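(* Let $n\ge2$ and let $\Sigma_+=\{X\in\mathbb{R}^{2n\times2n}:\det X>0\}$. If $\Omega\subset\mathbb{R}^{2n}$ is bounded, open, and connected and $\nu:\Omega\to\mathcal{P}(\mathbb{R}^{2n\times2n})$ is a $W^{1,2n}$ gradient Young measure which is supported in $L\cap\Sigma_+$, then $\nu$ is supported in $L_1\cap\Sigma_+$ or in $L_2\cap\Sigma_+$.
   Context: $L=L_1\cup L_2\subset\mathbb{R}^{2n\times2n}$, where in $n\times n$ block form $L_1=\left\{\begin{pmatrix}A&0\\0&D\end{pmatrix}\right\}$ and $L_2=\left\{\begin{pmatrix}0&B\\C&0\end{pmatrix}\right\}$ with $A,B,C,D\in\mathbb{R}^{n\times n}$ arbitrary. $\mathcal{P}(\mathbb{R}^{2n\times2n})$ is the set of (Borel) probability measures on $\mathbb{R}^{2n\times2n}$. A map $\nu:\Omega\to\mathcal{P}(\mathbb{R}^{2n\times2n})$, $x\mapsto\nu_x$, is a $W^{1,p}$ gradient Young measure if there exists a sequence of $W^{1,p}$ maps $f_j:\Omega\to\mathbb{R}^{2n}$ such that $|\nabla f_j|^p\rightharpoonup g$ weakly in $L^1(\Omega)$ for some $g\in L^1(\Omega)$ and, for every continuous $\psi:\mathbb{R}^{2n\times2n}\to\mathbb{R}$ with $|\psi(X)|\le C(1+|X|^p)$ for some $C>0$, one has $\psi\circ\nabla f_j\rightharpoonup\bar\psi$ weakly in $L^1(\Omega)$, where $\bar\psi(x)=\int_{\mathbb{R}^{2n\times2n}}\psi(X)\,d\nu_x(X)$ for a.e.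 $x\in\Omega$. A gradient Young measure $\nu$ is supported in a Borel set $A\subset\mathbb{R}^{2n\times2n}$ if $\nu_x(\mathbb{R}^{2n\times2n}\setminus A)=0$ for a.e. $x\in\Omega$. *)

theory Defs
  imports "HOL-Probability.Giry_Monad"
begin

definition partial_deriv :: "'m::finite \<Rightarrow> (real^'m \<Rightarrow> real) \<Rightarrow> real^'m \<Rightarrow> real" where
  "partial_deriv j \<phi> x = frechet_derivative \<phi> (at x) (axis j 1)"

primrec C_k :: "nat \<Rightarrow> (real^'m::finite \<Rightarrow> real) \<Rightarrow> bool" where
  "C_k 0 \<phi> \<longleftrightarrow> continuous_on UNIV \<phi>"
| "C_k (Suc k) \<phi> \<longleftrightarrow> (\<forall>x. \<phi> differentiable (at x)) \<and> (\<forall>j. C_k k (partial_deriv j \<phi>))"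

text \<open>The space \<open>C\<^sub>c\<^sup>\<infinity>(\<Omega>)\<close>; its elements are extended by zero to the whole space.\<close>

definition test_function :: "(real^'m::finite) set \<Rightarrow> (real^'m \<Rightarrow> real) \<Rightarrow> bool" where
  "test_function \<Omega> \<phi> \<longleftrightarrow>
     (\<forall>k. C_k k \<phi>) \<and> (\<exists>K. compact K \<and> K \<subseteq> \<Omega> \<and> (\<forall>x. x \<notin> K \<longrightarrow> \<phi> x = 0))"

text \<open>Functions on \<open>\<Omega>\<close> are total functions whose values outside \<open>\<Omega>\<close> are irrelevant. Elements of
  \<open>L\<^sup>p(\<Omega>)\<close> are represented by functions rather than by classes modulo null sets.\<close>

definition L_p :: "real \<Rightarrow> (real^'m::finite) set \<Rightarrow> (real^'m \<Rightarrow> 'b::euclidean_space) set" where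
  "L_p p \<Omega> = {f \<in> borel_measurable (lebesgue_on \<Omega>).
     integrable (lebesgue_on \<Omega>) (\<lambda>x. norm (f x) powr p)}"

definition L_infinity :: "(real^'m::finite) set \<Rightarrow> (real^'m \<Rightarrow> real) set" where
  "L_infinity \<Omega> = {h \<in> borel_measurable (lebesgue_on \<Omega>).
     \<exists>C. AE x in lebesgue_on \<Omega>. \<bar>h x\<bar> \<le> C}"

text \<open>\<open>f \<in> W\<^sup>1\<^sup>,\<^sup>p(\<Omega>)\<close> with weak gradient \<open>G\<close>, where the entry of \<open>G\<close> in row \<open>i\<close> and
  column \<open>j\<close> is \<open>\<partial>\<^sub>j f\<^sub>i\<close>. For \<open>p \<ge> 1\<close> both integrands below are integrable.\<close>

definition sobolev_with_gradient ::
  "real \<Rightarrow> (real^'m::finite) set \<Rightarrow> (real^'m \<Rightarrow> real^'k::finite) \<Rightarrow> (real^'m \<Rightarrow> real^'m^'k) \<Rightarrow> bool"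
where
  "sobolev_with_gradient p \<Omega> f G \<longleftrightarrow>
     f \<in> L_p p \<Omega> \<and> G \<in> L_p p \<Omega> \<and>
     (\<forall>\<phi>. test_function \<Omega> \<phi> \<longrightarrow>
        (\<forall>i j. (LINT x|lebesgue_on \<Omega>. f x $ i * partial_deriv j \<phi> x) =
             - (LINT x|lebesgue_on \<Omega>. G x $ i $ j * \<phi> x)))"

definition weakly_L1 ::
  "(real^'m::finite) set \<Rightarrow> (nat \<Rightarrow> real^'m \<Rightarrow> real) \<Rightarrow> (real^'m \<Rightarrow> real) \<Rightarrow> bool" where
  "weakly_L1 \<Omega> u v \<longleftrightarrow>
     (\<forall>j. integrable (lebesgue_on \<Omega>) (u j)) \<and> integrable (lebesgue_on \<Omega>) v \<and>
     (\<forall>h \<in> L_infinity \<Omega>.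
        (\<lambda>j. LINT x|lebesgue_on \<Omega>. u j x * h x) \<longlonglongrightarrow> (LINT x|lebesgue_on \<Omega>. v x * h x))"

text \<open>The integrability of \<open>\<psi>\<close> with respect to almost every \<open>\<nu>\<^sub>x\<close> is required explicitly, because
  the Bochner integral of a nonintegrable function is \<open>0\<close> by convention.\<close>

definition gradient_young_measure ::
  "real \<Rightarrow> (real^'m::finite) set \<Rightarrow> (real^'m \<Rightarrow> (real^'m^'k::finite) measure) \<Rightarrow> bool" where
  "gradient_young_measure p \<Omega> \<nu> \<longleftrightarrow>
     \<nu> \<in> \<Omega> \<rightarrow> space (prob_algebra borel) \<and>
     (\<exists>(f :: nat \<Rightarrow> real^'m \<Rightarrow> real^'k) G.
        (\<forall>j. sobolev_with_gradient p \<Omega> (f j) (G j)) \<and>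
        (\<exists>g. weakly_L1 \<Omega> (\<lambda>j x. norm (G j x) powr p) g) \<and>
        (\<forall>\<psi> :: real^'m^'k \<Rightarrow> real.
           continuous_on UNIV \<psi> \<and> (\<exists>C>0. \<forall>X. \<bar>\<psi> X\<bar> \<le> C * (1 + norm X powr p)) \<longrightarrow>
           (\<exists>\<psi>'. (AE x in lebesgue_on \<Omega>. integrable (\<nu> x) \<psi> \<and> \<psi>' x = (LINT X|\<nu> x. \<psi> X)) \<and>
                 weakly_L1 \<Omega> (\<lambda>j x. \<psi> (G j x)) \<psi>')))"

definition supported_in ::
  "(real^'m::finite) set \<Rightarrow> (real^'m \<Rightarrow> (real^'m^'k::finite) measure) \<Rightarrow> (real^'m^'k) set \<Rightarrow> bool" where
  "supported_in \<Omega> \<nu> A \<longleftrightarrow>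
     A \<in> sets borel \<and> (AE x in lebesgue_on \<Omega>. emeasure (\<nu> x) (UNIV - A) = 0)"

text \<open>The index type \<open>'n + 'n\<close> represents \<open>\<real>\<^sup>2\<^sup>n\<close> for \<open>n = CARD('n)\<close>: \<open>Inl\<close> and \<open>Inr\<close> give
  the first and the last \<open>n\<close> coordinates.\<close>

definition block_matrix ::
  "real^'n::finite^'n \<Rightarrow> real^'n^'n \<Rightarrow> real^'n^'n \<Rightarrow> real^'n^'n \<Rightarrow> real^('n + 'n)^('n + 'n)" where
  "block_matrix A B C D = (\<chi> i j.
     case (i, j) of
       (Inl a, Inl b) \<Rightarrow> A $ a $ b
     | (Inl a, Inr b) \<Rightarrow> B $ a $ b
     | (Inr a, Inl b) \<Rightarrow> C $ a $ b
     | (Inr a, Inr b) \<Rightarrow> D $ a $ b)"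

definition L1 :: "(real^('n + 'n)^('n::finite + 'n)) set" where
  "L1 = {block_matrix A 0 0 D | A D. True}"

definition L2 :: "(real^('n + 'n)^('n::finite + 'n)) set" where
  "L2 = {block_matrix 0 B C 0 | B C. True}"

definition L :: "(real^('n + 'n)^('n::finite + 'n)) set" where
  "L = L1 \<union> L2"

definition Sigma_plus :: "(real^'m^'m::finite) set" where
  "Sigma_plus = {X. det X > 0}"

end

theory Submission
  imports Defs "HOL-Computational_Algebra.Polynomial"
begin

text \<open>Write \<open>(x, y)\<close> for the two groups of coordinates and \<open>a, b, c, d\<close> for the determinants of
  the blocks \<open>A, B, C, D\<close> of a gradient. The \<open>y\<close>-derivatives of \<open>a\<close> are divergences in \<open>x\<close>
  of the minors of the same rows in which one \<open>x\<close>-column is replaced by a \<open>y\<close>-column; as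
  \<open>n \<ge> 2\<close>, these mixed minors vanish on \<open>L\<close>, so they tend to \<open>0\<close> in \<open>L\<^sup>2\<close> along the
  generating sequence. In this weak sense \<open>a\<close> and \<open>c\<close> oscillate in \<open>x\<close> only and \<open>b\<close> and \<open>d\<close>
  in \<open>y\<close> only, and averages over a small cube, with a cutoff of product form, decouple:
  \<open>\<langle>ad\<rangle> = \<langle>a\<rangle>\<langle>d\<rangle>\<close>, \<open>\<langle>cb\<rangle> = \<langle>c\<rangle>\<langle>b\<rangle>\<close> and \<open>\<langle>a\<rangle>\<langle>b\<rangle> = \<langle>ab\<rangle> = 0\<close>. Hence \<open>\<langle>ad\<rangle> = 0\<close> or
  \<open>\<langle>cb\<rangle> = 0\<close>. On \<open>L\<close> with positive determinant, \<open>ad\<close> and \<open>cb\<close> have a fixed sign and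
  exactly one of them vanishes, so on each small cube \<open>\<nu>\<^sub>x\<close> lives on one of the two
  components, and connectedness excludes a switch.

  The derivatives of \<open>a\<close> are small only as divergences, not as functions. This is handled by
  smoothing with a lazy random walk in the \<open>y\<close>-directions, whose finite differences satisfy the
  required bounds by elementary Hilbert space arguments.\<close>

section \<open>Lazy random walks of isometric translations\<close>

text \<open>Each factor of a pairing is merely bounded in L^2, so the smallness of the divergences
  cannot be inserted on either side alone. The walk splits one factor: R steps of length \<epsilon>
  / sqrt R spread it over the distance \<epsilon>, which bounds its derivatives by a multiple of 1 /
  \<epsilon> and lets the small divergence belonging to the other factor act on it. What the walk
  removes is again a divergence; integrating both divergences by parts leaves products of two small
  fields, linked by second differences of the summed walk. These are bounded independently of R, the
  discrete form of the L^2 bound of second derivatives by the Laplacian. A term without a small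
  field arises only where a derivative hits the cutoff, and it carries the factor \<epsilon>. The
  walk stands in for a heat flow, but it asks for nothing beyond isometric translations, finite sums
  and norms, so an incomplete space of functions suffices. The exponent 2n fits because products of
  two minors of order n grow like the power 2n: testing with squares of minors bounds them in L^2
  and makes the mixed ones vanish there.\<close>

locale translation_group =
  fixes tr :: "'v::real_vector \<Rightarrow> 'a::real_inner \<Rightarrow> 'a"
  assumes tr_linear: "linear (tr v)"
    and tr_zero [simp]: "tr 0 x = x"
    and tr_add: "tr (v + w) x = tr v (tr w x)"
    and tr_inner [simp]: "inner (tr v x) (tr v y) = inner x y"
begin

lemma tr_plus: "tr v (x + y) = tr v x + tr v y"
  and tr_diff: "tr v (x - y) = tr v x - tr v y"
  and tr_scaleR: "tr v (r *\<^sub>R x) = r *\<^sub>R tr v x"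
  and tr_sum: "tr v (\<Sum>i\<in>A. f i) = (\<Sum>i\<in>A. tr v (f i))"
  using tr_linear by (auto simp: linear_add linear_diff linear_cmul linear_neg linear_sum)

lemma norm_tr [simp]: "norm (tr v x) = norm x"
  by (simp add: norm_eq_sqrt_inner)

lemma tr_commute: "tr v (tr w x) = tr w (tr v x)"
  by (metis tr_add add.commute)

lemma tr_cancel [simp]: "tr v (tr (- v) x) = x" "tr (- v) (tr v x) = x"
  by (metis tr_add tr_zero add.right_inverse, metis tr_add tr_zero add.left_inverse)

lemma inner_tr_left: "inner (tr v x) y = inner x (tr (- v) y)"
  by (metis tr_inner tr_cancel(1))

definition shift_diff :: "'v \<Rightarrow> 'a \<Rightarrow> 'a" where
  "shift_diff v x = tr v x - x"

lemma shift_diff_add: "shift_diff v (x + y) = shift_diff v x + shift_diff v y"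
  and shift_diff_scaleR: "shift_diff v (r *\<^sub>R x) = r *\<^sub>R shift_diff v x"
  and shift_diff_sum: "shift_diff v (\<Sum>i\<in>A. f i) = (\<Sum>i\<in>A. shift_diff v (f i))"
  by (auto simp: shift_diff_def tr_plus tr_diff tr_scaleR tr_sum scaleR_diff_right sum_subtractf)

lemma shift_diff_linear: "linear (shift_diff v)"
  by (intro linearI shift_diff_add shift_diff_scaleR)

lemma inner_shift_diff: "inner (shift_diff v x) y = inner x (shift_diff (- v) y)"
  by (simp add: shift_diff_def inner_tr_left inner_diff_left inner_diff_right)

lemma shift_diff_commute: "shift_diff v (shift_diff w x) = shift_diff w (shift_diff v x)"
  using tr_commute[of v w x] by (simp add: shift_diff_def tr_diff)

text \<open>The walker rests with probability 1/2 and otherwise takes one of the 2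
  \<open>card Y\<close> moves along \<open>s k\<close> or \<open>- s k\<close>, each with
  probability 1 / (4 \<open>card Y\<close>); \<open>walk_step_average\<close> displays this form.
  The version with the discrete Laplacian is the one that energy identities start from.\<close>

definition walk_step :: "('m \<Rightarrow> 'v) \<Rightarrow> 'm set \<Rightarrow> 'a \<Rightarrow> 'a" where
  "walk_step s Y x = x - (1 / (4 * real (card Y))) *\<^sub>R (\<Sum>k\<in>Y. shift_diff (- s k) (shift_diff (s k) x))"

text \<open>A truncated Green operator: identity minus \<open>walk_step\<close> applied to it
  telescopes to identity minus the R-th power of \<open>walk_step\<close>.\<close>

definition walk_sum :: "('m \<Rightarrow> 'v) \<Rightarrow> 'm set \<Rightarrow> nat \<Rightarrow> 'a \<Rightarrow> 'a" where
  "walk_sum s Y R x = (\<Sum>r<R. (walk_step s Y ^^ r) x)"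

context
  fixes s :: "'m \<Rightarrow> 'v" and Y :: "'m set"
  assumes finY: "finite Y" and neY: "Y \<noteq> {}"
begin

private abbreviation "P \<equiv> walk_step s Y"
private abbreviation "c \<equiv> 1 / (4 * real (card Y))"
private abbreviation "N \<equiv> \<lambda>x. \<Sum>k\<in>Y. shift_diff (- s k) (shift_diff (s k) x)"

lemma c_pos: "c > 0"
  using finY neY by (simp add: card_gt_0_iff)

lemma card_pos: "real (card Y) > 0"
  using finY neY by (simp add: card_gt_0_iff)

lemma walk_step_average:
  "P x = (1/2) *\<^sub>R x + c *\<^sub>R (\<Sum>k\<in>Y. tr (s k) x + tr (- s k) x)"
proof -
  have "N x = (\<Sum>k\<in>Y. 2 *\<^sub>R x - (tr (s k) x + tr (- s k) x))"
    by (intro sum.cong refl) (simp add: shift_diff_def tr_diff scaleR_2)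
  also have "\<dots> = (2 * real (card Y)) *\<^sub>R x - (\<Sum>k\<in>Y. tr (s k) x + tr (- s k) x)"
    by (simp add: sum_subtractf sum_constant_scaleR mult.commute)
  finally have "c *\<^sub>R N x = (1/2) *\<^sub>R x - c *\<^sub>R (\<Sum>k\<in>Y. tr (s k) x + tr (- s k) x)"
    using card_pos by (simp add: scaleR_diff_right)
  then have "P x = x - ((1/2) *\<^sub>R x - c *\<^sub>R (\<Sum>k\<in>Y. tr (s k) x + tr (- s k) x))"
    by (simp only: walk_step_def)
  also have "\<dots> = (x - (1/2) *\<^sub>R x) + c *\<^sub>R (\<Sum>k\<in>Y. tr (s k) x + tr (- s k) x)"
    by (simp only: diff_diff_eq2 diff_add_eq)
  also have "x - (1/2) *\<^sub>R x = (1/2) *\<^sub>R x"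
    using scaleR_diff_left[of 1 "1/2" x] by simp
  finally show ?thesis .
qed

lemma norm_walk_step_le: "norm (P x) \<le> norm x"
proof -
  have "norm (P x) \<le> norm ((1/2) *\<^sub>R x) + norm (c *\<^sub>R (\<Sum>k\<in>Y. tr (s k) x + tr (- s k) x))"
    unfolding walk_step_average by (rule norm_triangle_ineq)
  also have "norm (c *\<^sub>R (\<Sum>k\<in>Y. tr (s k) x + tr (- s k) x)) \<le> c * (\<Sum>k\<in>Y. 2 * norm x)"
    using c_pos by (simp add: divide_right_mono del: sum_constant)
      (intro divide_right_mono sum_norm_le, auto intro: order_trans[OF norm_triangle_ineq])
  also have "c * (\<Sum>k\<in>Y. 2 * norm x) = norm x / 2"
    using card_pos by simp
  finally show ?thesis by simp
qed

lemma walk_step_linear: "linear P"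
  unfolding walk_step_def[abs_def]
  by (intro linear_compose_sub linear_compose_scale_right linear_compose_sum linear_id[unfolded id_def]
      linear_compose[OF shift_diff_linear shift_diff_linear, unfolded o_def] ballI)

lemma walk_step_add: "P (x + y) = P x + P y"
  and walk_step_diff: "P (x - y) = P x - P y"
  and walk_step_scaleR: "P (r *\<^sub>R x) = r *\<^sub>R P x"
  using walk_step_linear by (simp_all add: linear_add linear_diff linear_cmul)

lemma walk_step_zero: "P 0 = 0"
  using walk_step_scaleR[of 0 0] by simp

lemma walk_step_tr: "P (tr v x) = tr v (P x)"
proof -
  have "shift_diff w (tr v x) = tr v (shift_diff w x)" for w x
    by (simp add: shift_diff_def tr_diff tr_commute)
  then show ?thesis
    by (simp add: walk_step_def tr_diff tr_scaleR tr_sum)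
qed

lemma walk_step_shift_diff: "P (shift_diff v x) = shift_diff v (P x)"
  by (simp add: shift_diff_def walk_step_diff walk_step_tr)

lemma inner_walk_step: "inner (P x) y = inner x (P y)"
proof -
  have "inner (N x) y = inner x (N y)"
    by (simp add: inner_sum_left inner_sum_right inner_shift_diff)
  then show ?thesis
    by (simp add: walk_step_def inner_diff_left inner_diff_right)
qed

text \<open>This is the purpose of the laziness: the resting part contributes half the squared norm,
  and the translations, which carry total weight 1/2, can take away at most that much. The
  positivity drives the decay of energy in \<open>norm_shift_diff_pow_walk_step_le\<close>.\<close>

lemma inner_walk_step_nonneg: "inner (P x) x \<ge> 0"
proof -
  have *: "inner (tr v x) x \<ge> - (norm x)\<^sup>2" for v
    using Cauchy_Schwarz_ineq2[of "tr v x" x] by (simp add: power2_eq_square abs_le_iff)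
  have "inner (P x) x = (norm x)\<^sup>2 / 2 + c * (\<Sum>k\<in>Y. inner (tr (s k) x) x + inner (tr (- s k) x) x)"
    by (simp add: walk_step_average inner_add_left inner_sum_left power2_norm_eq_inner)
  moreover have "c * (\<Sum>k\<in>Y. inner (tr (s k) x) x + inner (tr (- s k) x) x)
      \<ge> c * (\<Sum>k\<in>Y. - 2 * (norm x)\<^sup>2)"
  proof (intro mult_left_mono sum_mono)
    show "- 2 * (norm x)\<^sup>2 \<le> inner (tr (s k) x) x + inner (tr (- s k) x) x" for k
      using *[of "s k"] *[of "- s k"] by linarith
  qed simp
  moreover have "c * (\<Sum>k\<in>Y. - 2 * (norm x)\<^sup>2) = - (norm x)\<^sup>2 / 2"
    using card_pos by (simp add: field_simps)
  ultimately show ?thesis by linarith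
qed

lemma diff_walk_step: "x - P x = c *\<^sub>R N x"
  by (simp add: walk_step_def)

lemma inner_N: "inner (N x) x = (\<Sum>k\<in>Y. (norm (shift_diff (s k) x))\<^sup>2)"
proof -
  have "inner (shift_diff (- s k) (shift_diff (s k) x)) x = (norm (shift_diff (s k) x))\<^sup>2" for k
    by (simp add: inner_shift_diff[of "- s k"] power2_norm_eq_inner)
  then show ?thesis
    by (simp add: inner_sum_left)
qed

lemma pow_walk_step_add: "(P ^^ r) (x + y) = (P ^^ r) x + (P ^^ r) y"
  by (induction r) (simp_all add: walk_step_add)

lemma pow_walk_step_scaleR: "(P ^^ r) (q *\<^sub>R x) = q *\<^sub>R (P ^^ r) x"
  by (induction r) (simp_all add: walk_step_scaleR)

lemma pow_walk_step_shift_diff: "(P ^^ r) (shift_diff v x) = shift_diff v ((P ^^ r) x)"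
  by (induction r) (simp_all add: walk_step_shift_diff)

lemma norm_pow_walk_step_le: "norm ((P ^^ r) x) \<le> norm x"
  by (induction r) (simp_all add: order_trans[OF norm_walk_step_le])

lemma pow_walk_step_linear: "linear (P ^^ r)"
  by (intro linearI pow_walk_step_add pow_walk_step_scaleR)

lemma inner_pow_walk_step: "inner ((P ^^ r) x) y = inner x ((P ^^ r) y)"
proof (induction r arbitrary: x y)
  case (Suc r)
  have "inner ((P ^^ Suc r) x) y = inner ((P ^^ r) x) (P y)"
    by (simp add: inner_walk_step)
  also have "\<dots> = inner x ((P ^^ Suc r) y)"
    by (simp add: Suc funpow_swap1)
  finally show ?case .
qed simp

private abbreviation "W \<equiv> walk_sum s Y"

lemma walk_sum_linear: "linear (W R)"
  by (intro linearI)
    (auto simp: walk_sum_def pow_walk_step_add pow_walk_step_scaleR sum.distrib scaleR_sum_right)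

lemma walk_sum_shift_diff: "W R (shift_diff v x) = shift_diff v (W R x)"
  by (simp add: walk_sum_def pow_walk_step_shift_diff shift_diff_sum)

lemma inner_walk_sum: "inner (W R x) y = inner x (W R y)"
  by (simp add: walk_sum_def inner_sum_left inner_sum_right inner_pow_walk_step)

lemma norm_walk_sum_le: "norm (W R x) \<le> R * norm x"
proof -
  have "norm (W R x) \<le> (\<Sum>r<R. norm x)"
    unfolding walk_sum_def by (intro sum_norm_le norm_pow_walk_step_le)
  then show ?thesis by simp
qed

lemma walk_sum_telescope: "c *\<^sub>R N (W R x) = x - (P ^^ R) x"
proof -
  have "W R x - P (W R x) = x - (P ^^ R) x"
  proof (induction R)
    case 0
    then show ?case by (simp add: walk_sum_def walk_step_zero)
  next
    case (Suc R)
    have "W (Suc R) x = W R x + (P ^^ R) x"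
      by (simp add: walk_sum_def)
    then have "W (Suc R) x - P (W (Suc R) x) = (W R x - P (W R x)) + ((P ^^ R) x - P ((P ^^ R) x))"
      by (simp add: walk_step_add)
    then show ?case
      by (simp add: Suc)
  qed
  then show ?thesis
    using diff_walk_step by metis
qed

text \<open>Energy estimate for the Green operator: the sum of its squared first differences is the
  pairing with its own Laplacian, and that Laplacian telescopes to \<open>x - (P ^^ R) x\<close>.
  Only the undifferentiated walk sum costs a factor R, so a single root of R survives.\<close>

lemma norm_shift_diff_walk_sum_le:
  assumes k: "k \<in> Y"
  shows "norm (shift_diff (s k) (W R x)) \<le> sqrt (2 * real R / c) * norm x"
proof (rule power2_le_imp_le)
  have "c * (norm (shift_diff (s k) (W R x)))\<^sup>2 \<le> c * (\<Sum>k\<in>Y. (norm (shift_diff (s k) (W R x)))\<^sup>2)"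
    using k finY c_pos by (intro mult_left_mono member_le_sum) auto
  also have "\<dots> = inner (x - (P ^^ R) x) (W R x)"
    by (simp only: inner_N[symmetric] walk_sum_telescope[symmetric] inner_scaleR_left)
  also have "\<dots> \<le> norm (x - (P ^^ R) x) * norm (W R x)"
    by (rule norm_cauchy_schwarz)
  also have "\<dots> \<le> (2 * norm x) * (real R * norm x)"
    using norm_pow_walk_step_le[of R x] norm_walk_sum_le[of R x]
    by (intro mult_mono) (auto intro: order_trans[OF norm_triangle_ineq4])
  finally have "c * (norm (shift_diff (s k) (W R x)))\<^sup>2 \<le> 2 * real R * (norm x)\<^sup>2"
    by (simp add: power2_eq_square algebra_simps)
  then show "(norm (shift_diff (s k) (W R x)))\<^sup>2 \<le> (sqrt (2 * real R / c) * norm x)\<^sup>2"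
    using c_pos card_pos by (simp add: power_mult_distrib real_sqrt_pow2 field_simps)
qed (use c_pos in auto)

text \<open>Since differences commute, summation by parts turns the sum of all squared second
  differences into the squared norm of the Laplacian. Up to the factor c, telescoping identifies the
  latter with \<open>x - (P ^^ R) x\<close>, so the bound does not grow with R; the whole method
  rests on this.\<close>

lemma norm_second_shift_diff_walk_sum_le:
  assumes i: "i \<in> Y" and k: "k \<in> Y"
  shows "norm (shift_diff (s i) (shift_diff (s k) (W R x))) \<le> 2 / c * norm x"
proof (rule power2_le_imp_le)
  let ?w = "W R x"
  have "(norm (shift_diff (s i) (shift_diff (s k) ?w)))\<^sup>2
      \<le> (\<Sum>i\<in>Y. (norm (shift_diff (s i) (shift_diff (s k) ?w)))\<^sup>2)"
    using i finY by (intro member_le_sum) auto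
  also have "\<dots> \<le> (\<Sum>k\<in>Y. \<Sum>i\<in>Y. (norm (shift_diff (s i) (shift_diff (s k) ?w)))\<^sup>2)"
    using k finY by (intro member_le_sum[where f="\<lambda>k. \<Sum>i\<in>Y. (norm (shift_diff (s i) (shift_diff (s k) ?w)))\<^sup>2"])
      (auto intro: sum_nonneg)
  also have "\<dots> = (\<Sum>k\<in>Y. inner (N (shift_diff (s k) ?w)) (shift_diff (s k) ?w))"
    by (simp only: inner_N)
  also have "\<dots> = (\<Sum>k\<in>Y. inner (shift_diff (s k) (N ?w)) (shift_diff (s k) ?w))"
    by (simp add: shift_diff_sum shift_diff_commute)
  also have "\<dots> = (\<Sum>k\<in>Y. inner (N ?w) (shift_diff (- s k) (shift_diff (s k) ?w)))"
    by (intro sum.cong refl) (rule inner_shift_diff)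
  also have "\<dots> = inner (N ?w) (N ?w)"
    by (simp only: inner_sum_right)
  finally have 1: "(norm (shift_diff (s i) (shift_diff (s k) ?w)))\<^sup>2 \<le> (norm (N ?w))\<^sup>2"
    by (simp add: power2_norm_eq_inner)
  have "c * norm (N ?w) = norm (x - (P ^^ R) x)"
    using c_pos by (simp add: walk_sum_telescope[symmetric])
  also have "\<dots> \<le> 2 * norm x"
    using norm_pow_walk_step_le[of R x] norm_triangle_ineq4[of x "(P ^^ R) x"] by linarith
  finally have "norm (N ?w) \<le> 2 / c * norm x"
    using c_pos card_pos by (simp add: field_simps)
  then show "(norm (shift_diff (s i) (shift_diff (s k) ?w)))\<^sup>2 \<le> (2 / c * norm x)\<^sup>2"
    using 1 by (meson order_trans power_mono norm_ge_zero)
qed (use c_pos in auto)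

text \<open>The Dirichlet energy does not increase along the walk and is at most the loss of squared
  norm in the next step. Adding these losses over R steps bounds R times the final energy by the
  initial squared norm.\<close>

lemma norm_shift_diff_pow_walk_step_le:
  assumes k: "k \<in> Y" and R: "R > 0"
  shows "norm (shift_diff (s k) ((P ^^ R) x)) \<le> norm x / sqrt (c * R)"
proof (rule power2_le_imp_le)
  define E where "E g = c * (\<Sum>k\<in>Y. (norm (shift_diff (s k) g))\<^sup>2)" for g
  have E_inner: "E g = inner (g - P g) g" for g
    unfolding E_def diff_walk_step inner_scaleR_left inner_N by simp
  \<comment> \<open>The right side minus the left side equals the pairing of
    \<open>P (g - P g)\<close> with \<open>g\<close>, a positive combination of the pairings of
    \<open>P (shift_diff (s k) g)\<close> with \<open>shift_diff (s k) g\<close>. Each is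
    nonnegative by laziness.\<close>
  have E_le: "E g \<le> (norm g)\<^sup>2 - (norm (P g))\<^sup>2" for g
  proof -
    have "inner (P (g - P g)) g = c * inner (P (N g)) g"
      by (simp only: diff_walk_step walk_step_scaleR inner_scaleR_left)
    also have "inner (P (N g)) g = (\<Sum>k\<in>Y. inner (P (shift_diff (s k) g)) (shift_diff (s k) g))"
    proof -
      have "inner (P (N g)) g = inner (N g) (P g)"
        by (rule inner_walk_step)
      also have "\<dots> = (\<Sum>k\<in>Y. inner (shift_diff (s k) g) (shift_diff (s k) (P g)))"
        by (simp add: inner_sum_left inner_shift_diff[of "- s _"])
      also have "\<dots> = (\<Sum>k\<in>Y. inner (P (shift_diff (s k) g)) (shift_diff (s k) g))"
        by (intro sum.cong refl) (simp add: walk_step_shift_diff inner_commute)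
      finally show ?thesis .
    qed
    finally have "inner (P (g - P g)) g \<ge> 0"
      using c_pos by (auto intro!: sum_nonneg inner_walk_step_nonneg divide_nonneg_nonneg)
    then show ?thesis
      by (simp add: E_inner walk_step_diff inner_diff_left power2_norm_eq_inner inner_walk_step)
  qed
  have E_mono: "E (P g) \<le> E g" for g
    unfolding E_def using c_pos
    by (intro mult_left_mono sum_mono power_mono) (auto simp: walk_step_shift_diff[symmetric] norm_walk_step_le)
  have E_anti: "E ((P ^^ q) g) \<le> E g" for q g
    by (induction q) (auto intro: order_trans[OF E_mono])
  have "R * E ((P ^^ R) x) = (\<Sum>r<R. E ((P ^^ R) x))"
    by simp
  also have "\<dots> \<le> (\<Sum>r<R. (norm ((P ^^ r) x))\<^sup>2 - (norm ((P ^^ Suc r) x))\<^sup>2)"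
  proof (rule sum_mono)
    fix r assume "r \<in> {..<R}"
    then have "E ((P ^^ R) x) = E ((P ^^ (R - r)) ((P ^^ r) x))"
      by (metis funpow_add o_apply le_add_diff_inverse2 lessThan_iff less_imp_le)
    also have "\<dots> \<le> E ((P ^^ r) x)"
      by (rule E_anti)
    also have "\<dots> \<le> (norm ((P ^^ r) x))\<^sup>2 - (norm ((P ^^ Suc r) x))\<^sup>2"
      using E_le by simp
    finally show "E ((P ^^ R) x) \<le> (norm ((P ^^ r) x))\<^sup>2 - (norm ((P ^^ Suc r) x))\<^sup>2" .
  qed
  also have "\<dots> \<le> (norm x)\<^sup>2"
    by (subst sum_lessThan_telescope') simp
  finally have 1: "R * E ((P ^^ R) x) \<le> (norm x)\<^sup>2" .
  have "c * (norm (shift_diff (s k) ((P ^^ R) x)))\<^sup>2 \<le> E ((P ^^ R) x)"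
    unfolding E_def using k finY c_pos by (intro mult_left_mono member_le_sum) auto
  then have "R * (c * (norm (shift_diff (s k) ((P ^^ R) x)))\<^sup>2) \<le> (norm x)\<^sup>2"
    using 1 R by (meson mult_left_mono of_nat_0_le_iff order_trans)
  moreover have "c * real R > 0" "sqrt (c * real R) ^ 2 = c * real R"
    using R c_pos by (simp, subst real_sqrt_pow2, auto)
  ultimately show "(norm (shift_diff (s k) ((P ^^ R) x)))\<^sup>2 \<le> (norm x / sqrt (c * R))\<^sup>2"
    using R card_pos by (simp only: power_divide) (simp add: field_simps)
qed (use c_pos R in auto)

lemma diff_pow_walk_step:
  "x - (P ^^ R) x = c *\<^sub>R (\<Sum>k\<in>Y. shift_diff (- s k) (W R (shift_diff (s k) x)))"
  by (simp add: walk_sum_telescope[symmetric] walk_sum_shift_diff)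

end

section \<open>Strong derivatives along translations and the coupling estimate\<close>

definition has_strong_deriv :: "'v \<Rightarrow> 'a \<Rightarrow> 'a \<Rightarrow> bool" where
  "has_strong_deriv v x x' \<longleftrightarrow> ((\<lambda>h. (1 / h) *\<^sub>R shift_diff (h *\<^sub>R v) x) \<longlongrightarrow> x') (at 0)"

lemma has_strong_deriv_bounded_linear:
  assumes "has_strong_deriv v x x'" and T: "linear T" and B: "\<And>y. norm (T y) \<le> B * norm y"
    and comm: "\<And>w y. T (shift_diff w y) = shift_diff w (T y)"
  shows "has_strong_deriv v (T x) (T x')"
proof -
  have T': "bounded_linear T"
    using T B by (intro bounded_linear_intro[of T B])
      (auto simp: linear_add linear_cmul mult.commute)
  have "((\<lambda>h. T ((1 / h) *\<^sub>R shift_diff (h *\<^sub>R v) x)) \<longlongrightarrow> T x') (at 0)"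
    using assms(1) unfolding has_strong_deriv_def by (rule bounded_linear.tendsto[OF T'])
  then show ?thesis
    unfolding has_strong_deriv_def by (simp add: linear_cmul[OF T] comm)
qed

text \<open>Integration by parts without integrals: the adjoint of a difference along
  \<open>h *\<^sub>R v\<close> is the difference along its negative, and replacing h by -h in the
  difference quotient produces the minus sign.\<close>

lemma inner_strong_deriv:
  assumes x: "has_strong_deriv v x x'" and y: "has_strong_deriv v y y'"
  shows "inner x' y = - inner x y'"
proof -
  have 1: "((\<lambda>h. inner ((1 / h) *\<^sub>R shift_diff (h *\<^sub>R v) x) y) \<longlongrightarrow> inner x' y) (at 0)"
    using x unfolding has_strong_deriv_def by (intro tendsto_intros)
  have "filterlim uminus (at (0::real)) (at 0)"
    unfolding filterlim_at by (auto simp: eventually_at_filter intro!: tendsto_eq_intros)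
  then have "((\<lambda>h. (1 / - h) *\<^sub>R shift_diff (- h *\<^sub>R v) y) \<longlongrightarrow> y') (at 0)"
    using y unfolding has_strong_deriv_def by (rule filterlim_compose[rotated])
  then have "((\<lambda>h. - inner x ((1 / - h) *\<^sub>R shift_diff (- h *\<^sub>R v) y)) \<longlongrightarrow> - inner x y') (at 0)"
    by (intro tendsto_intros)
  moreover have "(\<lambda>h. - inner x ((1 / - h) *\<^sub>R shift_diff (- h *\<^sub>R v) y))
      = (\<lambda>h. inner ((1 / h) *\<^sub>R shift_diff (h *\<^sub>R v) x) y)"
    using inner_shift_diff[of _ x y] by auto
  ultimately have "((\<lambda>h. inner ((1 / h) *\<^sub>R shift_diff (h *\<^sub>R v) x) y) \<longlongrightarrow> - inner x y') (at 0)"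
    by (simp only:)
  then show ?thesis
    using 1 tendsto_unique[OF trivial_limit_at] by blast
qed

text \<open>On the scale \<open>h = \<epsilon> / sqrt R\<close> the derivatives of \<open>P\<^sup>R U\<close> are bounded
  uniformly in \<open>R\<close>, so \<open>weak\<close> applies to it, while \<open>U - P\<^sup>R U\<close> is a divergence in the
  directions \<open>Y\<close>. Moving this divergence onto \<open>U\<close> and the one in \<open>m'\<close> onto \<open>V\<close> leaves
  second differences of the walk sum, which are again bounded uniformly in \<open>R\<close>.\<close>

lemma coupling_estimate_discrete:
  fixes e :: "'m \<Rightarrow> 'v" and R :: nat
  assumes finX: "finite X" and finY: "finite Y" and neY: "Y \<noteq> {}"
    and U: "\<And>k. k \<in> Y \<Longrightarrow> has_strong_deriv (e k) U ((\<Sum>l\<in>X. m' l k) + r k)"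
    and m: "\<And>l k. l \<in> X \<Longrightarrow> k \<in> Y \<Longrightarrow> has_strong_deriv (e l) (m l k) (m' l k)"
    and V: "\<And>l. l \<in> X \<Longrightarrow> has_strong_deriv (e l) V ((\<Sum>k\<in>Y. \<mu>' k l) + p l)"
    and \<mu>: "\<And>k l. k \<in> Y \<Longrightarrow> l \<in> X \<Longrightarrow> has_strong_deriv (e k) (\<mu> k l) (\<mu>' k l)"
    and weak: "\<And>g g'. (\<And>k. k \<in> Y \<Longrightarrow> has_strong_deriv (e k) g (g' k)) \<Longrightarrow>
      \<bar>inner g V\<bar> \<le> \<kappa>0 * norm g + \<kappa>1 * (\<Sum>k\<in>Y. norm (g' k))"
    and \<epsilon>: "\<epsilon> > 0" and \<kappa>: "\<kappa>0 \<ge> 0" "\<kappa>1 \<ge> 0" and R: "R > 0"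
  defines "c \<equiv> 1 / (4 * real (card Y))" and "h \<equiv> \<epsilon> / sqrt R"
  defines "eU \<equiv> \<lambda>k. (1 / h) *\<^sub>R shift_diff (h *\<^sub>R e k) U - ((\<Sum>l\<in>X. m' l k) + r k)"
    and "e\<mu> \<equiv> \<lambda>k l. (1 / h) *\<^sub>R shift_diff (h *\<^sub>R e k) (\<mu> k l) - \<mu>' k l"
  shows "\<bar>inner U V\<bar> \<le> \<kappa>0 * norm U + \<kappa>1 * (\<Sum>k\<in>Y. norm U / (\<epsilon> * sqrt c) + norm (eU k))
    + (\<Sum>k\<in>Y. \<epsilon> * sqrt (2 * c) * (norm (r k) + norm (eU k)) * norm V
        + (\<Sum>l\<in>X. \<epsilon> * sqrt (2 * c) * norm (m l k) * (norm (p l) + (\<Sum>i\<in>Y. norm (e\<mu> i l)))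
            + (\<Sum>i\<in>Y. 2 * norm (m l k) * norm (\<mu> i l))))"
proof -
  \<comment> \<open>The choice of \<open>h\<close> ties the step length to the number of steps, so
    that the walk always spreads over the distance \<epsilon>. Multiplication by h turns the factor
    sqrt R in the first differences of \<open>?S\<close> into \<epsilon>, and division by h turns
    the factor 1 / sqrt R in those of \<open>?P\<close> into 1 / \<epsilon>.\<close>
  define s where "s k = h *\<^sub>R e k" for k
  have h: "h > 0"
    using \<epsilon> R by (simp add: h_def)
  have c: "c > 0"
    using finY neY by (simp add: c_def card_gt_0_iff)
  have c': "1 / (4 * real (card Y)) = c"
    by (simp add: c_def)
  note walk = finY neY
  let ?P = "walk_step s Y ^^ R" and ?S = "walk_sum s Y R"
  have S_le: "norm (shift_diff (s k) (?S x)) \<le> sqrt (2 * real R / c) * norm x" if "k \<in> Y" for k x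
    using norm_shift_diff_walk_sum_le[OF walk that] by (simp add: c')
  have SS_le: "norm (shift_diff (s i) (shift_diff (s k) (?S x))) \<le> 2 / c * norm x"
    if "i \<in> Y" "k \<in> Y" for i k x
    using norm_second_shift_diff_walk_sum_le[OF walk that] by (simp add: c')
  have P_le: "norm (shift_diff (s k) (?P x)) \<le> norm x / sqrt (c * R)" if "k \<in> Y" for k x
    using norm_shift_diff_pow_walk_step_le[OF walk that R] by (simp add: c')
  have chS: "c * h * sqrt (2 * real R / c) = \<epsilon> * sqrt (2 * c)"
  proof -
    have "c * sqrt (2 * real R / c) = sqrt (c\<^sup>2 * (2 * real R / c))"
      using c by (simp only: real_sqrt_mult) simp
    also have "c\<^sup>2 * (2 * real R / c) = R * (2 * c)"
      using c by (simp add: power2_eq_square)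
    finally have "(c * sqrt (2 * real R / c)) * h = sqrt (R * (2 * c)) * h"
      by simp
    also have "\<dots> = \<epsilon> * sqrt (2 * c)"
      using R by (simp add: h_def real_sqrt_mult)
    finally show ?thesis
      by (simp add: mult.commute mult.left_commute)
  qed
  have hP: "norm x / sqrt (c * R) / h = norm x / (\<epsilon> * sqrt c)" for x :: 'a
    using R by (simp add: h_def real_sqrt_mult)
  have lin_P: "linear ?P" and lin_S: "linear ?S"
    by (rule pow_walk_step_linear[OF walk] walk_sum_linear[OF walk])+
  define U' where "U' k = (\<Sum>l\<in>X. m' l k) + r k" for k
  have eU: "U' k = (1 / h) *\<^sub>R shift_diff (s k) U - eU k" for k
    by (simp add: eU_def U'_def s_def)
  \<comment> \<open>The smoothed part. Its derivatives \<open>?P (U' k)\<close> are differences of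
    \<open>?P U\<close> at scale h up to the error \<open>eU\<close>, hence bounded uniformly in R,
    and \<open>weak\<close> may be used with \<open>g\<close> equal to \<open>?P U\<close>.\<close>
  have 1: "\<bar>inner (?P U) V\<bar> \<le> \<kappa>0 * norm U + \<kappa>1 * (\<Sum>k\<in>Y. norm U / (\<epsilon> * sqrt c) + norm (eU k))"
  proof -
    have "has_strong_deriv (e k) (?P U) (?P (U' k))" if "k \<in> Y" for k
      using U[OF that] unfolding U'_def
      by (rule has_strong_deriv_bounded_linear[where B=1])
        (use lin_P norm_pow_walk_step_le[OF walk] pow_walk_step_shift_diff[OF walk] in auto)
    then have "\<bar>inner (?P U) V\<bar> \<le> \<kappa>0 * norm (?P U) + \<kappa>1 * (\<Sum>k\<in>Y. norm (?P (U' k)))"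
      by (rule weak)
    also have "\<dots> \<le> \<kappa>0 * norm U + \<kappa>1 * (\<Sum>k\<in>Y. norm U / (\<epsilon> * sqrt c) + norm (eU k))"
    proof (intro add_mono mult_left_mono sum_mono \<kappa> norm_pow_walk_step_le[OF walk])
      fix k assume k: "k \<in> Y"
      have "?P (U' k) = (1 / h) *\<^sub>R shift_diff (s k) (?P U) - ?P (eU k)"
        by (simp add: eU linear_diff[OF lin_P] linear_cmul[OF lin_P] pow_walk_step_shift_diff[OF walk])
      then have "norm (?P (U' k)) \<le> norm (shift_diff (s k) (?P U)) / h + norm (?P (eU k))"
        using h norm_triangle_ineq4[of "(1 / h) *\<^sub>R shift_diff (s k) (?P U)" "?P (eU k)"] by simp
      also have "\<dots> \<le> (norm U / sqrt (c * R)) / h + norm (eU k)"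
        using h by (intro add_mono divide_right_mono P_le k norm_pow_walk_step_le[OF walk]) simp
      finally show "norm (?P (U' k)) \<le> norm U / (\<epsilon> * sqrt c) + norm (eU k)"
        by (simp only: hP)
    qed
    finally show ?thesis .
  qed
  define G where "G k = shift_diff (s k) (?S V)" for k
  have G_le: "c * h * norm (G k) \<le> \<epsilon> * sqrt (2 * c) * norm V" if "k \<in> Y" for k
  proof -
    have "c * h * norm (G k) \<le> c * h * (sqrt (2 * real R / c) * norm V)"
      unfolding G_def using h c by (intro mult_left_mono S_le that) auto
    then show ?thesis
      by (metis (no_types) chS mult.assoc)
  qed
  \<comment> \<open>The part removed by the walk is a divergence of walk sums. Moving the outer
    difference and the walk sum onto \<open>V\<close> leaves first differences of \<open>U\<close>,
    which are the derivatives \<open>U' k\<close> up to \<open>eU\<close>.\<close>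
  have 2: "inner (U - ?P U) V = (\<Sum>k\<in>Y. c * h * inner (U' k + eU k) (G k))"
  proof -
    have "inner (U - ?P U) V = c * (\<Sum>k\<in>Y. inner (shift_diff (- s k) (?S (shift_diff (s k) U))) V)"
      by (simp only: diff_pow_walk_step[OF walk] c' inner_scaleR_left inner_sum_left)
    also have "\<dots> = c * (\<Sum>k\<in>Y. inner (shift_diff (s k) U) (G k))"
    proof (intro arg_cong[where f="\<lambda>t. c * t"] sum.cong refl)
      fix k
      have "inner (shift_diff (- s k) (?S (shift_diff (s k) U))) V = inner (?S (shift_diff (s k) U)) (shift_diff (s k) V)"
        using inner_shift_diff[of "- s k"] by simp
      also have "\<dots> = inner (shift_diff (s k) U) (G k)"
        unfolding G_def inner_walk_sum[OF walk] by (simp only: walk_sum_shift_diff[OF walk])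
      finally show "inner (shift_diff (- s k) (?S (shift_diff (s k) U))) V = inner (shift_diff (s k) U) (G k)" .
    qed
    also have "\<dots> = c * (\<Sum>k\<in>Y. h * inner (U' k + eU k) (G k))"
      using h by (simp add: eU)
    finally show ?thesis
      by (simp add: sum_distrib_left mult.assoc)
  qed
  \<comment> \<open>The terms with \<open>m'\<close>. The derivative along \<open>e l\<close> moves
    onto \<open>V\<close>, where it becomes the divergence of \<open>\<mu>'\<close> plus
    \<open>p\<close>. Replacing \<open>\<mu>'\<close> by difference quotients produces second
    differences of the walk sum: the factor h cancels against 1 / h, and c * (2 / c) is the constant
    2.\<close>
  have 3: "\<bar>c * h * inner (m' l k) (G k)\<bar> \<le> \<epsilon> * sqrt (2 * c) * norm (m l k) * (norm (p l) + (\<Sum>i\<in>Y. norm (e\<mu> i l)))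
            + (\<Sum>i\<in>Y. 2 * norm (m l k) * norm (\<mu> i l))" if l: "l \<in> X" and k: "k \<in> Y" for l k
  proof -
    let ?T = "\<lambda>x. shift_diff (s k) (?S x)"
    have lin_T: "linear ?T"
      using linear_compose[OF lin_S shift_diff_linear[of "s k"]] by (simp add: o_def)
    have T_le: "c * h * norm (?T x) \<le> \<epsilon> * sqrt (2 * c) * norm x" for x
    proof -
      have "c * h * norm (?T x) \<le> c * h * (sqrt (2 * real R / c) * norm x)"
        using h c by (intro mult_left_mono S_le k) auto
      then show ?thesis
        by (metis (no_types) chS mult.assoc)
    qed
    have "has_strong_deriv (e l) (?T V) (?T ((\<Sum>i\<in>Y. \<mu>' i l) + p l))"
      using V[OF l]
    proof (rule has_strong_deriv_bounded_linear[where T="?T" and B="sqrt (2 * real R / c)"])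
      show "?T (shift_diff w y) = shift_diff w (?T y)" for w y
        by (simp add: walk_sum_shift_diff[OF walk] shift_diff_commute)
    qed (auto intro: S_le k lin_T)
    then have "inner (m' l k) (G k) = - inner (m l k) (?T ((\<Sum>i\<in>Y. \<mu>' i l) + p l))"
      unfolding G_def by (rule inner_strong_deriv[OF m[OF l k]])
    then have "\<bar>c * h * inner (m' l k) (G k)\<bar>
        \<le> c * h * (norm (m l k) * norm (?T ((\<Sum>i\<in>Y. \<mu>' i l) + p l)))"
      using h c Cauchy_Schwarz_ineq2[of "m l k" "?T ((\<Sum>i\<in>Y. \<mu>' i l) + p l)"]
      by (simp add: abs_mult mult_left_mono)
    also have "?T ((\<Sum>i\<in>Y. \<mu>' i l) + p l)
        = (1 / h) *\<^sub>R (\<Sum>i\<in>Y. shift_diff (s i) (?T (\<mu> i l))) + ?T (p l - (\<Sum>i\<in>Y. e\<mu> i l))"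
    proof -
      have "(\<Sum>i\<in>Y. \<mu>' i l) + p l
          = (1 / h) *\<^sub>R (\<Sum>i\<in>Y. shift_diff (s i) (\<mu> i l)) + (p l - (\<Sum>i\<in>Y. e\<mu> i l))"
        by (simp add: e\<mu>_def sum_subtractf s_def scaleR_sum_right)
      then have "?T ((\<Sum>i\<in>Y. \<mu>' i l) + p l)
          = (1 / h) *\<^sub>R (\<Sum>i\<in>Y. ?T (shift_diff (s i) (\<mu> i l))) + ?T (p l - (\<Sum>i\<in>Y. e\<mu> i l))"
        by (simp only: linear_add[OF lin_T] linear_cmul[OF lin_T] linear_sum[OF lin_T])
      also have "(\<Sum>i\<in>Y. ?T (shift_diff (s i) (\<mu> i l))) = (\<Sum>i\<in>Y. shift_diff (s i) (?T (\<mu> i l)))"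
        by (intro sum.cong refl) (simp only: walk_sum_shift_diff[OF walk] shift_diff_commute)
      finally show ?thesis .
    qed
    also have "c * h * (norm (m l k) * norm \<dots>)
        \<le> norm (m l k) * (c * norm (\<Sum>i\<in>Y. shift_diff (s i) (?T (\<mu> i l))))
          + norm (m l k) * (c * h * norm (?T (p l - (\<Sum>i\<in>Y. e\<mu> i l))))"
    proof -
      let ?a = "\<Sum>i\<in>Y. shift_diff (s i) (?T (\<mu> i l))" and ?b = "?T (p l - (\<Sum>i\<in>Y. e\<mu> i l))"
      have "h * norm ((1 / h) *\<^sub>R ?a + ?b) \<le> norm ?a + h * norm ?b"
        using h mult_left_mono[OF norm_triangle_ineq[of "(1 / h) *\<^sub>R ?a" ?b], of h]
        by (simp add: distrib_left)
      then have "c * norm (m l k) * (h * norm ((1 / h) *\<^sub>R ?a + ?b)) \<le> c * norm (m l k) * (norm ?a + h * norm ?b)"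
        using c by (intro mult_left_mono) auto
      then show ?thesis
        by (simp add: algebra_simps)
    qed
    also have "\<dots> \<le> norm (m l k) * (\<Sum>i\<in>Y. 2 * norm (\<mu> i l))
          + norm (m l k) * (\<epsilon> * sqrt (2 * c) * (norm (p l) + (\<Sum>i\<in>Y. norm (e\<mu> i l))))"
    proof (intro add_mono mult_left_mono)
      have "norm (\<Sum>i\<in>Y. shift_diff (s i) (?T (\<mu> i l))) \<le> (\<Sum>i\<in>Y. 2 / c * norm (\<mu> i l))"
        by (intro sum_norm_le SS_le k)
      then have "c * norm (\<Sum>i\<in>Y. shift_diff (s i) (?T (\<mu> i l))) \<le> c * (\<Sum>i\<in>Y. 2 / c * norm (\<mu> i l))"
        using c by (intro mult_left_mono) auto
      then show "c * norm (\<Sum>i\<in>Y. shift_diff (s i) (?T (\<mu> i l))) \<le> (\<Sum>i\<in>Y. 2 * norm (\<mu> i l))"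
        using c by (simp add: sum_distrib_left)
      have "norm (p l - (\<Sum>i\<in>Y. e\<mu> i l)) \<le> norm (p l) + (\<Sum>i\<in>Y. norm (e\<mu> i l))"
        by (intro order_trans[OF norm_triangle_ineq4] add_left_mono norm_sum)
      then have "\<epsilon> * sqrt (2 * c) * norm (p l - (\<Sum>i\<in>Y. e\<mu> i l))
          \<le> \<epsilon> * sqrt (2 * c) * (norm (p l) + (\<Sum>i\<in>Y. norm (e\<mu> i l)))"
        using c \<epsilon> by (intro mult_left_mono) auto
      then show "c * h * norm (?T (p l - (\<Sum>i\<in>Y. e\<mu> i l)))
          \<le> \<epsilon> * sqrt (2 * c) * (norm (p l) + (\<Sum>i\<in>Y. norm (e\<mu> i l)))"
        using T_le order_trans by blast
    qed auto
    finally show ?thesis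
      by (simp add: sum_distrib_left algebra_simps)
  qed
  have 4: "\<bar>inner (U - ?P U) V\<bar> \<le> (\<Sum>k\<in>Y. \<epsilon> * sqrt (2 * c) * (norm (r k) + norm (eU k)) * norm V
        + (\<Sum>l\<in>X. \<epsilon> * sqrt (2 * c) * norm (m l k) * (norm (p l) + (\<Sum>i\<in>Y. norm (e\<mu> i l)))
            + (\<Sum>i\<in>Y. 2 * norm (m l k) * norm (\<mu> i l))))"
    unfolding 2
  proof (rule order_trans[OF sum_abs sum_mono])
    fix k assume k: "k \<in> Y"
    have "c * h * inner (U' k + eU k) (G k) = (\<Sum>l\<in>X. c * h * inner (m' l k) (G k))
        + c * h * inner (r k + eU k) (G k)"
      by (simp add: U'_def inner_add_left inner_sum_left sum_distrib_left algebra_simps)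
    then have "\<bar>c * h * inner (U' k + eU k) (G k)\<bar> \<le> (\<Sum>l\<in>X. \<bar>c * h * inner (m' l k) (G k)\<bar>)
        + \<bar>c * h * inner (r k + eU k) (G k)\<bar>"
      using sum_abs[of "\<lambda>l. c * h * inner (m' l k) (G k)" X] by linarith
    moreover have "\<bar>c * h * inner (r k + eU k) (G k)\<bar> \<le> \<epsilon> * sqrt (2 * c) * (norm (r k) + norm (eU k)) * norm V"
    proof -
      have "\<bar>c * h * inner (r k + eU k) (G k)\<bar> \<le> c * h * (norm (r k + eU k) * norm (G k))"
        using h c Cauchy_Schwarz_ineq2[of "r k + eU k" "G k"] by (simp add: abs_mult mult_left_mono)
      also have "\<dots> = norm (r k + eU k) * (c * h * norm (G k))"
        by simp
      also have "\<dots> \<le> (norm (r k) + norm (eU k)) * (\<epsilon> * sqrt (2 * c) * norm V)"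
        using h c by (intro mult_mono G_le k norm_triangle_ineq) auto
      finally show ?thesis
        by (simp add: algebra_simps)
    qed
    moreover have "(\<Sum>l\<in>X. \<bar>c * h * inner (m' l k) (G k)\<bar>) \<le> (\<Sum>l\<in>X. \<epsilon> * sqrt (2 * c) * norm (m l k) * (norm (p l) + (\<Sum>i\<in>Y. norm (e\<mu> i l)))
            + (\<Sum>i\<in>Y. 2 * norm (m l k) * norm (\<mu> i l)))"
      by (intro sum_mono 3 k)
    ultimately show "\<bar>c * h * inner (U' k + eU k) (G k)\<bar> \<le> \<epsilon> * sqrt (2 * c) * (norm (r k) + norm (eU k)) * norm V
        + (\<Sum>l\<in>X. \<epsilon> * sqrt (2 * c) * norm (m l k) * (norm (p l) + (\<Sum>i\<in>Y. norm (e\<mu> i l)))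
            + (\<Sum>i\<in>Y. 2 * norm (m l k) * norm (\<mu> i l)))"
      by linarith
  qed
  have "inner U V = inner (?P U) V + inner (U - ?P U) V"
    by (simp add: inner_diff_left)
  then show ?thesis
    using 1 4 by linarith
qed

text \<open>With \<epsilon> fixed, R tends to infinity. Then h tends to 0 and the discretisation
  errors \<open>eU\<close> and \<open>e\<mu>\<close> vanish by the definition of the strong
  derivative, while everything else in the discrete bound is independent of R.\<close>

lemma coupling_estimate:
  fixes e :: "'m \<Rightarrow> 'v"
  assumes finX: "finite X" and finY: "finite Y" and neY: "Y \<noteq> {}"
    and U: "\<And>k. k \<in> Y \<Longrightarrow> has_strong_deriv (e k) U ((\<Sum>l\<in>X. m' l k) + r k)"
    and m: "\<And>l k. l \<in> X \<Longrightarrow> k \<in> Y \<Longrightarrow> has_strong_deriv (e l) (m l k) (m' l k)"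
    and V: "\<And>l. l \<in> X \<Longrightarrow> has_strong_deriv (e l) V ((\<Sum>k\<in>Y. \<mu>' k l) + p l)"
    and \<mu>: "\<And>k l. k \<in> Y \<Longrightarrow> l \<in> X \<Longrightarrow> has_strong_deriv (e k) (\<mu> k l) (\<mu>' k l)"
    and weak: "\<And>g g'. (\<And>k. k \<in> Y \<Longrightarrow> has_strong_deriv (e k) g (g' k)) \<Longrightarrow>
      \<bar>inner g V\<bar> \<le> \<kappa>0 * norm g + \<kappa>1 * (\<Sum>k\<in>Y. norm (g' k))"
    and \<epsilon>: "\<epsilon> > 0" and \<kappa>: "\<kappa>0 \<ge> 0" "\<kappa>1 \<ge> 0"
  defines "c \<equiv> 1 / (4 * real (card Y))"
  shows "\<bar>inner U V\<bar> \<le> \<kappa>0 * norm U + \<kappa>1 * (\<Sum>k\<in>Y. norm U / (\<epsilon> * sqrt c))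
    + (\<Sum>k\<in>Y. \<epsilon> * sqrt (2 * c) * norm (r k) * norm V
        + (\<Sum>l\<in>X. \<epsilon> * sqrt (2 * c) * norm (m l k) * norm (p l)
            + (\<Sum>i\<in>Y. 2 * norm (m l k) * norm (\<mu> i l))))"
proof -
  define h where "h R = \<epsilon> / sqrt (real (Suc R))" for R
  define eU where "eU R k = (1 / h R) *\<^sub>R shift_diff (h R *\<^sub>R e k) U - ((\<Sum>l\<in>X. m' l k) + r k)" for R k
  define e\<mu> where "e\<mu> R k l = (1 / h R) *\<^sub>R shift_diff (h R *\<^sub>R e k) (\<mu> k l) - \<mu>' k l" for R k l
  have h0: "h \<longlonglongrightarrow> 0"
  proof -
    have "(\<lambda>R. \<epsilon> / sqrt (real R)) \<longlonglongrightarrow> 0"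
      by (intro tendsto_divide_0[OF tendsto_const] filterlim_at_top_imp_at_infinity
          filterlim_compose[OF sqrt_at_top filterlim_real_sequentially])
    then show ?thesis
      unfolding h_def[abs_def] by (subst filterlim_sequentially_Suc)
  qed
  have h: "filterlim h (at 0) sequentially"
    using h0 \<epsilon> by (auto simp: filterlim_at h_def)
  have eU0: "(\<lambda>R. norm (eU R k)) \<longlonglongrightarrow> 0" if "k \<in> Y" for k
    using filterlim_compose[OF U[OF that, unfolded has_strong_deriv_def] h]
    unfolding eU_def by (intro tendsto_norm_zero) (rule LIM_zero)
  have e\<mu>0: "(\<lambda>R. norm (e\<mu> R k l)) \<longlonglongrightarrow> 0" if "k \<in> Y" "l \<in> X" for k l
    using filterlim_compose[OF \<mu>[OF that, unfolded has_strong_deriv_def] h]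
    unfolding e\<mu>_def by (intro tendsto_norm_zero) (rule LIM_zero)
  define B where "B R = \<kappa>0 * norm U + \<kappa>1 * (\<Sum>k\<in>Y. norm U / (\<epsilon> * sqrt c) + norm (eU R k))
    + (\<Sum>k\<in>Y. \<epsilon> * sqrt (2 * c) * (norm (r k) + norm (eU R k)) * norm V
        + (\<Sum>l\<in>X. \<epsilon> * sqrt (2 * c) * norm (m l k) * (norm (p l) + (\<Sum>i\<in>Y. norm (e\<mu> R i l)))
            + (\<Sum>i\<in>Y. 2 * norm (m l k) * norm (\<mu> i l))))" for R
  have le: "\<bar>inner U V\<bar> \<le> B R" for R
    unfolding B_def eU_def e\<mu>_def c_def h_def
    by (rule coupling_estimate_discrete[OF finX finY neY U m V \<mu> weak \<epsilon> \<kappa>]) auto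
  have "B \<longlonglongrightarrow> \<kappa>0 * norm U + \<kappa>1 * (\<Sum>k\<in>Y. norm U / (\<epsilon> * sqrt c) + 0)
    + (\<Sum>k\<in>Y. \<epsilon> * sqrt (2 * c) * (norm (r k) + 0) * norm V
        + (\<Sum>l\<in>X. \<epsilon> * sqrt (2 * c) * norm (m l k) * (norm (p l) + (\<Sum>i\<in>Y. 0))
            + (\<Sum>i\<in>Y. 2 * norm (m l k) * norm (\<mu> i l))))"
    unfolding B_def by (intro tendsto_intros eU0 e\<mu>0)
  from tendsto_lowerbound[OF this] le show ?thesis
    by (simp add: always_eventually)
qed

end

section \<open>Compactly supported functions as an inner product space\<close>

definition cc_function :: "('a::euclidean_space \<Rightarrow> real) \<Rightarrow> bool" where
  "cc_function f \<longleftrightarrow> continuous_on UNIV f \<and> (\<exists>B. \<forall>x. norm x > B \<longrightarrow> f x = 0)"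

lemma cc_function_continuous: "cc_function f \<Longrightarrow> continuous_on S f"
  by (auto simp: cc_function_def intro: continuous_on_subset)

lemma cc_function_zero: "cc_function (\<lambda>x. 0)"
  by (simp add: cc_function_def)

lemma cc_function_add:
  assumes "cc_function f" "cc_function g"
  shows "cc_function (\<lambda>x. f x + g x)"
proof -
  obtain A B where "\<And>x. norm x > A \<Longrightarrow> f x = 0" "\<And>x. norm x > B \<Longrightarrow> g x = 0"
    using assms unfolding cc_function_def by blast
  then have "\<forall>x. norm x > max A B \<longrightarrow> f x + g x = 0"
    by simp
  then show ?thesis
    using assms unfolding cc_function_def by (auto intro!: continuous_intros exI[of _ "max A B"])
qed

lemma cc_function_mult:
  assumes "cc_function f" "continuous_on UNIV g"
  shows "cc_function (\<lambda>x. f x * g x)" "cc_function (\<lambda>x. g x * f x)"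
  using assms unfolding cc_function_def by (auto intro!: continuous_intros)

lemma cc_function_cmult: "cc_function f \<Longrightarrow> cc_function (\<lambda>x. r * f x)"
  by (rule cc_function_mult) auto

lemma cc_function_minus: "cc_function f \<Longrightarrow> cc_function (\<lambda>x. - f x)"
  using cc_function_cmult[of f "-1"] by simp

lemma cc_function_diff: "cc_function f \<Longrightarrow> cc_function g \<Longrightarrow> cc_function (\<lambda>x. f x - g x)"
  using cc_function_add[OF _ cc_function_minus, of f g] by simp

lemma cc_function_sum: "(\<And>i. i \<in> I \<Longrightarrow> cc_function (f i)) \<Longrightarrow> cc_function (\<lambda>x. \<Sum>i\<in>I. f i x)"
  by (induction I rule: infinite_finite_induct) (auto intro: cc_function_zero cc_function_add)

lemma cc_function_shift:
  assumes "cc_function f"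
  shows "cc_function (\<lambda>x. f (x + v))"
proof -
  obtain B where B: "\<And>x. norm x > B \<Longrightarrow> f x = 0"
    using assms unfolding cc_function_def by blast
  have "f (x + v) = 0" if "norm x > B + norm v" for x
    using that norm_triangle_ineq4[of "x + v" v] by (intro B) simp
  moreover have "continuous_on UNIV (\<lambda>x. f (x + v))"
    using assms unfolding cc_function_def
    by (intro continuous_on_compose2[of UNIV f _ "\<lambda>x. x + v"]) (auto intro!: continuous_on_add)
  ultimately show ?thesis
    unfolding cc_function_def by blast
qed

lemma integrable_cc_function:
  assumes "cc_function f"
  shows "integrable lborel f"
proof -
  obtain B where B: "\<And>x. norm x > B \<Longrightarrow> f x = 0"
    using assms unfolding cc_function_def by blast
  have "integrable lborel (\<lambda>x. indicator (cball 0 B) x *\<^sub>R f x)"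
    using assms by (intro borel_integrable_compact cc_function_continuous) auto
  moreover have "(\<lambda>x. indicator (cball 0 B) x *\<^sub>R f x) = f"
    using B by (intro ext) (force simp: indicator_def)
  ultimately show ?thesis by simp
qed

lemma bounded_cc_function:
  assumes "cc_function f"
  shows "\<exists>C\<ge>0. \<forall>x. \<bar>f x\<bar> \<le> C"
proof -
  obtain B where B: "\<And>x. norm x > B \<Longrightarrow> f x = 0"
    using assms unfolding cc_function_def by blast
  have "bounded (f ` cball 0 B)"
    using assms by (intro compact_imp_bounded compact_continuous_image cc_function_continuous) auto
  then obtain C where "\<forall>x\<in>cball 0 B. \<bar>f x\<bar> \<le> C"
    unfolding bounded_iff by auto
  then have "\<bar>f x\<bar> \<le> max C 0" for x
    using B[of x] by (cases "norm x > B") (auto simp: max.coboundedI1)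
  then show ?thesis
    by (intro exI[of _ "max C 0"]) auto
qed

lemma integral_lborel_shift:
  fixes f :: "'a::euclidean_space \<Rightarrow> real"
  assumes "f \<in> borel_measurable borel"
  shows "(LINT x|lborel. f (x + v)) = (LINT x|lborel. f x)"
proof -
  have "(LINT x|lborel. f x) = (LINT x|distr lborel borel ((+) v). f x)"
    by (simp add: lborel_distr_plus)
  also have "\<dots> = (LINT x|lborel. f (v + x))"
    using assms by (intro integral_distr) auto
  finally show ?thesis by (simp add: add.commute)
qed

text \<open>The set where f does not vanish is open and null, hence empty. This definiteness is the
  reason for working with continuous functions: the L^2 pairing is an inner product on the functions
  themselves, without classes modulo null sets.\<close>

lemma cc_function_square_integral_zero:
  assumes "cc_function f" "(LINT x|lborel. f x * f x) = 0"
  shows "f x = 0"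
proof -
  have "integrable lborel (\<lambda>x. f x * f x)"
    using assms by (intro integrable_cc_function cc_function_mult cc_function_continuous)
  then have "AE x in lborel. f x * f x = 0"
    using integral_nonneg_eq_0_iff_AE[of lborel "\<lambda>x. f x * f x"] assms(2) by simp
  then have "AE x in lborel. f x = 0"
    by simp
  moreover have op: "open {x. f x \<noteq> 0}"
    using assms(1) by (intro open_Collect_neq cc_function_continuous continuous_intros)
  ultimately have "{x. f x \<noteq> 0} \<in> null_sets lborel"
    by (subst (asm) AE_iff_null) auto
  then have "negligible {x. f x \<noteq> 0}"
    by (simp add: negligible_iff_null_sets null_sets_completionI)
  then have "{x. f x \<noteq> 0} = {}"
    using op open_not_negligible by blast
  then show ?thesis by blast
qed

typedef (overloaded) 'a::euclidean_space cc = "{f :: 'a \<Rightarrow> real. cc_function f}"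
  morphisms cc_apply Abs_cc
  using cc_function_zero by blast

setup_lifting type_definition_cc

lemma cc_function_cc_apply [simp]: "cc_function (cc_apply f)"
  using cc_apply by blast

instantiation cc :: (euclidean_space) real_vector
begin

lift_definition zero_cc :: "'a cc" is "\<lambda>x. 0" by (rule cc_function_zero)
lift_definition plus_cc :: "'a cc \<Rightarrow> 'a cc \<Rightarrow> 'a cc" is "\<lambda>f g x. f x + g x" by (rule cc_function_add)
lift_definition minus_cc :: "'a cc \<Rightarrow> 'a cc \<Rightarrow> 'a cc" is "\<lambda>f g x. f x - g x" by (rule cc_function_diff)
lift_definition uminus_cc :: "'a cc \<Rightarrow> 'a cc" is "\<lambda>f x. - f x" by (rule cc_function_minus)
lift_definition scaleR_cc :: "real \<Rightarrow> 'a cc \<Rightarrow> 'a cc" is "\<lambda>r f x. r * f x" by (rule cc_function_cmult)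
instance
proof
  fix f g h :: "'a cc" and r q :: real
  show "f + g + h = f + (g + h)" "f + g = g + f" "0 + f = f" "- f + f = 0" "f - g = f + - g"
    by (transfer; simp add: fun_eq_iff)+
  show "r *\<^sub>R (f + g) = r *\<^sub>R f + r *\<^sub>R g" "(r + q) *\<^sub>R f = r *\<^sub>R f + q *\<^sub>R f"
    "r *\<^sub>R q *\<^sub>R f = (r * q) *\<^sub>R f" "1 *\<^sub>R f = f"
    by (transfer; simp add: fun_eq_iff algebra_simps)+
qed

end

instantiation cc :: (euclidean_space) real_inner
begin

lift_definition inner_cc :: "'a cc \<Rightarrow> 'a cc \<Rightarrow> real" is "\<lambda>f g. LINT x|lborel. f x * g x" .

definition norm_cc :: "'a cc \<Rightarrow> real" where "norm_cc f = sqrt (inner f f)"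
definition dist_cc :: "'a cc \<Rightarrow> 'a cc \<Rightarrow> real" where "dist_cc f g = norm (f - g)"
definition sgn_cc :: "'a cc \<Rightarrow> 'a cc" where "sgn_cc f = f /\<^sub>R norm f"
definition uniformity_cc :: "('a cc \<times> 'a cc) filter" where
  "uniformity_cc = (INF e\<in>{0 <..}. principal {(x, y). dist x y < e})"
definition open_cc :: "'a cc set \<Rightarrow> bool" where
  "open_cc S = (\<forall>x\<in>S. \<forall>\<^sub>F (x', y) in uniformity. x' = x \<longrightarrow> y \<in> S)"

instance
proof
  fix f g h :: "'a cc" and r :: real
  show "inner f g = inner g f"
    by transfer (simp add: mult.commute)
  show "inner (f + g) h = inner f h + inner g h"
    by transfer (simp add: distrib_right integrable_cc_function cc_function_mult cc_function_continuous)
  show "inner (r *\<^sub>R f) g = r * inner f g"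
    by transfer (simp add: mult.assoc)
  show "0 \<le> inner f f"
    by transfer simp
  show "(inner f f = 0) = (f = 0)"
    by transfer (auto intro: cc_function_square_integral_zero)
  show "norm f = sqrt (inner f f)"
    by (rule norm_cc_def)
  show "dist f g = norm (f - g)"
    by (rule dist_cc_def)
  show "sgn f = f /\<^sub>R norm f"
    by (rule sgn_cc_def)
  show "(uniformity :: ('a cc \<times> 'a cc) filter) = (INF e\<in>{0 <..}. principal {(x, y). dist x y < e})"
    by (rule uniformity_cc_def)
  show "open S = (\<forall>x\<in>S. \<forall>\<^sub>F (x', y) in uniformity. x' = x \<longrightarrow> y \<in> S)" for S :: "'a cc set"
    by (rule open_cc_def)
qed

end

lift_definition cc_shift :: "'a::euclidean_space \<Rightarrow> 'a cc \<Rightarrow> 'a cc" is "\<lambda>v f x. f (x + v)"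
  by (rule cc_function_shift)

interpretation cc: translation_group cc_shift
proof
  fix v w :: 'a and f g :: "'a cc" and r :: real
  show "cc_shift v (f + g) = cc_shift v f + cc_shift v g" "cc_shift v (r *\<^sub>R f) = r *\<^sub>R cc_shift v f"
    "cc_shift 0 f = f" "cc_shift (v + w) f = cc_shift v (cc_shift w f)"
    by (transfer; simp add: fun_eq_iff add.assoc)+
  show "inner (cc_shift v f) (cc_shift v g) = inner f g"
    by transfer (rule integral_lborel_shift, rule borel_measurable_continuous_onI,
        intro continuous_intros cc_function_continuous)
qed

lemma norm_cc_le:
  fixes f :: "'a::euclidean_space cc"
  assumes bound: "\<And>x. \<bar>cc_apply f x\<bar> \<le> \<delta>" and supp: "\<And>x. norm x > B \<Longrightarrow> cc_apply f x = 0"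
  shows "norm f \<le> \<delta> * sqrt (measure lborel (cball (0::'a) B))"
proof (rule power2_le_imp_le)
  have \<delta>: "\<delta> \<ge> 0"
    using bound[of 0] by linarith
  have "(norm f)\<^sup>2 = (LINT x|lborel. cc_apply f x * cc_apply f x)"
    by (simp add: power2_norm_eq_inner inner_cc.rep_eq)
  also have "\<dots> \<le> (LINT x|lborel. indicator (cball (0::'a) B) x * \<delta>\<^sup>2)"
  proof (rule integral_mono)
    show "integrable lborel (\<lambda>x. cc_apply f x * cc_apply f x)"
      by (intro integrable_cc_function cc_function_mult cc_function_continuous cc_function_cc_apply)
    show "integrable lborel (\<lambda>x::'a. indicator (cball 0 B) x * \<delta>\<^sup>2)"
      by (intro integrable_mult_left integrable_real_indicator) (auto simp: emeasure_bounded_finite infinity_ennreal_def[symmetric] simp del: infinity_ennreal_def)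
    show "cc_apply f x * cc_apply f x \<le> indicator (cball 0 B) x * \<delta>\<^sup>2" for x
    proof (cases "x \<in> cball 0 B")
      case True
      have "(cc_apply f x)\<^sup>2 \<le> \<delta>\<^sup>2"
        using bound[of x] \<delta> by (simp add: abs_le_square_iff[symmetric])
      then show ?thesis using True by (simp add: power2_eq_square)
    qed (use supp[of x] in auto)
  qed
  also have "\<dots> = \<delta>\<^sup>2 * measure lborel (cball (0::'a) B)"
    by (simp add: mult.commute)
  also have "\<dots> = (\<delta> * sqrt (measure lborel (cball (0::'a) B)))\<^sup>2"
    by (simp add: power_mult_distrib)
  finally show "(norm f)\<^sup>2 \<le> (\<delta> * sqrt (measure lborel (cball (0::'a) B)))\<^sup>2" .
  show "0 \<le> \<delta> * sqrt (measure lborel (cball (0::'a) B))"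
    using \<delta> by simp
qed

section \<open>Continuously differentiable functions as strongly differentiable vectors\<close>

definition C1_gradient :: "('a::euclidean_space \<Rightarrow> real) \<Rightarrow> ('a \<Rightarrow> 'a) \<Rightarrow> bool" where
  "C1_gradient f f' \<longleftrightarrow> (\<forall>x. GDERIV f x :> f' x) \<and> continuous_on UNIV f'"

lemma C1_gradient_continuous: "C1_gradient f f' \<Longrightarrow> continuous_on S f"
  unfolding C1_gradient_def gderiv_def
  by (meson has_derivative_continuous continuous_at_imp_continuous_on)

lemma C1_gradient_mult:
  assumes "C1_gradient f f'" "C1_gradient g g'"
  shows "C1_gradient (\<lambda>x. f x * g x) (\<lambda>x. f x *\<^sub>R g' x + g x *\<^sub>R f' x)"
proof -
  have "continuous_on UNIV (\<lambda>x. f x *\<^sub>R g' x + g x *\<^sub>R f' x)"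
    using assms C1_gradient_continuous[OF assms(1)] C1_gradient_continuous[OF assms(2)]
    unfolding C1_gradient_def by (intro continuous_on_add continuous_on_scaleR) auto
  then show ?thesis
    using assms unfolding C1_gradient_def by (simp add: GDERIV_mult)
qed

lemma C1_gradient_add:
  "C1_gradient f f' \<Longrightarrow> C1_gradient g g' \<Longrightarrow> C1_gradient (\<lambda>x. f x + g x) (\<lambda>x. f' x + g' x)"
  unfolding C1_gradient_def by (simp add: GDERIV_add continuous_on_add)

lemma C1_gradient_diff:
  "C1_gradient f f' \<Longrightarrow> C1_gradient g g' \<Longrightarrow> C1_gradient (\<lambda>x. f x - g x) (\<lambda>x. f' x - g' x)"
  unfolding C1_gradient_def by (simp add: GDERIV_diff continuous_on_diff)

lemma C1_gradient_shift:
  assumes "C1_gradient f f'"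
  shows "C1_gradient (\<lambda>x. f (x + v)) (\<lambda>x. f' (x + v))"
proof -
  have "GDERIV (\<lambda>x. f (x + v)) x :> f' (x + v)" for x
  proof -
    have "((\<lambda>x. x + v) has_derivative (\<lambda>h. h)) (at x)"
      by (auto intro!: derivative_eq_intros)
    from has_derivative_compose[OF this, of f "\<lambda>h. inner h (f' (x + v))"] show ?thesis
      using assms unfolding C1_gradient_def gderiv_def by simp
  qed
  moreover have "continuous_on UNIV (\<lambda>x. f' (x + v))"
    using assms unfolding C1_gradient_def
    by (intro continuous_on_compose2[of UNIV f' _ "\<lambda>x. x + v"]) (auto intro!: continuous_on_add)
  ultimately show ?thesis
    unfolding C1_gradient_def by blast
qed

lemma C1_gradient_along_line:
  assumes "C1_gradient f f'"
  shows "((\<lambda>s. f (x + s *\<^sub>R v)) has_real_derivative inner v (f' (x + s *\<^sub>R v))) (at s)"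
proof -
  have "((\<lambda>s. x + s *\<^sub>R v) has_derivative (\<lambda>h. h *\<^sub>R v)) (at s)"
    by (auto intro!: derivative_eq_intros)
  moreover have "(f has_derivative (\<lambda>h. inner h (f' (x + s *\<^sub>R v)))) (at (x + s *\<^sub>R v))"
    using assms unfolding C1_gradient_def gderiv_def by blast
  ultimately have "((\<lambda>s. f (x + s *\<^sub>R v)) has_derivative (\<lambda>h. inner (h *\<^sub>R v) (f' (x + s *\<^sub>R v)))) (at s)"
    by (rule has_derivative_compose)
  then show ?thesis
    by (simp add: has_field_derivative_def mult_commute_abs)
qed

lemma C1_gradient_zero_outside:
  assumes f: "C1_gradient f f'" and B: "\<And>x. norm x > B \<Longrightarrow> f x = 0" and x: "norm x > B"
  shows "f' x = 0"
proof -
  have "open {x::'a. norm x > B}"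
    by (intro open_Collect_less continuous_intros)
  then have "(f has_derivative (\<lambda>h. 0)) (at x)"
    using x B by (auto intro!: has_derivative_transform_within_open[of "\<lambda>x. 0" "\<lambda>h. 0" x UNIV "{x. norm x > B}", OF has_derivative_const])
  moreover have "(f has_derivative (\<lambda>h. inner h (f' x))) (at x)"
    using f unfolding C1_gradient_def gderiv_def by blast
  ultimately have "(\<lambda>h. 0) = (\<lambda>h. inner h (f' x))"
    by (rule has_derivative_unique)
  then have "inner (f' x) (f' x) = 0"
    by metis
  then show ?thesis by simp
qed

lemma cc_function_directional:
  assumes "C1_gradient f f'" "cc_function f"
  shows "cc_function (\<lambda>x. inner v (f' x))"
proof -
  obtain B where "\<And>x. norm x > B \<Longrightarrow> f x = 0"
    using assms unfolding cc_function_def by blast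
  then have "\<And>x. norm x > B \<Longrightarrow> f' x = 0"
    using C1_gradient_zero_outside[OF assms(1)] by blast
  moreover have "continuous_on UNIV (\<lambda>x. inner v (f' x))"
    using assms unfolding C1_gradient_def by (intro continuous_intros) auto
  ultimately show ?thesis
    unfolding cc_function_def by (metis inner_zero_right)
qed

text \<open>By the mean value theorem the difference quotient is the directional derivative at a
  point no farther away than the translation. Uniform continuity makes the error uniformly small,
  and since all supports lie in one ball, uniform smallness is smallness in norm.\<close>

lemma has_strong_deriv_C1:
  assumes f: "C1_gradient f f'" "cc_function f"
  shows "cc.has_strong_deriv v (Abs_cc f) (Abs_cc (\<lambda>x. inner v (f' x)))"
proof -
  define D where "D x = inner v (f' x)" for x
  have D: "cc_function D"
    unfolding D_def[abs_def] by (rule cc_function_directional[OF f])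
  obtain B0 where B0: "\<And>x. norm x > B0 \<Longrightarrow> f x = 0"
    using f unfolding cc_function_def by blast
  define B where "B = max B0 0"
  have B: "norm x > B \<Longrightarrow> f x = 0" "B \<ge> 0" for x
    using B0 by (simp_all add: B_def)
  \<comment> \<open>This ball contains the supports of the difference quotients for all
    \<bar>h\<bar> \<le> 1, which is why \<open>q\<close> below is capped by 1. Uniform continuity is
    taken on a ball larger by another \<open>norm v\<close>, since the intermediate points may leave
    this one.\<close>
  define B' where "B' = B + norm v"
  define M where "M = sqrt (measure lborel (cball (0::'a) B'))"
  have "(\<lambda>h. norm ((1 / h) *\<^sub>R cc.shift_diff (h *\<^sub>R v) (Abs_cc f) - Abs_cc D)) \<midarrow>0\<rightarrow> 0"
  proof (rule tendstoI)
    fix e :: real assume e: "e > 0"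
    define \<delta> where "\<delta> = e / (M + 1)"
    have M: "M \<ge> 0" by (simp add: M_def)
    then have \<delta>: "\<delta> > 0" using e by (simp add: \<delta>_def)
    have "uniformly_continuous_on (cball 0 (B' + norm v)) D"
      by (intro compact_uniformly_continuous cc_function_continuous D) simp
    then obtain d where d: "d > 0" "\<And>x y. x \<in> cball 0 (B' + norm v) \<Longrightarrow> y \<in> cball 0 (B' + norm v) \<Longrightarrow> dist x y < d \<Longrightarrow> dist (D x) (D y) < \<delta>"
      using \<delta> unfolding uniformly_continuous_on_def by metis
    define q where "q = min 1 (d / (norm v + 1))"
    have "norm ((1 / h) *\<^sub>R cc.shift_diff (h *\<^sub>R v) (Abs_cc f) - Abs_cc D) < e"
      if h: "h \<noteq> 0" "\<bar>h\<bar> < q" for h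
    proof -
      let ?g = "(1 / h) *\<^sub>R cc.shift_diff (h *\<^sub>R v) (Abs_cc f) - Abs_cc D"
      have g: "cc_apply ?g x = (1 / h) * (f (x + h *\<^sub>R v) - f x) - D x" for x
        by (simp add: minus_cc.rep_eq scaleR_cc.rep_eq cc.shift_diff_def cc_shift.rep_eq Abs_cc_inverse f D)
      have hv: "norm (h *\<^sub>R v) \<le> norm v" "norm (h *\<^sub>R v) < d"
      proof -
        show "norm (h *\<^sub>R v) \<le> norm v"
          using h by (simp add: q_def mult_left_le_one_le)
        have "norm (h *\<^sub>R v) \<le> \<bar>h\<bar> * (norm v + 1)"
          by (simp add: mult_left_mono)
        also have "\<dots> < d / (norm v + 1) * (norm v + 1)"
          using h by (intro mult_strict_right_mono) (auto simp: q_def add_nonneg_pos)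
        finally show "norm (h *\<^sub>R v) < d"
          by (simp add: add_nonneg_pos order.strict_implies_not_eq[symmetric] split: if_splits)
      qed
      have mvt: "\<exists>\<theta>. \<bar>\<theta>\<bar> \<le> 1 \<and> f (x + h *\<^sub>R v) - f x = h * D (x + \<theta> *\<^sub>R (h *\<^sub>R v))" for x
      proof -
        have "((\<lambda>s. f (x + s *\<^sub>R (h *\<^sub>R v))) has_real_derivative inner (h *\<^sub>R v) (f' (x + s *\<^sub>R (h *\<^sub>R v)))) (at s)" for s
          by (rule C1_gradient_along_line[OF f(1)])
        then obtain \<theta> where "0 < \<theta>" "\<theta> < 1" "f (x + 1 *\<^sub>R (h *\<^sub>R v)) - f (x + 0 *\<^sub>R (h *\<^sub>R v)) = (1 - 0) * inner (h *\<^sub>R v) (f' (x + \<theta> *\<^sub>R (h *\<^sub>R v)))"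
          using MVT2[of 0 1 "\<lambda>s. f (x + s *\<^sub>R (h *\<^sub>R v))" "\<lambda>s. inner (h *\<^sub>R v) (f' (x + s *\<^sub>R (h *\<^sub>R v)))"] by auto
        then show ?thesis
          by (intro exI[of _ \<theta>]) (simp add: D_def)
      qed
      have "norm ?g \<le> \<delta> * M"
        unfolding M_def
      proof (rule norm_cc_le)
        fix x :: 'a
        obtain \<theta> where \<theta>: "\<bar>\<theta>\<bar> \<le> 1" "f (x + h *\<^sub>R v) - f x = h * D (x + \<theta> *\<^sub>R (h *\<^sub>R v))"
          using mvt by blast
        let ?y = "x + \<theta> *\<^sub>R (h *\<^sub>R v)"
        have y: "norm (\<theta> *\<^sub>R (h *\<^sub>R v)) \<le> norm (h *\<^sub>R v)"
          using \<theta>(1) mult_left_le_one_le[of "\<bar>h\<bar> * norm v" "\<bar>\<theta>\<bar>"] by (simp add: abs_mult mult.assoc)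
        have eq: "cc_apply ?g x = D ?y - D x"
          unfolding g \<theta>(2) using h by simp
        have zero: "D z = 0" if "norm z > B" for z
          using C1_gradient_zero_outside[OF f(1) B(1) that] by (simp add: D_def)
        have far: "D ?y = 0 \<and> D x = 0" if "norm x > B'"
        proof -
          have "norm ?y \<ge> norm x - norm v"
            using y hv(1) norm_diff_ineq[of x "\<theta> *\<^sub>R (h *\<^sub>R v)"] by linarith
          then show ?thesis
            using that norm_ge_zero[of v] unfolding B'_def by (intro conjI zero; linarith)
        qed
        show "cc_apply ?g x = 0" if "norm x > B'"
          using far[OF that] eq by simp
        show "\<bar>cc_apply ?g x\<bar> \<le> \<delta>"
        proof (cases "norm x > B'")
          case True
          then show ?thesis using far eq \<delta> by simp
        next
          case False
          have "norm ?y \<le> B' + norm v"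
            using False y hv(1) norm_triangle_ineq[of x "\<theta> *\<^sub>R (h *\<^sub>R v)"] by linarith
          moreover have "norm x \<le> B' + norm v"
            using False norm_ge_zero[of v] by linarith
          moreover have "dist ?y x < d"
            using y hv(2) by (simp add: dist_norm)
          ultimately have "dist (D ?y) (D x) < \<delta>"
            by (intro d(2)) auto
          then show ?thesis
            by (simp add: eq dist_real_def)
        qed
      qed
      also have "\<delta> * M < e"
        using e M by (simp add: \<delta>_def field_simps)
      finally show ?thesis .
    qed
    moreover have "q > 0"
      using d(1) by (simp add: q_def add_nonneg_pos)
    ultimately show "\<forall>\<^sub>F h in at 0. dist (norm ((1 / h) *\<^sub>R cc.shift_diff (h *\<^sub>R v) (Abs_cc f) - Abs_cc D)) 0 < e"
      by (auto simp: eventually_at intro!: exI[of _ q])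
  qed
  then show ?thesis
    unfolding cc.has_strong_deriv_def D_def[abs_def, symmetric]
    by (rule LIM_zero_cancel[OF tendsto_norm_zero_cancel])
qed

section \<open>Weak limits of products\<close>

text \<open>Pairing an orbit with a fixed vector gives a real function of the translation parameter,
  to which the mean value theorem applies; the vector-valued orbit itself has no such
  theorem.\<close>

lemma (in translation_group) DERIV_inner_shift:
  assumes "has_strong_deriv v x x'"
  shows "((\<lambda>r. inner y (tr (r *\<^sub>R v) x)) has_real_derivative inner y (tr (r *\<^sub>R v) x')) (at r)"
proof -
  have "((\<lambda>h. inner (tr (- (r *\<^sub>R v)) y) ((1 / h) *\<^sub>R shift_diff (h *\<^sub>R v) x)) \<longlongrightarrow> inner (tr (- (r *\<^sub>R v)) y) x') (at 0)"
    using assms unfolding has_strong_deriv_def by (intro tendsto_intros)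
  moreover have "(\<lambda>h. inner (tr (- (r *\<^sub>R v)) y) ((1 / h) *\<^sub>R shift_diff (h *\<^sub>R v) x))
      = (\<lambda>h. (inner y (tr ((r + h) *\<^sub>R v) x) - inner y (tr (r *\<^sub>R v) x)) / h)"
    by (auto simp: shift_diff_def inner_tr_left[of "- _"] tr_scaleR tr_diff inner_diff_right
        scaleR_add_left tr_add)
  ultimately show ?thesis
    by (simp add: DERIV_def inner_tr_left)
qed

lemma inner_Abs_cc:
  "cc_function f \<Longrightarrow> cc_function g \<Longrightarrow> inner (Abs_cc f) (Abs_cc g) = (LINT x|lborel. f x * g x)"
  by (simp add: inner_cc.rep_eq Abs_cc_inverse)

lemma Abs_cc_add: "cc_function f \<Longrightarrow> cc_function g \<Longrightarrow> Abs_cc (\<lambda>x. f x + g x) = Abs_cc f + Abs_cc g"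
  and Abs_cc_diff: "cc_function f \<Longrightarrow> cc_function g \<Longrightarrow> Abs_cc (\<lambda>x. f x - g x) = Abs_cc f - Abs_cc g"
  and Abs_cc_shift: "cc_function f \<Longrightarrow> Abs_cc (\<lambda>x. f (x + v)) = cc_shift v (Abs_cc f)"
  and Abs_cc_cmult: "cc_function f \<Longrightarrow> Abs_cc (\<lambda>x. r * f x) = r *\<^sub>R Abs_cc f"
  and Abs_cc_zero: "Abs_cc (\<lambda>x. 0) = 0"
  by (simp_all add: cc_apply_inject[symmetric] plus_cc.rep_eq minus_cc.rep_eq cc_shift.rep_eq scaleR_cc.rep_eq
      zero_cc.rep_eq Abs_cc_inverse cc_function_add cc_function_diff cc_function_shift cc_function_cmult cc_function_zero)

lemma Abs_cc_sum:
  "(\<And>i. i \<in> I \<Longrightarrow> cc_function (f i)) \<Longrightarrow> Abs_cc (\<lambda>x. \<Sum>i\<in>I. f i x) = (\<Sum>i\<in>I. Abs_cc (f i))"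
  by (induction I rule: infinite_finite_induct) (simp_all add: Abs_cc_zero Abs_cc_add cc_function_sum)

lemma norm_Abs_cc_mult_le:
  assumes f: "cc_function f" and \<eta>: "continuous_on UNIV \<eta>" and E: "\<And>x. \<bar>\<eta> x\<bar> \<le> E"
  shows "norm (Abs_cc (\<lambda>x. \<eta> x * f x)) \<le> E * norm (Abs_cc f)"
proof (rule power2_le_imp_le)
  have E0: "E \<ge> 0"
    using E[of 0] by linarith
  have f\<eta>: "cc_function (\<lambda>x. \<eta> x * f x)"
    by (rule cc_function_mult[OF f \<eta>])
  have "(norm (Abs_cc (\<lambda>x. \<eta> x * f x)))\<^sup>2 = (LINT x|lborel. (\<eta> x * f x) * (\<eta> x * f x))"
    using f\<eta> by (simp add: power2_norm_eq_inner inner_Abs_cc)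
  also have "\<dots> \<le> (LINT x|lborel. E\<^sup>2 * (f x * f x))"
  proof (rule integral_mono)
    show "integrable lborel (\<lambda>x. (\<eta> x * f x) * (\<eta> x * f x))"
      by (intro integrable_cc_function cc_function_mult cc_function_continuous f\<eta>)
    show "integrable lborel (\<lambda>x. E\<^sup>2 * (f x * f x))"
      by (intro integrable_cc_function cc_function_cmult cc_function_mult cc_function_continuous f)
    fix x
    have "(\<eta> x)\<^sup>2 \<le> E\<^sup>2"
      using E[of x] E0 by (simp add: abs_le_square_iff[symmetric])
    then have "(\<eta> x)\<^sup>2 * (f x)\<^sup>2 \<le> E\<^sup>2 * (f x)\<^sup>2"
      by (intro mult_right_mono) auto
    then show "(\<eta> x * f x) * (\<eta> x * f x) \<le> E\<^sup>2 * (f x * f x)"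
      by (simp add: power2_eq_square algebra_simps)
  qed
  also have "\<dots> = (E * norm (Abs_cc f))\<^sup>2"
    using f by (simp add: power_mult_distrib power2_norm_eq_inner inner_Abs_cc)
  finally show "(norm (Abs_cc (\<lambda>x. \<eta> x * f x)))\<^sup>2 \<le> (E * norm (Abs_cc f))\<^sup>2" .
  show "0 \<le> E * norm (Abs_cc f)"
    using E0 by simp
qed

lemma has_strong_deriv_axis:
  assumes "C1_gradient f f'" "cc_function f"
  shows "cc.has_strong_deriv (axis k 1) (Abs_cc f) (Abs_cc (\<lambda>x. f' x $ k))"
  using has_strong_deriv_C1[OF assms, of "axis k 1"] by (simp add: inner_axis')

text \<open>The increment of \<open>v\<close> along \<open>t\<close>, a vector in the directions X,
  is a derivative at an intermediate translate and thus a divergence in the directions Y of small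
  fields. This supplies the smallness \<open>weak\<close> of \<open>coupling_estimate\<close>, which
  is applied to \<open>\<eta>\<close> times \<open>u\<close> and \<open>\<eta>\<close> times the
  increment. The remainders \<open>r\<close> and \<open>p\<close> collect the derivatives that fall
  on the cutoff. After expansion every term of the bound contains \<omega> except one, which is
  proportional to \<epsilon>.\<close>

lemma shift_pairing_estimate:
  fixes u v \<eta> :: "real^'m::finite \<Rightarrow> real" and t :: "real^'m" and X Y :: "'m set" and c T \<omega> C E0 E1 \<epsilon> :: real
  assumes neY: "Y \<noteq> {}"
    and u: "C1_gradient u u'" "cc_function u" and v: "C1_gradient v v'" "cc_function v"
    and \<eta>: "C1_gradient \<eta> \<eta>'" "cc_function \<eta>"
    and m: "\<And>l k. C1_gradient (m l k) (m' l k)" "\<And>l k. cc_function (m l k)"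
    and n: "\<And>k l. C1_gradient (n k l) (n' k l)" "\<And>k l. cc_function (n k l)"
    and t: "\<And>i. i \<notin> X \<Longrightarrow> t $ i = 0"
    and du: "\<And>x k. \<eta> x \<noteq> 0 \<Longrightarrow> k \<in> Y \<Longrightarrow> u' x $ k = (\<Sum>l\<in>X. m' l k x $ l)"
    and dv: "\<And>x r l. \<eta> x \<noteq> 0 \<Longrightarrow> 0 \<le> r \<Longrightarrow> r \<le> 1 \<Longrightarrow> l \<in> X \<Longrightarrow>
      v' (x + r *\<^sub>R t) $ l = (\<Sum>k\<in>Y. n' k l (x + r *\<^sub>R t) $ k)"
    and E0: "\<And>x. \<bar>\<eta> x\<bar> \<le> E0" and E1: "\<And>x k. \<bar>\<eta>' x $ k\<bar> \<le> E1"
    and C: "norm (Abs_cc u) \<le> C" "norm (Abs_cc v) \<le> C"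
    and \<omega>: "\<And>l k. norm (Abs_cc (m l k)) \<le> \<omega>" "\<And>k l. norm (Abs_cc (n k l)) \<le> \<omega>"
    and \<epsilon>: "\<epsilon> > 0"
  defines "c \<equiv> 1 / (4 * real (card Y))" and "T \<equiv> \<Sum>l\<in>X. \<bar>t $ l\<bar>"
  shows "\<bar>LINT x|lborel. (\<eta> x)\<^sup>2 * u x * (v (x + t) - v x)\<bar>
    \<le> T * card Y * E1 * \<omega> * (E0 * C) + T * E0 * \<omega> * (card Y * (E0 * C / (\<epsilon> * sqrt c)))
      + card Y * (\<epsilon> * sqrt (2 * c) * (E1 * C + card X * (E1 * \<omega>)) * (2 * E0 * C)
        + card X * (\<epsilon> * sqrt (2 * c) * (E0 * \<omega>) * (2 * E1 * C + card Y * (2 * E1 * \<omega>))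
            + card Y * (2 * (E0 * \<omega>) * (2 * E0 * \<omega>))))"
proof -
  have nonneg: "E0 \<ge> 0" "E1 \<ge> 0" "C \<ge> 0" "\<omega> \<ge> 0" "T \<ge> 0"
    using E0[of 0] E1[of 0 undefined] C(1) \<omega>(1)[of undefined undefined] norm_ge_zero[of "Abs_cc u"]
      norm_ge_zero[of "Abs_cc (m undefined undefined)"]
    by (linarith, linarith, linarith, linarith) (simp add: T_def sum_nonneg)
  have c: "c > 0"
    using neY by (simp add: c_def card_gt_0_iff)
  have cont: "continuous_on UNIV \<eta>" "\<And>k. continuous_on UNIV (\<lambda>x. \<eta>' x $ k)"
    using \<eta> by (auto simp: C1_gradient_def cc_function_def intro!: continuous_intros)
  have norm_\<eta>: "norm (Abs_cc (\<lambda>x. \<eta> x * f x)) \<le> E0 * norm (Abs_cc f)" if "cc_function f" for f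
    by (rule norm_Abs_cc_mult_le[OF that cont(1) E0])
  have norm_\<eta>': "norm (Abs_cc (\<lambda>x. \<eta>' x $ k * f x)) \<le> E1 * norm (Abs_cc f)" if "cc_function f" for f k
    by (rule norm_Abs_cc_mult_le[OF that cont(2) E1])
  have cc\<eta>: "cc_function (\<lambda>x. \<eta> x * f x)" if "cc_function f" for f
    by (rule cc_function_mult[OF that cont(1)])
  have cc\<eta>': "cc_function (\<lambda>x. \<eta>' x $ k * f x)" if "cc_function f" for f k
    by (rule cc_function_mult[OF that cont(2)])
  have cc_partial: "cc_function (\<lambda>x. f' x $ k)" if "C1_gradient f f'" "cc_function f" for f f' k
    using cc_function_directional[OF that, of "axis k 1"] by (simp add: inner_axis')
  have deriv_\<eta>: "cc.has_strong_deriv (axis k 1) (Abs_cc (\<lambda>x. \<eta> x * f x)) (Abs_cc (\<lambda>x. \<eta> x * f' x $ k) + Abs_cc (\<lambda>x. \<eta>' x $ k * f x))"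
    if "C1_gradient f f'" "cc_function f" for f f' k
  proof -
    have "cc.has_strong_deriv (axis k 1) (Abs_cc (\<lambda>x. \<eta> x * f x)) (Abs_cc (\<lambda>x. (\<eta> x *\<^sub>R f' x + f x *\<^sub>R \<eta>' x) $ k))"
      by (intro has_strong_deriv_axis C1_gradient_mult \<eta> that cc\<eta>)
    also have "(\<lambda>x. (\<eta> x *\<^sub>R f' x + f x *\<^sub>R \<eta>' x) $ k) = (\<lambda>x. \<eta> x * f' x $ k + \<eta>' x $ k * f x)"
      by (simp add: mult.commute)
    finally show ?thesis
      by (simp add: Abs_cc_add cc\<eta> cc\<eta>' cc_partial[OF that] that)
  qed
  define \<delta>v where "\<delta>v x = v (x + t) - v x" for x
  define \<delta>n where "\<delta>n k l x = n k l (x + t) - n k l x" for k l x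
  have \<delta>v: "C1_gradient \<delta>v (\<lambda>x. v' (x + t) - v' x)" "cc_function \<delta>v"
    unfolding \<delta>v_def[abs_def] by (intro C1_gradient_diff C1_gradient_shift cc_function_diff cc_function_shift v)+
  have \<delta>n: "C1_gradient (\<delta>n k l) (\<lambda>x. n' k l (x + t) - n' k l x)" "cc_function (\<delta>n k l)" for k l
    unfolding \<delta>n_def[abs_def] by (intro C1_gradient_diff C1_gradient_shift cc_function_diff cc_function_shift n)+
  have norm_\<delta>: "norm (Abs_cc (\<lambda>x. f (x + t) - f x)) \<le> 2 * norm (Abs_cc f)" if "cc_function f" for f
    using norm_triangle_ineq4[of "cc_shift t (Abs_cc f)" "Abs_cc f"] that
    by (simp add: Abs_cc_diff Abs_cc_shift cc_function_shift)
  have norm_\<delta>v: "norm (Abs_cc \<delta>v) \<le> 2 * C"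
    using norm_\<delta>[OF v(2)] C(2) unfolding \<delta>v_def[abs_def] by linarith
  have norm_\<delta>n: "norm (Abs_cc (\<delta>n k l)) \<le> 2 * \<omega>" for k l
    using norm_\<delta>[OF n(2)[of k l]] \<omega>(2)[of k l] unfolding \<delta>n_def[abs_def] by linarith
  define U where "U = Abs_cc (\<lambda>x. \<eta> x * u x)"
  define V where "V = Abs_cc (\<lambda>x. \<eta> x * \<delta>v x)"
  define M where "M l k = Abs_cc (\<lambda>x. \<eta> x * m l k x)" for l k
  define M' where "M' l k = Abs_cc (\<lambda>x. \<eta> x * m' l k x $ l) + Abs_cc (\<lambda>x. \<eta>' x $ l * m l k x)" for l k
  define r where "r k = Abs_cc (\<lambda>x. \<eta>' x $ k * u x) - (\<Sum>l\<in>X. Abs_cc (\<lambda>x. \<eta>' x $ l * m l k x))" for k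
  define \<mu> where "\<mu> k l = Abs_cc (\<lambda>x. \<eta> x * \<delta>n k l x)" for k l
  define \<mu>' where "\<mu>' k l = Abs_cc (\<lambda>x. \<eta> x * (n' k l (x + t) - n' k l x) $ k) + Abs_cc (\<lambda>x. \<eta>' x $ k * \<delta>n k l x)" for k l
  define p where "p l = Abs_cc (\<lambda>x. \<eta>' x $ l * \<delta>v x) - (\<Sum>k\<in>Y. Abs_cc (\<lambda>x. \<eta>' x $ k * \<delta>n k l x))" for l
  define \<kappa>0 where "\<kappa>0 = T * card Y * E1 * \<omega>"
  define \<kappa>1 where "\<kappa>1 = T * E0 * \<omega>"
  have main: "\<bar>inner U V\<bar> \<le> \<kappa>0 * norm U + \<kappa>1 * (\<Sum>k\<in>Y. norm U / (\<epsilon> * sqrt c))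
    + (\<Sum>k\<in>Y. \<epsilon> * sqrt (2 * c) * norm (r k) * norm V
        + (\<Sum>l\<in>X. \<epsilon> * sqrt (2 * c) * norm (M l k) * norm (p l)
            + (\<Sum>i\<in>Y. 2 * norm (M l k) * norm (\<mu> i l))))"
    unfolding c_def
  proof (rule cc.coupling_estimate[where e="\<lambda>k. axis k 1" and X=X and Y=Y and U=U and V=V
        and m=M and m'=M' and r=r and \<mu>=\<mu> and \<mu>'=\<mu>' and p=p])
    fix k assume k: "k \<in> Y"
    have "(\<lambda>x. \<eta> x * u' x $ k) = (\<lambda>x. \<Sum>l\<in>X. \<eta> x * m' l k x $ l)"
    proof
      fix x
      show "\<eta> x * u' x $ k = (\<Sum>l\<in>X. \<eta> x * m' l k x $ l)"
        using du[of x k] k by (cases "\<eta> x = 0") (simp_all add: sum_distrib_left[symmetric])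
    qed
    then have "Abs_cc (\<lambda>x. \<eta> x * u' x $ k) = (\<Sum>l\<in>X. Abs_cc (\<lambda>x. \<eta> x * m' l k x $ l))"
      by (simp only:) (intro Abs_cc_sum cc\<eta> cc_partial[OF m])
    then have "Abs_cc (\<lambda>x. \<eta> x * u' x $ k) + Abs_cc (\<lambda>x. \<eta>' x $ k * u x) = (\<Sum>l\<in>X. M' l k) + r k"
      by (simp add: M'_def r_def sum.distrib)
    then show "cc.has_strong_deriv (axis k 1) U ((\<Sum>l\<in>X. M' l k) + r k)"
      using deriv_\<eta>[OF u, of k] by (simp only: U_def)
  next
    fix l k
    show "cc.has_strong_deriv (axis l 1) (M l k) (M' l k)"
      unfolding M_def M'_def by (rule deriv_\<eta>[OF m])
    show "cc.has_strong_deriv (axis l 1) (\<mu> l k) (\<mu>' l k)"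
      unfolding \<mu>_def \<mu>'_def by (rule deriv_\<eta>[OF \<delta>n])
  next
    fix l assume l: "l \<in> X"
    have "(\<lambda>x. \<eta> x * (v' (x + t) - v' x) $ l) = (\<lambda>x. \<Sum>k\<in>Y. \<eta> x * (n' k l (x + t) - n' k l x) $ k)"
    proof
      fix x
      show "\<eta> x * (v' (x + t) - v' x) $ l = (\<Sum>k\<in>Y. \<eta> x * (n' k l (x + t) - n' k l x) $ k)"
        using dv[of x 1 l] dv[of x 0 l] l
        by (cases "\<eta> x = 0") (simp_all add: sum_subtractf sum_distrib_left[symmetric])
    qed
    then have "Abs_cc (\<lambda>x. \<eta> x * (v' (x + t) - v' x) $ l) = (\<Sum>k\<in>Y. Abs_cc (\<lambda>x. \<eta> x * (n' k l (x + t) - n' k l x) $ k))"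
      by (simp only:) (intro Abs_cc_sum cc\<eta> cc_partial[OF \<delta>n])
    then have "Abs_cc (\<lambda>x. \<eta> x * (v' (x + t) - v' x) $ l) + Abs_cc (\<lambda>x. \<eta>' x $ l * \<delta>v x) = (\<Sum>k\<in>Y. \<mu>' k l) + p l"
      by (simp add: \<mu>'_def p_def sum.distrib)
    then show "cc.has_strong_deriv (axis l 1) V ((\<Sum>k\<in>Y. \<mu>' k l) + p l)"
      using deriv_\<eta>[OF \<delta>v, of l] by (simp only: V_def)
  next
    fix g :: "(real^'m) cc" and g'
    assume g: "\<And>k. k \<in> Y \<Longrightarrow> cc.has_strong_deriv (axis k 1) g (g' k)"
    \<comment> \<open>The cutoff is put on \<open>g\<close>, so that a fixed vector is paired with
      translates of \<open>v\<close> and the mean value theorem becomes available for the scalar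
      pairing.\<close>
    define \<gamma> where "\<gamma> = Abs_cc (\<lambda>x. \<eta> x * cc_apply g x)"
    have inner_\<gamma>: "inner \<gamma> (Abs_cc f) = inner g (Abs_cc (\<lambda>x. \<eta> x * f x))" if "cc_function f" for f
      by (simp add: \<gamma>_def inner_cc.rep_eq Abs_cc_inverse cc\<eta> that mult.assoc mult.left_commute)
    have "\<exists>\<theta>>0. \<theta> < 1 \<and> inner \<gamma> (cc_shift (1 *\<^sub>R t) (Abs_cc v)) - inner \<gamma> (cc_shift (0 *\<^sub>R t) (Abs_cc v))
        = (1 - 0) * inner \<gamma> (cc_shift (\<theta> *\<^sub>R t) (Abs_cc (\<lambda>x. inner t (v' x))))"
      by (intro MVT2 cc.DERIV_inner_shift has_strong_deriv_C1 v) simp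
    then obtain \<theta> where \<theta>: "0 < \<theta>" "\<theta> < 1"
      "inner \<gamma> (cc_shift t (Abs_cc v) - Abs_cc v) = inner \<gamma> (cc_shift (\<theta> *\<^sub>R t) (Abs_cc (\<lambda>x. inner t (v' x))))"
      by (auto simp: inner_diff_right)
    define q where "q k l x = n k l (x + \<theta> *\<^sub>R t)" for k l x
    define q' where "q' k l x = n' k l (x + \<theta> *\<^sub>R t)" for k l x
    have q: "C1_gradient (q k l) (q' k l)" "cc_function (q k l)" for k l
      unfolding q_def[abs_def] q'_def[abs_def] by (intro C1_gradient_shift cc_function_shift n)+
    have norm_q: "norm (Abs_cc (q k l)) \<le> \<omega>" for k l
      unfolding q_def[abs_def] using \<omega>(2)[of k l] by (simp add: Abs_cc_shift n)
    have cct: "cc_function (\<lambda>x. inner t (v' x))"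
      by (rule cc_function_directional[OF v])
    have "inner g V = inner \<gamma> (cc_shift t (Abs_cc v) - Abs_cc v)"
      unfolding V_def by (simp add: inner_\<gamma>[symmetric] \<delta>v, simp add: \<delta>v_def[abs_def] Abs_cc_diff Abs_cc_shift cc_function_shift v)
    also have "\<dots> = inner g (Abs_cc (\<lambda>x. \<eta> x * inner t (v' (x + \<theta> *\<^sub>R t))))"
      unfolding \<theta>(3) by (simp add: inner_\<gamma>[symmetric] cc_function_shift[OF cct] Abs_cc_shift[OF cct, symmetric])
    also have "(\<lambda>x. \<eta> x * inner t (v' (x + \<theta> *\<^sub>R t))) = (\<lambda>x. \<Sum>l\<in>X. t $ l * (\<Sum>k\<in>Y. \<eta> x * q' k l x $ k))"
    proof
      fix x
      have "inner t (v' (x + \<theta> *\<^sub>R t)) = (\<Sum>l\<in>X. t $ l * v' (x + \<theta> *\<^sub>R t) $ l)"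
        unfolding inner_vec_def using t by (intro sum.mono_neutral_cong_right) auto
      then show "\<eta> x * inner t (v' (x + \<theta> *\<^sub>R t)) = (\<Sum>l\<in>X. t $ l * (\<Sum>k\<in>Y. \<eta> x * q' k l x $ k))"
        using dv[of x \<theta>] \<theta> by (cases "\<eta> x = 0")
          (simp_all add: q'_def sum_distrib_left[symmetric] mult.left_commute)
    qed
    also have "Abs_cc \<dots> = (\<Sum>l\<in>X. t $ l *\<^sub>R (\<Sum>k\<in>Y. Abs_cc (\<lambda>x. \<eta> x * q' k l x $ k)))"
      by (simp add: Abs_cc_sum Abs_cc_cmult cc\<eta> cc_function_sum cc_function_cmult cc_partial[OF q])
    also have "inner g \<dots> = (\<Sum>l\<in>X. t $ l * (\<Sum>k\<in>Y. inner g (Abs_cc (\<lambda>x. \<eta> x * q' k l x $ k))))"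
      by (simp add: inner_sum_right)
    finally have "\<bar>inner g V\<bar> \<le> (\<Sum>l\<in>X. \<bar>t $ l\<bar> * (\<Sum>k\<in>Y. \<bar>inner g (Abs_cc (\<lambda>x. \<eta> x * q' k l x $ k))\<bar>))"
      by (auto intro!: order_trans[OF sum_abs] sum_mono mult_left_mono simp: abs_mult)
    \<comment> \<open>In each term the derivative along k is integrated by parts. Falling on
      \<open>g\<close> it yields \<open>\<kappa>1\<close>, falling on the cutoff it yields
      \<open>\<kappa>0\<close>; the weights \<bar>t $ l\<bar> add up to \<open>T\<close>.\<close>
    also have "\<dots> \<le> (\<Sum>l\<in>X. \<bar>t $ l\<bar> * (\<Sum>k\<in>Y. norm (g' k) * (E0 * \<omega>) + norm g * (E1 * \<omega>)))"
    proof (intro sum_mono mult_left_mono)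
      fix k l assume k: "k \<in> Y"
      have "inner g (Abs_cc (\<lambda>x. \<eta> x * q' k l x $ k))
          = - inner (g' k) (Abs_cc (\<lambda>x. \<eta> x * q k l x)) - inner g (Abs_cc (\<lambda>x. \<eta>' x $ k * q k l x))"
        using cc.inner_strong_deriv[OF g[OF k] deriv_\<eta>[OF q]] by (simp add: inner_add_right)
      also have "\<bar>\<dots>\<bar> \<le> norm (g' k) * norm (Abs_cc (\<lambda>x. \<eta> x * q k l x)) + norm g * norm (Abs_cc (\<lambda>x. \<eta>' x $ k * q k l x))"
        using Cauchy_Schwarz_ineq2[of "g' k" "Abs_cc (\<lambda>x. \<eta> x * q k l x)"]
          Cauchy_Schwarz_ineq2[of g "Abs_cc (\<lambda>x. \<eta>' x $ k * q k l x)"] by linarith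
      also have "\<dots> \<le> norm (g' k) * (E0 * \<omega>) + norm g * (E1 * \<omega>)"
        using norm_q[of k l] nonneg
        by (intro add_mono mult_left_mono order_trans[OF norm_\<eta>] order_trans[OF norm_\<eta>'] q) auto
      finally show "\<bar>inner g (Abs_cc (\<lambda>x. \<eta> x * q' k l x $ k))\<bar> \<le> norm (g' k) * (E0 * \<omega>) + norm g * (E1 * \<omega>)" .
    qed auto
    also have "\<dots> = \<kappa>0 * norm g + \<kappa>1 * (\<Sum>k\<in>Y. norm (g' k))"
    proof -
      have "(\<Sum>k\<in>Y. norm (g' k) * (E0 * \<omega>) + norm g * (E1 * \<omega>))
          = (\<Sum>k\<in>Y. norm (g' k)) * (E0 * \<omega>) + card Y * (norm g * (E1 * \<omega>))"
        by (simp add: sum.distrib sum_distrib_right)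
      then show ?thesis
        unfolding \<kappa>0_def \<kappa>1_def T_def
        by (simp only: sum_distrib_right[symmetric]) (simp add: algebra_simps)
    qed
    finally show "\<bar>inner g V\<bar> \<le> \<kappa>0 * norm g + \<kappa>1 * (\<Sum>k\<in>Y. norm (g' k))" .
  qed (use neY \<epsilon> nonneg in \<open>auto simp: \<kappa>0_def \<kappa>1_def\<close>)
  have norm_U: "norm U \<le> E0 * C"
    unfolding U_def using nonneg C by (intro order_trans[OF norm_\<eta>] mult_left_mono u) auto
  have norm_V: "norm V \<le> 2 * E0 * C"
    using norm_\<eta>[OF \<delta>v(2)] mult_left_mono[OF norm_\<delta>v, of E0] nonneg unfolding V_def by linarith
  have norm_M: "norm (M l k) \<le> E0 * \<omega>" for l k
    unfolding M_def using nonneg \<omega> by (intro order_trans[OF norm_\<eta>] mult_left_mono m) auto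
  have norm_\<mu>: "norm (\<mu> k l) \<le> 2 * E0 * \<omega>" for l k
    using norm_\<eta>[OF \<delta>n(2), of k l] mult_left_mono[OF norm_\<delta>n[of k l] nonneg(1)] unfolding \<mu>_def by linarith
  have norm_r: "norm (r k) \<le> E1 * C + card X * (E1 * \<omega>)" for k
  proof -
    have "norm (r k) \<le> norm (Abs_cc (\<lambda>x. \<eta>' x $ k * u x)) + (\<Sum>l\<in>X. norm (Abs_cc (\<lambda>x. \<eta>' x $ l * m l k x)))"
      unfolding r_def by (intro order_trans[OF norm_triangle_ineq4] add_left_mono norm_sum)
    also have "\<dots> \<le> E1 * C + (\<Sum>l\<in>X. E1 * \<omega>)"
      using nonneg C \<omega> by (intro add_mono sum_mono order_trans[OF norm_\<eta>'] mult_left_mono m u) auto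
    finally show ?thesis by simp
  qed
  have norm_p: "norm (p l) \<le> 2 * E1 * C + card Y * (2 * E1 * \<omega>)" for l
  proof -
    have "norm (p l) \<le> norm (Abs_cc (\<lambda>x. \<eta>' x $ l * \<delta>v x)) + (\<Sum>k\<in>Y. norm (Abs_cc (\<lambda>x. \<eta>' x $ k * \<delta>n k l x)))"
      unfolding p_def by (intro order_trans[OF norm_triangle_ineq4] add_left_mono norm_sum)
    also have "\<dots> \<le> E1 * (2 * C) + (\<Sum>k\<in>Y. E1 * (2 * \<omega>))"
      using nonneg norm_\<delta>v norm_\<delta>n by (intro add_mono sum_mono order_trans[OF norm_\<eta>'] mult_left_mono \<delta>v \<delta>n) auto
    finally show ?thesis by (simp add: algebra_simps)
  qed
  have pairing: "(LINT x|lborel. (\<eta> x)\<^sup>2 * u x * (v (x + t) - v x)) = inner U V"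
    unfolding U_def V_def
    by (simp add: inner_Abs_cc cc\<eta> u \<delta>v, simp add: \<delta>v_def power2_eq_square algebra_simps)
  have "\<bar>inner U V\<bar> \<le> \<kappa>0 * (E0 * C) + \<kappa>1 * (\<Sum>k\<in>Y. E0 * C / (\<epsilon> * sqrt c))
    + (\<Sum>k\<in>Y. \<epsilon> * sqrt (2 * c) * (E1 * C + card X * (E1 * \<omega>)) * (2 * E0 * C)
        + (\<Sum>l\<in>X. \<epsilon> * sqrt (2 * c) * (E0 * \<omega>) * (2 * E1 * C + card Y * (2 * E1 * \<omega>))
            + (\<Sum>i\<in>Y. 2 * (E0 * \<omega>) * (2 * E0 * \<omega>))))"
    using nonneg \<epsilon> c
    by (intro order_trans[OF main] add_mono mult_mono sum_mono divide_right_mono norm_U norm_V norm_M norm_\<mu> norm_r norm_p)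
      (auto simp: \<kappa>0_def \<kappa>1_def intro!: sum_nonneg)
  then show ?thesis
    by (simp only: pairing \<kappa>0_def \<kappa>1_def sum_constant)
qed

lemma tendsto_zero_of_epsilon_bound:
  fixes I :: "nat \<Rightarrow> real"
  assumes "\<And>\<epsilon>. \<epsilon> > 0 \<Longrightarrow> \<exists>b. (\<forall>\<^sub>F j in sequentially. \<bar>I j\<bar> \<le> b j) \<and> b \<longlonglongrightarrow> \<epsilon> * K"
  shows "I \<longlonglongrightarrow> 0"
proof (rule tendstoI)
  fix e :: real assume e: "e > 0"
  define \<epsilon> where "\<epsilon> = e / (2 * (\<bar>K\<bar> + 1))"
  have \<epsilon>: "\<epsilon> > 0"
    using e by (simp add: \<epsilon>_def add_nonneg_pos)
  obtain b where b: "\<forall>\<^sub>F j in sequentially. \<bar>I j\<bar> \<le> b j" "b \<longlonglongrightarrow> \<epsilon> * K"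
    using assms[OF \<epsilon>] by blast
  have "\<epsilon> * K \<le> \<epsilon> * (\<bar>K\<bar> + 1)"
    using \<epsilon> by (intro mult_left_mono) auto
  also have "\<dots> = e / 2"
    using abs_ge_zero[of K] unfolding \<epsilon>_def by (simp add: field_simps)
  finally have "\<epsilon> * K < e"
    using e by linarith
  with b(2) have "\<forall>\<^sub>F j in sequentially. b j < e"
    by (rule order_tendstoD)
  with b(1) show "\<forall>\<^sub>F j in sequentially. dist (I j) 0 < e"
    by eventually_elim simp
qed

lemma cc_function_component_bounded:
  fixes \<eta> :: "real^'m::finite \<Rightarrow> real"
  assumes "C1_gradient \<eta> \<eta>'" "cc_function \<eta>"
  shows "\<exists>E. \<forall>x k. \<bar>\<eta>' x $ k\<bar> \<le> E"
proof -
  have "\<exists>E\<ge>0. \<forall>x. \<bar>\<eta>' x $ k\<bar> \<le> E" for k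
    using bounded_cc_function[OF cc_function_directional[OF assms, of "axis k 1"]]
    by (simp add: inner_axis')
  then obtain E where E: "\<And>k. E k \<ge> 0" "\<And>k x. \<bar>\<eta>' x $ k\<bar> \<le> E k"
    by metis
  have "\<bar>\<eta>' x $ k\<bar> \<le> (\<Sum>k\<in>UNIV. E k)" for x k
    using E(2)[of x k] member_le_sum[of k UNIV E] E(1) by force
  then show ?thesis by blast
qed

text \<open>For fixed \<epsilon> the fields tend to 0 in norm, so the bound of
  \<open>shift_pairing_estimate\<close> tends to a multiple of \<epsilon> whose coefficient does not
  depend on \<epsilon>; and \<epsilon> is arbitrary. The order of the limits matters, since the
  bound also contains \<omega> / \<epsilon>.\<close>

lemma shift_pairing_tendsto_zero:
  fixes u v :: "nat \<Rightarrow> real^'m::finite \<Rightarrow> real" and t :: "real^'m" and X Y :: "'m set"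
  assumes neY: "Y \<noteq> {}"
    and u: "\<And>j. C1_gradient (u j) (u' j)" "\<And>j. cc_function (u j)"
    and v: "\<And>j. C1_gradient (v j) (v' j)" "\<And>j. cc_function (v j)"
    and \<eta>: "C1_gradient \<eta> \<eta>'" "cc_function \<eta>"
    and m: "\<And>j l k. l \<in> X \<Longrightarrow> k \<in> Y \<Longrightarrow> C1_gradient (m j l k) (m' j l k)"
      "\<And>j l k. l \<in> X \<Longrightarrow> k \<in> Y \<Longrightarrow> cc_function (m j l k)"
    and n: "\<And>j k l. k \<in> Y \<Longrightarrow> l \<in> X \<Longrightarrow> C1_gradient (n j k l) (n' j k l)"
      "\<And>j k l. k \<in> Y \<Longrightarrow> l \<in> X \<Longrightarrow> cc_function (n j k l)"
    and t: "\<And>i. i \<notin> X \<Longrightarrow> t $ i = 0"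
    and du: "\<And>j x k. \<eta> x \<noteq> 0 \<Longrightarrow> k \<in> Y \<Longrightarrow> u' j x $ k = (\<Sum>l\<in>X. m' j l k x $ l)"
    and dv: "\<And>j x r l. \<eta> x \<noteq> 0 \<Longrightarrow> 0 \<le> r \<Longrightarrow> r \<le> 1 \<Longrightarrow> l \<in> X \<Longrightarrow>
      v' j (x + r *\<^sub>R t) $ l = (\<Sum>k\<in>Y. n' j k l (x + r *\<^sub>R t) $ k)"
    and C: "\<And>j. norm (Abs_cc (u j)) \<le> C" "\<And>j. norm (Abs_cc (v j)) \<le> C"
    and m0: "\<And>l k. l \<in> X \<Longrightarrow> k \<in> Y \<Longrightarrow> (\<lambda>j. norm (Abs_cc (m j l k))) \<longlonglongrightarrow> 0"
    and n0: "\<And>k l. k \<in> Y \<Longrightarrow> l \<in> X \<Longrightarrow> (\<lambda>j. norm (Abs_cc (n j k l))) \<longlonglongrightarrow> 0"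
  shows "(\<lambda>j. LINT x|lborel. (\<eta> x)\<^sup>2 * u j x * (v j (x + t) - v j x)) \<longlonglongrightarrow> 0"
proof -
  obtain E0 where E0: "\<And>x. \<bar>\<eta> x\<bar> \<le> E0"
    using bounded_cc_function[OF \<eta>(2)] by blast
  obtain E1 where E1: "\<And>x k. \<bar>\<eta>' x $ k\<bar> \<le> E1"
    using cc_function_component_bounded[OF \<eta>] by blast
  define \<omega> where "\<omega> j = (\<Sum>l\<in>X. \<Sum>k\<in>Y. norm (Abs_cc (m j l k)) + norm (Abs_cc (n j k l)))" for j
  have "\<omega> \<longlonglongrightarrow> (\<Sum>l\<in>X. \<Sum>k\<in>Y. 0 + 0)"
    unfolding \<omega>_def by (intro tendsto_sum tendsto_add m0 n0)
  then have \<omega>0: "\<omega> \<longlonglongrightarrow> 0"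
    by simp
  have \<omega>_nonneg: "\<omega> j \<ge> 0" for j
    by (simp add: \<omega>_def sum_nonneg)
  have \<omega>: "norm (Abs_cc (m j l k)) + norm (Abs_cc (n j k l)) \<le> \<omega> j" if "l \<in> X" "k \<in> Y" for j l k
  proof -
    have "norm (Abs_cc (m j l k)) + norm (Abs_cc (n j k l)) \<le> (\<Sum>k\<in>Y. norm (Abs_cc (m j l k)) + norm (Abs_cc (n j k l)))"
      using that by (intro member_le_sum[where f="\<lambda>k. norm (Abs_cc (m j l k)) + norm (Abs_cc (n j k l))"]) auto
    also have "\<dots> \<le> \<omega> j"
      unfolding \<omega>_def using that
      by (intro member_le_sum[where f="\<lambda>l. \<Sum>k\<in>Y. norm (Abs_cc (m j l k)) + norm (Abs_cc (n j k l))"])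
        (auto intro: sum_nonneg)
    finally show ?thesis .
  qed
  \<comment> \<open>\<open>shift_pairing_estimate\<close> speaks of all pairs of indices, whereas
    the fields are controlled only for l in X and k in Y. Elsewhere they are replaced by 0.\<close>
  define M where "M j l k = (if l \<in> X \<and> k \<in> Y then m j l k else (\<lambda>x. 0))" for j l k
  define M' where "M' j l k = (if l \<in> X \<and> k \<in> Y then m' j l k else (\<lambda>x. 0))" for j l k
  define N where "N j k l = (if l \<in> X \<and> k \<in> Y then n j k l else (\<lambda>x. 0))" for j l k
  define N' where "N' j k l = (if l \<in> X \<and> k \<in> Y then n' j k l else (\<lambda>x. 0))" for j l k
  have zero: "C1_gradient (\<lambda>x::real^'m. 0) (\<lambda>x. 0)"
    by (simp add: C1_gradient_def GDERIV_const)
  let ?c = "1 / (4 * real (card Y))" and ?T = "\<Sum>l\<in>X. \<bar>t $ l\<bar>"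
  define b where "b \<epsilon> j = ?T * card Y * E1 * \<omega> j * (E0 * C) + ?T * E0 * \<omega> j * (card Y * (E0 * C / (\<epsilon> * sqrt ?c)))
      + card Y * (\<epsilon> * sqrt (2 * ?c) * (E1 * C + card X * (E1 * \<omega> j)) * (2 * E0 * C)
        + card X * (\<epsilon> * sqrt (2 * ?c) * (E0 * \<omega> j) * (2 * E1 * C + card Y * (2 * E1 * \<omega> j))
            + card Y * (2 * (E0 * \<omega> j) * (2 * E0 * \<omega> j))))" for \<epsilon> j
  have bound: "\<bar>LINT x|lborel. (\<eta> x)\<^sup>2 * u j x * (v j (x + t) - v j x)\<bar> \<le> b \<epsilon> j" if "\<epsilon> > 0" for \<epsilon> j
    unfolding b_def
  proof (rule shift_pairing_estimate[where m="M j" and m'="M' j" and n="N j" and n'="N' j", OF neY u v \<eta>])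
    show "C1_gradient (M j l k) (M' j l k)" "cc_function (M j l k)" for l k
      using m zero by (auto simp: M_def M'_def cc_function_zero)
    show "C1_gradient (N j k l) (N' j k l)" "cc_function (N j k l)" for l k
      using n zero by (auto simp: N_def N'_def cc_function_zero)
    show "norm (Abs_cc (M j l k)) \<le> \<omega> j" for l k
      using \<omega>[of l k j] \<omega>_nonneg[of j] norm_ge_zero[of "Abs_cc (n j k l)"]
      by (auto simp: M_def Abs_cc_zero intro: order_trans[rotated])
    show "norm (Abs_cc (N j k l)) \<le> \<omega> j" for l k
      using \<omega>[of l k j] \<omega>_nonneg[of j] norm_ge_zero[of "Abs_cc (m j l k)"]
      by (auto simp: N_def Abs_cc_zero intro: order_trans[rotated])
  qed (use t du dv E0 E1 C that in \<open>auto simp: M'_def N'_def\<close>)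
  show ?thesis
  proof (rule tendsto_zero_of_epsilon_bound)
    fix \<epsilon> :: real assume \<epsilon>: "\<epsilon> > 0"
    have "b \<epsilon> \<longlonglongrightarrow> ?T * card Y * E1 * 0 * (E0 * C) + ?T * E0 * 0 * (card Y * (E0 * C / (\<epsilon> * sqrt ?c)))
      + card Y * (\<epsilon> * sqrt (2 * ?c) * (E1 * C + card X * (E1 * 0)) * (2 * E0 * C)
        + card X * (\<epsilon> * sqrt (2 * ?c) * (E0 * 0) * (2 * E1 * C + card Y * (2 * E1 * 0))
            + card Y * (2 * (E0 * 0) * (2 * E0 * 0))))"
      unfolding b_def by (intro tendsto_add tendsto_mult tendsto_const \<omega>0)
    then have "b \<epsilon> \<longlonglongrightarrow> \<epsilon> * (real (card Y) * (sqrt (2 * ?c) * (E1 * C) * (2 * E0 * C)))"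
      by (simp only: mult_zero_left mult_zero_right add_0_left add_0_right) (simp add: mult_ac)
    then show "\<exists>b. (\<forall>\<^sub>F j in sequentially. \<bar>LINT x|lborel. (\<eta> x)\<^sup>2 * u j x * (v j (x + t) - v j x)\<bar> \<le> b j)
        \<and> b \<longlonglongrightarrow> \<epsilon> * (real (card Y) * (sqrt (2 * ?c) * (E1 * C) * (2 * E0 * C)))"
      using bound[OF \<epsilon>] by (intro exI[of _ "b \<epsilon>"]) auto
  qed
qed

section \<open>Decoupling by integration over all translations\<close>

lemma integral_lborel_reflect:
  fixes f :: "real^'m::finite \<Rightarrow> real"
  assumes f: "f \<in> borel_measurable borel"
  shows "(LINT x|lborel. f (\<chi> i. if i \<in> X then x $ i else - x $ i)) = (LINT x|lborel. f x)"
proof -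
  define c :: "real^'m \<Rightarrow> real" where "c b = (if \<exists>i\<in>X. b = axis i 1 then 1 else -1)" for b
  define T :: "real^'m \<Rightarrow> real^'m" where "T x = 0 + (\<Sum>b\<in>Basis. (c b * (x \<bullet> b)) *\<^sub>R b)" for x
  have T: "T x = (\<chi> i. if i \<in> X then x $ i else - x $ i)" for x
  proof (rule vec_eq_iff[THEN iffD2], rule allI)
    fix i
    have b: "axis i 1 \<in> (Basis :: (real^'m) set)"
      by (auto simp: Basis_vec_def)
    have "T x $ i = T x \<bullet> axis i 1"
      by (simp add: inner_axis)
    also have "\<dots> = c (axis i 1) * (x \<bullet> axis i 1)"
      using b by (simp add: T_def inner_sum_left_Basis)
    finally show "T x $ i = (\<chi> i. if i \<in> X then x $ i else - x $ i) $ i"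
      by (auto simp: c_def inner_axis axis_eq_axis)
  qed
  have T_meas: "T \<in> borel \<rightarrow>\<^sub>M borel"
    unfolding T_def[abs_def] by measurable
  have "lborel = density (distr lborel borel T) (\<lambda>_. (\<Prod>b\<in>Basis. \<bar>c b\<bar>))"
    unfolding T_def[abs_def] by (rule lborel_affine_euclidean) (simp add: c_def)
  also have "(\<Prod>b\<in>Basis. \<bar>c b\<bar>) = 1"
    by (intro prod.neutral) (auto simp: c_def)
  finally have eq: "lborel = distr lborel borel T"
    by (simp add: density_1)
  have "(LINT x|lborel. f x) = (LINT x|distr lborel borel T. f x)"
    using eq by simp
  also have "\<dots> = (LINT x|lborel. f (T x))"
    using T_meas f by (intro integral_distr) auto
  finally show ?thesis
    by (simp add: T)
qed

lemma cc_function_Pair: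
  fixes F :: "'a::euclidean_space \<Rightarrow> 'b::euclidean_space \<Rightarrow> real"
  assumes "continuous_on UNIV (\<lambda>p. F (fst p) (snd p))"
    and "\<And>x y. F x y \<noteq> 0 \<Longrightarrow> norm x \<le> A \<and> norm y \<le> B"
  shows "cc_function (\<lambda>p. F (fst p) (snd p))"
proof -
  have "F (fst p) (snd p) = 0" if p: "norm p > A + B" for p
  proof (rule ccontr)
    assume "F (fst p) (snd p) \<noteq> 0"
    then have "norm (fst p) \<le> A" "norm (snd p) \<le> B"
      using assms(2) by blast+
    then show False
      using p norm_Pair_le[of "fst p" "snd p"] by simp
  qed
  then show ?thesis
    using assms(1) unfolding cc_function_def by blast
qed

lemma Fubini_cc_function:
  fixes F :: "'a::euclidean_space \<Rightarrow> 'b::euclidean_space \<Rightarrow> real"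
  assumes "cc_function (\<lambda>p. F (fst p) (snd p))"
  shows "(LINT y|lborel. LINT x|lborel. F x y) = (LINT x|lborel. LINT y|lborel. F x y)"
    and "(\<lambda>y. LINT x|lborel. F x y) \<in> borel_measurable borel"
    and "integrable lborel (\<lambda>y. LINT x|lborel. F x y)"
proof -
  have int: "integrable (lborel \<Otimes>\<^sub>M lborel) (\<lambda>(x, y). F x y)"
    using integrable_cc_function[OF assms] by (simp add: lborel_prod case_prod_unfold)
  show "(LINT y|lborel. LINT x|lborel. F x y) = (LINT x|lborel. LINT y|lborel. F x y)"
    by (rule lborel_pair.Fubini_integral[OF int])
  show i: "integrable lborel (\<lambda>y. LINT x|lborel. F x y)"
    using lborel_pair.integrable_snd[OF int] by simp
  then show "(\<lambda>y. LINT x|lborel. F x y) \<in> borel_measurable borel"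
    using borel_measurable_integrable[OF i] by simp
qed

text \<open>A product of two averages is a double integral of \<open>u j x * v j (x + w)\<close>.
  For fixed w, \<open>v\<close> can be relieved of the X-part of the translation and
  \<open>u\<close> can be given its Y-part, at a cost that tends to 0, so both are evaluated at the
  same corner of the box spanned by x and x + w. The product form of the cutoff then rearranges the
  weight in such a way that the integral over w factors out.\<close>

lemma product_weak_continuity:
  fixes u v :: "nat \<Rightarrow> real^'m::finite \<Rightarrow> real" and X Y :: "'m set" and b :: "'m \<Rightarrow> real \<Rightarrow> real"
  assumes XY: "Y = - X" "X \<noteq> {}" "Y \<noteq> {}"
    and u: "\<And>j. C1_gradient (u j) (u' j)" "\<And>j. cc_function (u j)"
    and v: "\<And>j. C1_gradient (v j) (v' j)" "\<And>j. cc_function (v j)"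
    and m: "\<And>j l k. l \<in> X \<Longrightarrow> k \<in> Y \<Longrightarrow> C1_gradient (m j l k) (m' j l k)"
      "\<And>j l k. l \<in> X \<Longrightarrow> k \<in> Y \<Longrightarrow> cc_function (m j l k)"
    and n: "\<And>j k l. k \<in> Y \<Longrightarrow> l \<in> X \<Longrightarrow> C1_gradient (n j k l) (n' j k l)"
      "\<And>j k l. k \<in> Y \<Longrightarrow> l \<in> X \<Longrightarrow> cc_function (n j k l)"
    and \<beta>: "C1_gradient \<beta> \<beta>'" "cc_function \<beta>"
    and \<beta>_prod: "\<And>x. \<beta> x = (\<Prod>i\<in>UNIV. b i (x $ i))"
    and b_conv: "\<And>i x y r. b i x \<noteq> 0 \<Longrightarrow> b i y \<noteq> 0 \<Longrightarrow> 0 \<le> r \<Longrightarrow> r \<le> 1 \<Longrightarrow> b i (x + r * (y - x)) \<noteq> 0"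
    and du: "\<And>j x k. \<beta> x \<noteq> 0 \<Longrightarrow> k \<in> Y \<Longrightarrow> u' j x $ k = (\<Sum>l\<in>X. m' j l k x $ l)"
    and dv: "\<And>j x l. \<beta> x \<noteq> 0 \<Longrightarrow> l \<in> X \<Longrightarrow> v' j x $ l = (\<Sum>k\<in>Y. n' j k l x $ k)"
    and C: "\<And>j. norm (Abs_cc (u j)) \<le> C" "\<And>j. norm (Abs_cc (v j)) \<le> C"
    and m0: "\<And>l k. l \<in> X \<Longrightarrow> k \<in> Y \<Longrightarrow> (\<lambda>j. norm (Abs_cc (m j l k))) \<longlonglongrightarrow> 0"
    and n0: "\<And>k l. k \<in> Y \<Longrightarrow> l \<in> X \<Longrightarrow> (\<lambda>j. norm (Abs_cc (n j k l))) \<longlonglongrightarrow> 0"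
  defines "\<Phi> \<equiv> \<lambda>x. (\<beta> x)\<^sup>2"
  shows "(\<lambda>j. (LINT x|lborel. \<Phi> x) * (LINT x|lborel. \<Phi> x * (u j x * v j x))
      - (LINT x|lborel. \<Phi> x * u j x) * (LINT x|lborel. \<Phi> x * v j x)) \<longlonglongrightarrow> 0"
proof -
  define prj :: "'m set \<Rightarrow> real^'m \<Rightarrow> real^'m" where "prj Z w = (\<chi> i. if i \<in> Z then w $ i else 0)" for Z w
  have prj_nth: "prj Z w $ i = (if i \<in> Z then w $ i else 0)" for Z w i
    by (simp add: prj_def)
  have prj_sum: "prj Y w + prj X w = w" for w
    using XY by (auto simp: vec_eq_iff prj_nth)
  have cont_prj: "continuous_on S (prj Z)" for S Z
    unfolding prj_def[abs_def]
  proof (rule continuous_on_vec_lambda)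
    show "continuous_on S (\<lambda>w. if i \<in> Z then w $ i else 0)" for i
      by (cases "i \<in> Z") (auto intro!: continuous_intros)
  qed
  have \<beta>_nz: "\<beta> x \<noteq> 0 \<longleftrightarrow> (\<forall>i. b i (x $ i) \<noteq> 0)" for x
    by (simp add: \<beta>_prod)
  have \<Phi>: "cc_function \<Phi>"
    unfolding \<Phi>_def power2_eq_square by (intro cc_function_mult cc_function_continuous \<beta>)
  have uv: "cc_function (\<lambda>x. u j x * v j x)" for j
    by (intro cc_function_mult cc_function_continuous u v)
  \<comment> \<open>A cutoff for the pair x, x + w. Its square is
    \<open>\<Phi> x * \<Phi> (x + w)\<close>, the weight of the double integral.\<close>
  define \<eta> where "\<eta> w x = \<beta> x * \<beta> (x + w)" for w x
  define \<eta>' where "\<eta>' w x = \<beta> x *\<^sub>R \<beta>' (x + w) + \<beta> (x + w) *\<^sub>R \<beta>' x" for w x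
  have \<eta>: "C1_gradient (\<eta> w) (\<eta>' w)" "cc_function (\<eta> w)" for w
    unfolding \<eta>_def[abs_def] \<eta>'_def[abs_def]
    by (intro C1_gradient_mult C1_gradient_shift cc_function_mult cc_function_continuous cc_function_shift \<beta>)+
  \<comment> \<open>Each factor of the cutoff is nonzero on a convex set, so the cutoff is nonzero
    throughout the box with opposite corners x and x + w. The divergence identities, assumed only
    where it is nonzero, therefore hold along both translations.\<close>
  have inside: "\<beta> (x + prj Z w + r *\<^sub>R prj Z' w) \<noteq> 0"
    if "\<eta> w x \<noteq> 0" "0 \<le> r" "r \<le> 1" "Z \<inter> Z' = {}" for w x r Z Z'
    unfolding \<beta>_nz
  proof
    fix i
    have nz: "b i (x $ i) \<noteq> 0" "b i ((x + w) $ i) \<noteq> 0"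
      using that(1) \<beta>_nz[of x] \<beta>_nz[of "x + w"] by (auto simp: \<eta>_def)
    show "b i ((x + prj Z w + r *\<^sub>R prj Z' w) $ i) \<noteq> 0"
      using nz b_conv[OF nz that(2,3)] that(4) by (auto simp: prj_nth)
  qed
  define A where "A j w = (LINT x|lborel. (\<eta> w x)\<^sup>2 * (u j x * v j (x + w)))" for j w
  define B where "B j w = (LINT x|lborel. (\<eta> w x)\<^sup>2 * (u j (x + prj Y w) * v j (x + prj Y w)))" for j w
  have int: "integrable lborel (\<lambda>x. (\<eta> w x)\<^sup>2 * (u j (x + p) * v j (x + q)))" for j w p q
    unfolding power2_eq_square
    by (intro integrable_cc_function cc_function_mult cc_function_continuous cc_function_shift \<eta> u v)
  have AB: "(\<lambda>j. A j w - B j w) \<longlonglongrightarrow> 0" for w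
  proof -
    let ?s = "prj Y w" and ?t = "prj X w"
    \<comment> \<open>Here \<open>v\<close> moves from x + w to x + \<open>?s\<close> along the
      directions X; in the next fact \<open>u\<close> moves from x to the same point along Y, with
      the roles of X and Y and of the two families of fields exchanged.\<close>
    have 1: "(\<lambda>j. LINT x|lborel. (\<eta> w x)\<^sup>2 * u j x * (v j (x + ?t + ?s) - v j (x + ?s))) \<longlonglongrightarrow> 0"
    proof (rule shift_pairing_tendsto_zero[where u=u and u'=u' and m=m and m'=m' and \<eta>="\<eta> w" and \<eta>'="\<eta>' w" and C=C
          and t="?t" and v="\<lambda>j x. v j (x + ?s)" and v'="\<lambda>j x. v' j (x + ?s)"
          and n="\<lambda>j k l x. n j k l (x + ?s)" and n'="\<lambda>j k l x. n' j k l (x + ?s)" and X=X and Y=Y, OF XY(3)])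
      fix j x k assume "\<eta> w x \<noteq> 0" "k \<in> Y"
      then show "u' j x $ k = (\<Sum>l\<in>X. m' j l k x $ l)"
        by (intro du) (auto simp: \<eta>_def)
    next
      fix j x l and r :: real assume *: "\<eta> w x \<noteq> 0" "0 \<le> r" "r \<le> 1" "l \<in> X"
      have "\<beta> (x + r *\<^sub>R ?t + ?s) \<noteq> 0"
        using inside[OF *(1-3), of Y X] XY(1) by (simp add: add.commute add.left_commute)
      then show "v' j (x + r *\<^sub>R ?t + ?s) $ l = (\<Sum>k\<in>Y. n' j k l (x + r *\<^sub>R ?t + ?s) $ k)"
        using *(4) by (rule dv)
    qed (use \<eta> m n u v C m0 n0 in \<open>auto simp: prj_nth Abs_cc_shift intro: C1_gradient_shift cc_function_shift\<close>)
    have 2: "(\<lambda>j. LINT x|lborel. (\<eta> w x)\<^sup>2 * v j (x + ?s) * (u j (x + ?s) - u j x)) \<longlonglongrightarrow> 0"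
    proof (rule shift_pairing_tendsto_zero[where \<eta>="\<eta> w" and \<eta>'="\<eta>' w" and C=C
          and t="?s" and u="\<lambda>j x. v j (x + ?s)" and u'="\<lambda>j x. v' j (x + ?s)" and v=u and v'=u'
          and m="\<lambda>j k l x. n j k l (x + ?s)" and m'="\<lambda>j k l x. n' j k l (x + ?s)" and n=m and n'=m' and X=Y and Y=X, OF XY(2)])
      fix j x k assume "\<eta> w x \<noteq> 0" "k \<in> X"
      then show "v' j (x + ?s) $ k = (\<Sum>l\<in>Y. n' j l k (x + ?s) $ l)"
        using inside[of w x 0 Y X] XY(1) by (intro dv) auto
    next
      fix j x l and r :: real assume *: "\<eta> w x \<noteq> 0" "0 \<le> r" "r \<le> 1" "l \<in> Y"
      have "\<beta> (x + r *\<^sub>R ?s) \<noteq> 0"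
        using inside[OF *(1-3), of "{}" Y] by (simp add: prj_def zero_vec_def[symmetric])
      then show "u' j (x + r *\<^sub>R ?s) $ l = (\<Sum>k\<in>X. m' j k l (x + r *\<^sub>R ?s) $ k)"
        using *(4) by (rule du)
    qed (use \<eta> m n u v C m0 n0 in \<open>auto simp: prj_nth Abs_cc_shift intro: C1_gradient_shift cc_function_shift\<close>)
    have "A j w - B j w = (LINT x|lborel. (\<eta> w x)\<^sup>2 * u j x * (v j (x + ?t + ?s) - v j (x + ?s)))
        - (LINT x|lborel. (\<eta> w x)\<^sup>2 * v j (x + ?s) * (u j (x + ?s) - u j x))" for j
    proof -
      have eq: "x + ?t + ?s = x + w" for x
        by (metis prj_sum add.assoc add.commute)
      have "(LINT x|lborel. (\<eta> w x)\<^sup>2 * u j x * (v j (x + ?t + ?s) - v j (x + ?s)))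
          = A j w - (LINT x|lborel. (\<eta> w x)\<^sup>2 * (u j (x + 0) * v j (x + ?s)))"
        unfolding A_def using Bochner_Integration.integral_diff[OF int[of w j 0 w] int[of w j 0 ?s]]
        by (simp only: eq) (simp add: algebra_simps)
      moreover have "(LINT x|lborel. (\<eta> w x)\<^sup>2 * v j (x + ?s) * (u j (x + ?s) - u j x))
          = B j w - (LINT x|lborel. (\<eta> w x)\<^sup>2 * (u j (x + 0) * v j (x + ?s)))"
        unfolding B_def using Bochner_Integration.integral_diff[OF int[of w j ?s ?s] int[of w j 0 ?s]]
        by (simp add: algebra_simps)
      ultimately show ?thesis by simp
    qed
    then show ?thesis
      using tendsto_diff[OF 1 2] by simp
  qed
  obtain E where E: "E \<ge> 0" "\<And>x. \<bar>\<beta> x\<bar> \<le> E"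
    using bounded_cc_function[OF \<beta>(2)] by blast
  obtain R where R: "\<And>x. norm x > R \<Longrightarrow> \<beta> x = 0"
    using \<beta>(2) unfolding cc_function_def by blast
  have \<eta>_supp: "norm x \<le> R \<and> norm w \<le> 2 * R" if "\<eta> w x \<noteq> 0" for w x
  proof -
    have "norm x \<le> R" "norm (x + w) \<le> R"
      using that R[of x] R[of "x + w"] by (force simp: \<eta>_def)+
    then show ?thesis
      using norm_triangle_ineq4[of "x + w" x] by simp
  qed
  have \<eta>_le: "\<bar>(\<eta> w x)\<^sup>2\<bar> \<le> (E * E)\<^sup>2" for w x
  proof -
    have "\<bar>\<eta> w x\<bar> \<le> E * E"
      unfolding \<eta>_def abs_mult using E by (intro mult_mono) auto
    then show ?thesis
      by (metis abs_ge_zero abs_power2 power2_abs power_mono)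
  qed
  have cont_\<beta>: "continuous_on UNIV \<beta>"
    by (rule cc_function_continuous[OF \<beta>(2)])
  have cont_comp: "continuous_on UNIV (\<lambda>p. f (g p))" if "cc_function f" "continuous_on UNIV g"
    for f :: "real^'m \<Rightarrow> real" and g :: "(real^'m) \<times> (real^'m) \<Rightarrow> real^'m"
    by (rule continuous_on_compose2[OF cc_function_continuous[OF that(1), of UNIV] that(2)]) auto
  have cont_prj_snd: "continuous_on UNIV (\<lambda>p::(real^'m) \<times> (real^'m). prj Z (snd p))" for Z
    by (rule continuous_on_compose2[OF cont_prj[of UNIV]]) (auto intro!: continuous_intros)
  have ccF: "cc_function (\<lambda>p. (\<eta> (snd p) (fst p))\<^sup>2 * (u j (fst p + f (snd p)) * v j (fst p + g (snd p))))"
    if "continuous_on UNIV (\<lambda>p::(real^'m) \<times> (real^'m). f (snd p))" "continuous_on UNIV (\<lambda>p::(real^'m) \<times> (real^'m). g (snd p))" for j f g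
  proof (rule cc_function_Pair[where A=R and B="2 * R"])
    show "continuous_on UNIV (\<lambda>p. (\<eta> (snd p) (fst p))\<^sup>2 * (u j (fst p + f (snd p)) * v j (fst p + g (snd p))))"
      unfolding \<eta>_def
      by (intro continuous_on_mult continuous_on_power cont_comp \<beta> u v continuous_on_add that
          continuous_on_fst continuous_on_snd continuous_on_id)
    show "(\<eta> w x)\<^sup>2 * (u j (x + f w) * v j (x + g w)) \<noteq> 0 \<Longrightarrow> norm x \<le> R \<and> norm w \<le> 2 * R" for x w
      using \<eta>_supp by auto
  qed
  have contid: "continuous_on UNIV (\<lambda>p::(real^'m) \<times> (real^'m). snd p)" "continuous_on UNIV (\<lambda>p::(real^'m) \<times> (real^'m). (0::real^'m))"
    by (intro continuous_intros)+
  have FA: "cc_function (\<lambda>p. (\<eta> (snd p) (fst p))\<^sup>2 * (u j (fst p) * v j (fst p + snd p)))" for j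
    using ccF[OF contid(2) contid(1), of j] by simp
  have FB: "cc_function (\<lambda>p. (\<eta> (snd p) (fst p))\<^sup>2 * (u j (fst p + prj Y (snd p)) * v j (fst p + prj Y (snd p))))" for j
    by (rule ccF[OF cont_prj_snd cont_prj_snd])
  have A_int: "integrable lborel (A j)" "A j \<in> borel_measurable borel" for j
    unfolding A_def[abs_def] by (rule Fubini_cc_function[OF FA])+
  have B_int: "integrable lborel (B j)" "B j \<in> borel_measurable borel" for j
    unfolding B_def[abs_def] by (rule Fubini_cc_function[OF FB])+
  have C0: "C \<ge> 0"
    using C(1)[of 0] norm_ge_zero order_trans by blast
  have bound: "\<bar>LINT x|lborel. (\<eta> w x)\<^sup>2 * (u j (x + p) * v j (x + q))\<bar> \<le> indicator (cball 0 (2 * R)) w * ((E * E)\<^sup>2 * C\<^sup>2)" for j w p q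
  proof (cases "norm w \<le> 2 * R")
    case True
    have cc\<eta>u: "cc_function (\<lambda>x. (\<eta> w x)\<^sup>2 * u j (x + p))"
      unfolding power2_eq_square by (intro cc_function_mult cc_function_continuous cc_function_shift \<eta> u)
    have "(LINT x|lborel. (\<eta> w x)\<^sup>2 * (u j (x + p) * v j (x + q)))
        = inner (Abs_cc (\<lambda>x. (\<eta> w x)\<^sup>2 * u j (x + p))) (Abs_cc (\<lambda>x. v j (x + q)))"
      using cc\<eta>u by (simp add: inner_Abs_cc cc_function_shift v mult.assoc)
    also have "\<bar>\<dots>\<bar> \<le> norm (Abs_cc (\<lambda>x. (\<eta> w x)\<^sup>2 * u j (x + p))) * norm (Abs_cc (\<lambda>x. v j (x + q)))"
      by (rule Cauchy_Schwarz_ineq2)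
    also have "\<dots> \<le> ((E * E)\<^sup>2 * norm (Abs_cc (\<lambda>x. u j (x + p)))) * norm (Abs_cc (\<lambda>x. v j (x + q)))"
      by (intro mult_right_mono norm_Abs_cc_mult_le[OF _ _ \<eta>_le] cc_function_shift u continuous_on_power cc_function_continuous \<eta>) auto
    also have "\<dots> \<le> ((E * E)\<^sup>2 * C) * C"
      using C C0 by (intro mult_mono mult_left_mono) (auto simp: Abs_cc_shift u v)
    finally show ?thesis
      using True by (simp add: power2_eq_square mult.assoc)
  next
    case False
    then have "\<eta> w x = 0" for x
      using \<eta>_supp by blast
    then show ?thesis by simp
  qed
  \<comment> \<open>The convergence is known for each w separately. By the Cauchy-Schwarz inequality
    both integrals are bounded uniformly in j and vanish unless w lies in a ball, which permits
    integration over w.\<close>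
  have lim: "(\<lambda>j. (LINT w|lborel. A j w - B j w)) \<longlonglongrightarrow> (LINT w|(lborel::(real^'m) measure). 0)"
  proof (rule integral_dominated_convergence[where w="\<lambda>w. indicator (cball 0 (2 * R)) w * (2 * ((E * E)\<^sup>2 * C\<^sup>2))"])
    show "integrable lborel (\<lambda>w::real^'m. indicator (cball 0 (2 * R)) w * (2 * ((E * E)\<^sup>2 * C\<^sup>2)))"
      by (intro integrable_mult_left integrable_real_indicator) (use emeasure_bounded_finite[of "cball 0 (2 * R)"] in auto)
    show "AE w in lborel. norm (A j w - B j w) \<le> indicator (cball 0 (2 * R)) w * (2 * ((E * E)\<^sup>2 * C\<^sup>2))" for j
    proof (rule AE_I2)
      fix w
      have "\<bar>A j w\<bar> \<le> indicator (cball 0 (2 * R)) w * ((E * E)\<^sup>2 * C\<^sup>2)"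
        using bound[of w j 0 w] by (simp add: A_def)
      moreover have "\<bar>B j w\<bar> \<le> indicator (cball 0 (2 * R)) w * ((E * E)\<^sup>2 * C\<^sup>2)"
        unfolding B_def by (rule bound)
      ultimately show "norm (A j w - B j w) \<le> indicator (cball 0 (2 * R)) w * (2 * ((E * E)\<^sup>2 * C\<^sup>2))"
        by (simp add: abs_if split: if_splits)
    qed
  qed (use AB A_int B_int in auto)
  have A_eq: "(LINT w|lborel. A j w) = (LINT x|lborel. \<Phi> x * u j x) * (LINT x|lborel. \<Phi> x * v j x)" for j
  proof -
    have "(LINT w|lborel. A j w) = (LINT x|lborel. LINT w|lborel. (\<eta> w x)\<^sup>2 * (u j x * v j (x + w)))"
      unfolding A_def by (rule Fubini_cc_function(1)[OF FA])
    also have "\<dots> = (LINT x|lborel. (\<Phi> x * u j x) * (LINT w|lborel. \<Phi> w * v j w))"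
    proof (rule Bochner_Integration.integral_cong[OF refl])
      fix x
      have meas: "(\<lambda>w. \<Phi> w * v j w) \<in> borel_measurable borel"
        by (intro borel_measurable_continuous_onI continuous_on_mult cc_function_continuous \<Phi> v)
      have "(LINT w|lborel. (\<eta> w x)\<^sup>2 * (u j x * v j (x + w))) = (LINT w|lborel. (\<Phi> x * u j x) * (\<Phi> (w + x) * v j (w + x)))"
        by (intro Bochner_Integration.integral_cong refl) (simp add: \<eta>_def \<Phi>_def power_mult_distrib add.commute)
      also have "\<dots> = (\<Phi> x * u j x) * (LINT w|lborel. \<Phi> (w + x) * v j (w + x))"
        by simp
      also have "(LINT w|lborel. \<Phi> (w + x) * v j (w + x)) = (LINT w|lborel. \<Phi> w * v j w)"
        by (rule integral_lborel_shift[OF meas])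
      finally show "(LINT w|lborel. (\<eta> w x)\<^sup>2 * (u j x * v j (x + w))) = (\<Phi> x * u j x) * (LINT w|lborel. \<Phi> w * v j w)" .
    qed
    finally show ?thesis by simp
  qed
  have B_eq: "(LINT w|lborel. B j w) = (LINT x|lborel. \<Phi> x) * (LINT x|lborel. \<Phi> x * (u j x * v j x))" for j
  proof -
    define J :: "real^'m \<Rightarrow> real^'m" where "J w = (\<chi> i. if i \<in> X then w $ i else - w $ i)" for w
    have cont_J: "continuous_on UNIV (\<lambda>p::(real^'m) \<times> (real^'m). J (snd p))"
    proof -
      have "J w = prj X w - prj Y w" for w
        using XY(1) by (auto simp: vec_eq_iff J_def prj_nth)
      then show ?thesis
        by (simp add: continuous_on_diff cont_prj_snd)
    qed
    have norm_J: "norm (J w) = norm w" for w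
      unfolding norm_vec_def by (rule arg_cong[where f="\<lambda>f. L2_set f UNIV"]) (auto simp: J_def)
    \<comment> \<open>After the substitution by \<open>x - prj Y w\<close> the two weighted points
      differ from x and x + J w only by an exchange of their Y-coordinates, J being the reflection
      in these coordinates. A cutoff of product form does not notice such an exchange.\<close>
    have swap: "\<Phi> (x - prj Y w) * \<Phi> (x - prj Y w + w) = \<Phi> x * \<Phi> (x + J w)" for x w
    proof -
      have "\<beta> (x - prj Y w) * \<beta> (x - prj Y w + w) = \<beta> x * \<beta> (x + J w)"
        unfolding \<beta>_prod prod.distrib[symmetric] using XY(1)
        by (intro prod.cong refl) (auto simp: prj_nth J_def)
      then show ?thesis
        by (simp add: \<Phi>_def power_mult_distrib[symmetric])
    qed
    have B_shift: "B j w = (LINT x|lborel. (\<Phi> x * \<Phi> (x + J w)) * (u j x * v j x))" for w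
    proof -
      define F where "F x = (\<Phi> (x - prj Y w) * \<Phi> (x - prj Y w + w)) * (u j x * v j x)" for x
      have "F = (\<lambda>x. (\<Phi> x * \<Phi> (x + J w)) * (u j x * v j x))"
        by (simp add: F_def swap fun_eq_iff)
      moreover have "continuous_on UNIV (\<lambda>x. (\<Phi> x * \<Phi> (x + J w)) * (u j x * v j x))"
        by (intro continuous_on_mult cc_function_continuous cc_function_shift \<Phi> u v)
      ultimately have meas: "F \<in> borel_measurable borel"
        by (simp add: borel_measurable_continuous_onI)
      have "B j w = (LINT x|lborel. F (x + prj Y w))"
        unfolding B_def F_def
        by (intro Bochner_Integration.integral_cong refl) (simp add: \<eta>_def \<Phi>_def power_mult_distrib)
      also have "\<dots> = (LINT x|lborel. F x)"
        by (rule integral_lborel_shift[OF meas])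
      finally show ?thesis
        by (simp add: F_def swap)
    qed
    have FJ: "cc_function (\<lambda>p. (\<Phi> (fst p) * \<Phi> (fst p + J (snd p))) * (u j (fst p) * v j (fst p)))"
    proof (rule cc_function_Pair[where A=R and B="2 * R"])
      show "continuous_on UNIV (\<lambda>p. (\<Phi> (fst p) * \<Phi> (fst p + J (snd p))) * (u j (fst p) * v j (fst p)))"
        by (intro continuous_on_mult cont_comp \<Phi> u v continuous_on_add cont_J
            continuous_on_fst continuous_on_snd continuous_on_id)
      show "\<Phi> x * \<Phi> (x + J w) * (u j x * v j x) \<noteq> 0 \<Longrightarrow> norm x \<le> R \<and> norm w \<le> 2 * R" for x w
        using \<eta>_supp[of "J w" x] by (auto simp: \<eta>_def \<Phi>_def norm_J)
    qed
    have "(LINT w|lborel. B j w) = (LINT x|lborel. LINT w|lborel. (\<Phi> x * \<Phi> (x + J w)) * (u j x * v j x))"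
      unfolding B_shift by (rule Fubini_cc_function(1)[OF FJ])
    also have "\<dots> = (LINT x|lborel. (\<Phi> x * (u j x * v j x)) * (LINT w|lborel. \<Phi> w))"
    proof (rule Bochner_Integration.integral_cong[OF refl])
      fix x
      have meas: "\<Phi> \<in> borel_measurable borel" "(\<lambda>w. \<Phi> (w + x)) \<in> borel_measurable borel"
        by (intro borel_measurable_continuous_onI cc_function_continuous cc_function_shift \<Phi>)+
      have "(LINT w|lborel. (\<Phi> x * \<Phi> (x + J w)) * (u j x * v j x)) = (\<Phi> x * (u j x * v j x)) * (LINT w|lborel. \<Phi> (J w + x))"
        by (simp add: algebra_simps flip: integral_mult_right_zero)
      also have "(LINT w|lborel. \<Phi> (J w + x)) = (LINT w|lborel. \<Phi> (w + x))"
        unfolding J_def by (rule integral_lborel_reflect[OF meas(2)])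
      also have "\<dots> = (LINT w|lborel. \<Phi> w)"
        by (rule integral_lborel_shift[OF meas(1)])
      finally show "(LINT w|lborel. (\<Phi> x * \<Phi> (x + J w)) * (u j x * v j x)) = (\<Phi> x * (u j x * v j x)) * (LINT w|lborel. \<Phi> w)" .
    qed
    finally show ?thesis by simp
  qed
  have "(\<lambda>j. - (LINT w|lborel. A j w - B j w)) \<longlonglongrightarrow> - 0"
    using lim by (intro tendsto_minus) simp
  then show ?thesis
    using A_int B_int by (simp add: A_eq B_eq)
qed

section \<open>Smooth bump functions\<close>

primrec Ck_real :: "nat \<Rightarrow> (real \<Rightarrow> real) \<Rightarrow> bool" where
  "Ck_real 0 f \<longleftrightarrow> continuous_on UNIV f"
| "Ck_real (Suc k) f \<longleftrightarrow> (\<forall>x. f field_differentiable at x) \<and> Ck_real k (deriv f)"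

lemma Ck_real_Suc_I:
  assumes "\<And>x. (f has_real_derivative f' x) (at x)" "Ck_real k f'"
  shows "Ck_real (Suc k) f"
proof -
  have "deriv f = f'"
    using assms(1) by (auto intro: DERIV_imp_deriv)
  then show ?thesis
    using assms by (auto simp: field_differentiable_def)
qed

lemma Ck_real_Suc_D: "Ck_real (Suc k) f \<Longrightarrow> Ck_real k f"
proof (induction k arbitrary: f)
  case 0
  then show ?case
    by (auto intro!: continuous_at_imp_continuous_on field_differentiable_imp_continuous_at)
qed auto

lemma Ck_real_deriv:
  "Ck_real (Suc k) f \<Longrightarrow> (f has_real_derivative deriv f x) (at x)"
  by (simp add: field_differentiable_derivI)

lemma Ck_real_add: "Ck_real k f \<Longrightarrow> Ck_real k g \<Longrightarrow> Ck_real k (\<lambda>x. f x + g x)"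
proof (induction k arbitrary: f g)
  case (Suc k)
  show ?case
    by (rule Ck_real_Suc_I[where f'="\<lambda>x. deriv f x + deriv g x"])
      (use Suc Ck_real_deriv in \<open>auto intro!: derivative_intros Suc.IH\<close>)
qed (auto intro: continuous_intros)

lemma Ck_real_mult: "Ck_real k f \<Longrightarrow> Ck_real k g \<Longrightarrow> Ck_real k (\<lambda>x. f x * g x)"
proof (induction k arbitrary: f g)
  case (Suc k)
  show ?case
  proof (rule Ck_real_Suc_I)
    show "((\<lambda>x. f x * g x) has_real_derivative (deriv f x * g x + deriv g x * f x)) (at x)" for x
      using Suc.prems Ck_real_deriv by (intro DERIV_mult) auto
    show "Ck_real k (\<lambda>x. deriv f x * g x + deriv g x * f x)"
      using Suc.prems Ck_real_Suc_D by (intro Ck_real_add Suc.IH) auto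
  qed
qed (auto intro: continuous_intros)

lemma Ck_real_const: "Ck_real k (\<lambda>x. c)"
proof (induction k arbitrary: c)
  case (Suc k)
  show ?case
    by (rule Ck_real_Suc_I[where f'="\<lambda>x. 0"]) (auto intro: Suc)
qed auto

lemma Ck_real_affine: "Ck_real k f \<Longrightarrow> Ck_real k (\<lambda>x. f (a * x + c))"
proof (induction k arbitrary: f)
  case 0
  then show ?case
    by (auto intro!: continuous_on_compose2[of UNIV f _ "\<lambda>x. a * x + c"] continuous_intros)
next
  case (Suc k)
  show ?case
  proof (rule Ck_real_Suc_I)
    show "((\<lambda>x. f (a * x + c)) has_real_derivative (deriv f (a * x + c) * a)) (at x)" for x
      using Ck_real_deriv[OF Suc.prems]
      by (intro DERIV_chain2[of f]) (auto intro!: derivative_eq_intros)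
    show "Ck_real k (\<lambda>x. deriv f (a * x + c) * a)"
      using Suc.prems by (intro Ck_real_mult Ck_real_const Suc.IH) simp
  qed
qed

section \<open>A flat exponential and the bump built from it\<close>

definition flat_exp :: "real poly \<Rightarrow> real \<Rightarrow> real" where
  "flat_exp p t = (if t > 0 then poly p (1 / t) * exp (- (1 / t)) else 0)"

lemma poly_exp_tendsto_0: "((\<lambda>y. poly p y * exp (- y)) \<longlongrightarrow> 0) at_top" for p :: "real poly"
proof -
  have 1: "((\<lambda>y::real. y ^ i * exp (- y)) \<longlongrightarrow> 0) at_top" for i
    using tendsto_power_div_exp_0[of i] by (simp add: exp_minus divide_inverse)
  have "((\<lambda>y. \<Sum>i\<le>degree p. coeff p i * (y ^ i * exp (- y))) \<longlongrightarrow> (\<Sum>i\<le>degree p. coeff p i * 0)) at_top"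
    by (intro tendsto_intros 1)
  then show ?thesis
    by (simp add: poly_altdef sum_distrib_right mult.assoc)
qed

text \<open>The functions p(y) exp(-y) with y = 1 / t are closed under differentiation: dy/dt =
  -y^2, which turns p into y^2 (p - p'). Smoothness of all of them then needs only continuity and an
  induction over all p at once.\<close>

lemma DERIV_flat_exp:
  "(flat_exp p has_real_derivative flat_exp ([:0, 0, 1:] * (p - pderiv p)) t) (at t)"
proof -
  let ?q = "[:0, 0, 1:] * (p - pderiv p)"
  consider "t > 0" | "t < 0" | "t = 0" by linarith
  then show ?thesis
  proof cases
    case 1
    have "((\<lambda>t. poly p (1 / t) * exp (- (1 / t))) has_real_derivative flat_exp ?q t) (at t)"
      using 1 by (auto intro!: derivative_eq_intros poly_DERIV[THEN DERIV_chain2] simp: flat_exp_def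
          field_simps power2_eq_square)
    then show ?thesis
      by (rule has_field_derivative_transform_within_open[of _ _ _ "{0<..}"])
        (use 1 in \<open>auto simp: flat_exp_def\<close>)
  next
    case 2
    have "((\<lambda>t. 0) has_real_derivative flat_exp ?q t) (at t)"
      using 2 by (simp add: flat_exp_def)
    then show ?thesis
      by (rule has_field_derivative_transform_within_open[of _ _ _ "{..<0}"])
        (use 2 in \<open>auto simp: flat_exp_def\<close>)
  next
    case 3
    have "((\<lambda>h. flat_exp p h / h) \<longlongrightarrow> 0) (at_left 0)"
      by (rule tendsto_eventually) (auto simp: eventually_at_filter flat_exp_def)
    moreover have "((\<lambda>h. flat_exp p h / h) \<longlongrightarrow> 0) (at_right 0)"
    proof -
      \<comment> \<open>At the origin the division by h is another factor 1 / h in the polynomial,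
        which is what \<open>pCons 0\<close> adds, so the decay of a polynomial times exp(-y)
        settles the difference quotient too.\<close>
      have "((\<lambda>h. poly (pCons 0 p) (inverse h) * exp (- inverse h)) \<longlongrightarrow> 0) (at_right 0)"
        by (rule filterlim_compose[OF poly_exp_tendsto_0 filterlim_inverse_at_top_right])
      moreover have "\<forall>\<^sub>F h in at_right 0. poly (pCons 0 p) (inverse h) * exp (- inverse h) = flat_exp p h / h"
        by (auto simp: eventually_at_filter flat_exp_def field_simps)
      ultimately show ?thesis
        by (rule Lim_transform_eventually)
    qed
    ultimately have "((\<lambda>h. flat_exp p h / h) \<longlongrightarrow> 0) (at 0)"
      by (rule filterlim_split_at)
    then show ?thesis
      using 3 by (simp add: DERIV_def) (simp add: flat_exp_def)
  qed
qed

lemma Ck_real_flat_exp: "Ck_real k (flat_exp p)"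
proof (induction k arbitrary: p)
  case 0
  show ?case
    using DERIV_flat_exp by (auto intro!: continuous_at_imp_continuous_on DERIV_isCont)
next
  case (Suc k)
  show ?case
    by (rule Ck_real_Suc_I[OF DERIV_flat_exp Suc])
qed

definition bump :: "real \<Rightarrow> real" where
  "bump x = flat_exp 1 (x + 1) * flat_exp 1 (- x + 1)"

lemma Ck_real_bump: "Ck_real k bump"
  using Ck_real_mult[OF Ck_real_affine[OF Ck_real_flat_exp, of k 1 1 1] Ck_real_affine[OF Ck_real_flat_exp, of k 1 "-1" 1]]
  by (simp add: bump_def[abs_def])

lemma bump_nonneg: "bump x \<ge> 0"
  by (simp add: bump_def flat_exp_def)

lemma bump_nonzero_iff: "bump x \<noteq> 0 \<longleftrightarrow> \<bar>x\<bar> < 1"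
  by (auto simp: bump_def flat_exp_def)

section \<open>Products of functions of one coordinate\<close>

definition coord_prod :: "('m::finite \<Rightarrow> real \<Rightarrow> real) \<Rightarrow> real^'m \<Rightarrow> real" where
  "coord_prod b x = (\<Prod>i\<in>UNIV. b i (x $ i))"

lemma coord_prod_nonzero_iff: "coord_prod b x \<noteq> 0 \<longleftrightarrow> (\<forall>i. b i (x $ i) \<noteq> 0)"
  by (simp add: coord_prod_def)

lemma coord_prod_remove: "coord_prod b x = b j (x $ j) * (\<Prod>i\<in>UNIV - {j}. b i (x $ i))"
  using prod.remove[of UNIV j "\<lambda>i. b i (x $ i)"] by (simp add: coord_prod_def)

lemma GDERIV_coord_prod:
  assumes "\<And>i y. (b i has_real_derivative b' i y) (at y)"
  shows "GDERIV (coord_prod b) x :> (\<chi> j. coord_prod (b(j := b' j)) x)"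
proof -
  have "((\<lambda>x. b i (x $ i)) has_derivative (\<lambda>h. h $ i * b' i (x $ i))) (at x)" for i
  proof -
    have "((\<lambda>x. x $ i) has_derivative (\<lambda>h. h $ i)) (at x)"
      by (rule bounded_linear_imp_has_derivative) (rule bounded_linear_vec_nth)
    from has_derivative_compose[OF this, of "b i" "\<lambda>h. h * b' i (x $ i)"] show ?thesis
      using assms[of i "x $ i"] by (simp add: has_field_derivative_def mult_commute_abs)
  qed
  then have "(coord_prod b has_derivative (\<lambda>h. \<Sum>i\<in>UNIV. (h $ i * b' i (x $ i)) * (\<Prod>j\<in>UNIV - {i}. b j (x $ j)))) (at x)"
    unfolding coord_prod_def[abs_def] by (intro has_derivative_prod)
  also have "(\<lambda>h. \<Sum>i\<in>UNIV. (h $ i * b' i (x $ i)) * (\<Prod>j\<in>UNIV - {i}. b j (x $ j)))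
      = (\<lambda>h. inner h (\<chi> j. coord_prod (b(j := b' j)) x))"
  proof
    fix h :: "real^'a"
    have "coord_prod (b(i := b' i)) x = b' i (x $ i) * (\<Prod>j\<in>UNIV - {i}. b j (x $ j))" for i
      by (subst coord_prod_remove[of _ _ i]) (auto intro!: prod.cong)
    then show "(\<Sum>i\<in>UNIV. (h $ i * b' i (x $ i)) * (\<Prod>j\<in>UNIV - {i}. b j (x $ j))) = inner h (\<chi> j. coord_prod (b(j := b' j)) x)"
      by (simp add: inner_vec_def mult.assoc)
  qed
  finally show ?thesis
    by (simp add: gderiv_def)
qed

lemma partial_deriv_GDERIV:
  assumes "GDERIV f x :> D"
  shows "partial_deriv j f x = D $ j"
proof -
  have eq: "frechet_derivative f (at x) = (\<lambda>h. inner h D)"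
    using assms unfolding gderiv_def by (rule frechet_derivative_at[symmetric])
  show ?thesis
    by (simp add: partial_deriv_def eq inner_axis')
qed

lemma continuous_coord_prod:
  assumes "\<And>i. continuous_on UNIV (b i)"
  shows "continuous_on UNIV (coord_prod b)"
  unfolding coord_prod_def[abs_def]
proof (rule continuous_on_prod)
  show "continuous_on UNIV (\<lambda>x. b i (x $ i))" for i
    by (rule continuous_on_compose2[OF assms[of i]]) (auto intro: continuous_intros)
qed

text \<open>A partial derivative exchanges one factor for its derivative and remains a product, so
  smoothness reduces to one variable. Products serve three times: as the cutoffs of
  \<open>product_weak_continuity\<close>, as the mollifier, and as the test functions in
  \<open>mollify_gradient_symmetric\<close>.\<close>

lemma C_k_coord_prod:
  assumes "\<And>i. Ck_real k (b i)"
  shows "C_k k (coord_prod b)"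
  using assms
proof (induction k arbitrary: b)
  case 0
  then show ?case
    by (simp add: continuous_coord_prod)
next
  case (Suc k)
  have G: "GDERIV (coord_prod b) x :> (\<chi> j. coord_prod (b(j := deriv (b j))) x)" for x
    by (intro GDERIV_coord_prod Ck_real_deriv[OF Suc.prems])
  have "partial_deriv j (coord_prod b) = coord_prod (b(j := deriv (b j)))" for j
    using partial_deriv_GDERIV[OF G] by auto
  moreover have "C_k k (coord_prod (b(j := deriv (b j))))" for j
    using Suc.prems Ck_real_Suc_D by (intro Suc.IH) auto
  moreover have "coord_prod b differentiable at x" for x
    using G unfolding gderiv_def differentiable_def by blast
  ultimately show ?case by simp
qed

lemma C1_gradient_coord_prod:
  assumes "\<And>i. Ck_real (Suc 0) (b i)"
  shows "C1_gradient (coord_prod b) (\<lambda>x. \<chi> j. coord_prod (b(j := deriv (b j))) x)"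
  unfolding C1_gradient_def
proof (intro conjI allI)
  have b: "continuous_on UNIV (b i)" "continuous_on UNIV (deriv (b i))" for i
    using assms[of i] Ck_real_Suc_D[of 0 "b i"] by auto
  show "GDERIV (coord_prod b) x :> (\<chi> j. coord_prod (b(j := deriv (b j))) x)" for x
    by (intro GDERIV_coord_prod Ck_real_deriv[OF assms])
  show "continuous_on UNIV (\<lambda>x. \<chi> j. coord_prod (b(j := deriv (b j))) x)"
    by (intro continuous_on_vec_lambda continuous_coord_prod) (use b in auto)
qed

section \<open>Uniform estimates and correlation with a kernel\<close>

lemma uniformly_continuous_on_UNIV_bounded_support:
  fixes f :: "'a::euclidean_space \<Rightarrow> 'b::real_normed_vector"
  assumes f: "continuous_on UNIV f" and B: "\<And>x. norm x > B \<Longrightarrow> f x = 0"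
  shows "uniformly_continuous_on UNIV f"
  unfolding uniformly_continuous_on_def
proof (intro allI impI)
  fix e :: real assume e: "e > 0"
  have "uniformly_continuous_on (cball 0 (B + 1)) f"
    by (intro compact_uniformly_continuous continuous_on_subset[OF f]) auto
  then obtain d where d: "d > 0"
    "\<And>x y. x \<in> cball 0 (B + 1) \<Longrightarrow> y \<in> cball 0 (B + 1) \<Longrightarrow> dist y x < d \<Longrightarrow> dist (f y) (f x) < e"
    using e unfolding uniformly_continuous_on_def by metis
  have "dist (f y) (f x) < e" if xy: "dist y x < min d 1" for x y
  proof (cases "norm x \<le> B + 1 \<and> norm y \<le> B + 1")
    case True
    then show ?thesis
      using xy by (intro d(2)) auto
  next
    case False
    have "norm (y - x) < 1"
      using xy by (simp add: dist_norm)
    then have "\<bar>norm x - norm y\<bar> < 1"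
      using norm_triangle_ineq3[of y x] by linarith
    then have "norm x > B" "norm y > B"
      using False by linarith+
    then show ?thesis
      using B e by simp
  qed
  then show "\<exists>d>0. \<forall>x\<in>UNIV. \<forall>x'\<in>UNIV. dist x' x < d \<longrightarrow> dist (f x') (f x) < e"
    using d(1) by (intro exI[of _ "min d 1"]) auto
qed

lemma C1_gradient_uniformly_continuous:
  assumes "C1_gradient f f'" "cc_function f"
  shows "uniformly_continuous_on UNIV f'"
proof -
  obtain B where "\<And>x. norm x > B \<Longrightarrow> f x = 0"
    using assms unfolding cc_function_def by blast
  then show ?thesis
    using assms(1) C1_gradient_zero_outside[OF assms(1)]
    by (intro uniformly_continuous_on_UNIV_bounded_support[of f' B]) (auto simp: C1_gradient_def)
qed

lemma C1_gradient_uniform_remainder: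
  assumes f: "C1_gradient f f'" "cc_function f" and e: "e > 0"
  shows "\<exists>d>0. \<forall>x h. norm h < d \<longrightarrow> \<bar>f (x + h) - f x - inner h (f' x)\<bar> \<le> e * norm h"
proof -
  obtain d where d: "d > 0" "\<And>x y. dist y x < d \<Longrightarrow> dist (f' y) (f' x) < e"
    using C1_gradient_uniformly_continuous[OF f] e unfolding uniformly_continuous_on_def by auto
  have "\<bar>f (x + h) - f x - inner h (f' x)\<bar> \<le> e * norm h" if h: "norm h < d" for x h
  proof -
    obtain \<theta> where \<theta>: "0 < \<theta>" "\<theta> < 1" "f (x + 1 *\<^sub>R h) - f (x + 0 *\<^sub>R h) = (1 - 0) * inner h (f' (x + \<theta> *\<^sub>R h))"
      using MVT2[of 0 1 "\<lambda>s. f (x + s *\<^sub>R h)" "\<lambda>s. inner h (f' (x + s *\<^sub>R h))"] C1_gradient_along_line[OF f(1)] by auto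
    have "norm (\<theta> *\<^sub>R h) \<le> norm h"
      using \<theta> by (simp add: mult_left_le_one_le)
    then have "dist (f' (x + \<theta> *\<^sub>R h)) (f' x) < e"
      using h by (intro d(2)) (simp add: dist_norm)
    then have "norm (f' (x + \<theta> *\<^sub>R h) - f' x) \<le> e"
      by (simp add: dist_norm)
    have "\<bar>f (x + h) - f x - inner h (f' x)\<bar> = \<bar>inner h (f' (x + \<theta> *\<^sub>R h) - f' x)\<bar>"
      using \<theta>(3) by (simp add: inner_diff_right)
    also have "\<dots> \<le> norm h * norm (f' (x + \<theta> *\<^sub>R h) - f' x)"
      by (rule Cauchy_Schwarz_ineq2)
    also have "\<dots> \<le> norm h * e"
      using \<open>norm (f' (x + \<theta> *\<^sub>R h) - f' x) \<le> e\<close> by (intro mult_left_mono) auto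
    finally show ?thesis by (simp add: mult.commute)
  qed
  then show ?thesis using d(1) by blast
qed

lemma integrable_mult_bounded_continuous:
  fixes F :: "'a::euclidean_space \<Rightarrow> real" and \<psi> :: "'a \<Rightarrow> 'b::euclidean_space"
  assumes F: "integrable lborel F" and \<psi>: "continuous_on UNIV \<psi>" and C: "\<And>x. norm (\<psi> x) \<le> C"
  shows "integrable lborel (\<lambda>x. F x *\<^sub>R \<psi> x)"
proof (rule Bochner_Integration.integrable_bound[where f="\<lambda>x. C * F x"])
  have [measurable]: "\<psi> \<in> borel_measurable borel" "F \<in> borel_measurable borel"
    using \<psi> borel_measurable_integrable[OF F] by (auto intro: borel_measurable_continuous_onI)
  show "(\<lambda>x. F x *\<^sub>R \<psi> x) \<in> borel_measurable lborel"
    by measurable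
  have "C \<ge> 0"
    using C norm_ge_zero order_trans by blast
  then have "norm (F x *\<^sub>R \<psi> x) \<le> norm (C * F x)" for x
    using mult_left_mono[OF C[of x], of "\<bar>F x\<bar>"] by (simp add: abs_mult mult.commute)
  then show "AE x in lborel. norm (F x *\<^sub>R \<psi> x) \<le> norm (C * F x)"
    by simp
qed (use F in simp)

lemma continuous_on_minus_shift:
  fixes f :: "'a::real_normed_vector \<Rightarrow> 'b::topological_space"
  assumes "continuous_on UNIV f"
  shows "continuous_on UNIV (\<lambda>y. f (y - z))" "continuous_on UNIV (\<lambda>z. f (y - z))"
  by (rule continuous_on_compose2[OF assms]; auto intro: continuous_intros)+

text \<open>The first-order remainder of the kernel is small uniformly in the base point, so it can
  be integrated against \<bar>F\<bar> directly. The kernel is evaluated at y - z, whence the minus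
  sign in the gradient.\<close>

lemma C1_gradient_correlation:
  fixes F :: "'a::euclidean_space \<Rightarrow> real"
  assumes F: "integrable lborel F" and \<psi>: "C1_gradient \<psi> \<psi>'" "cc_function \<psi>"
  shows "C1_gradient (\<lambda>z. LINT y|lborel. F y * \<psi> (y - z)) (\<lambda>z. - (LINT y|lborel. F y *\<^sub>R \<psi>' (y - z)))"
proof -
  have cont': "continuous_on UNIV \<psi>'"
    using \<psi>(1) by (simp add: C1_gradient_def)
  obtain B where B: "\<And>x. norm x > B \<Longrightarrow> \<psi> x = 0"
    using \<psi> unfolding cc_function_def by blast
  have "bounded (\<psi>' ` cball 0 B)"
    by (intro compact_imp_bounded compact_continuous_image continuous_on_subset[OF cont']) auto
  then obtain C0 where C0: "\<forall>x\<in>cball 0 B. norm (\<psi>' x) \<le> C0"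
    unfolding bounded_iff by auto
  have C': "norm (\<psi>' x) \<le> max C0 0" for x
  proof (cases "norm x > B")
    case True
    then have "\<psi>' x = 0"
      using B C1_gradient_zero_outside[OF \<psi>(1), of B x] by blast
    then show ?thesis by simp
  qed (use C0 in \<open>auto simp: max.coboundedI1\<close>)
  obtain C where C: "\<And>x. \<bar>\<psi> x\<bar> \<le> C"
    using bounded_cc_function[OF \<psi>(2)] by blast
  have int: "integrable lborel (\<lambda>y. F y * \<psi> (y - z))" for z
  proof -
    have "integrable lborel (\<lambda>y. F y *\<^sub>R \<psi> (y - z))"
      by (rule integrable_mult_bounded_continuous[OF F continuous_on_minus_shift(1)[OF cc_function_continuous[OF \<psi>(2)]], where C=C])
        (simp add: C)
    then show ?thesis by simp
  qed
  have int': "integrable lborel (\<lambda>y. F y *\<^sub>R \<psi>' (y - z))" for z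
    by (rule integrable_mult_bounded_continuous[OF F continuous_on_minus_shift(1)[OF cont'] C'])
  \<comment> \<open>The summand 1 keeps the divisor positive even if F vanishes almost
    everywhere.\<close>
  define M where "M = (LINT y|lborel. \<bar>F y\<bar>) + 1"
  have M: "M > 0"
    unfolding M_def by (intro add_nonneg_pos) auto
  show ?thesis
    unfolding C1_gradient_def
  proof (intro conjI allI)
    fix z
    show "GDERIV (\<lambda>z. LINT y|lborel. F y * \<psi> (y - z)) z :> - (LINT y|lborel. F y *\<^sub>R \<psi>' (y - z))"
      unfolding gderiv_def has_derivative_at_alt
    proof (intro conjI allI impI)
      show "bounded_linear (\<lambda>h. inner h (- (LINT y|lborel. F y *\<^sub>R \<psi>' (y - z))))"
        by (rule bounded_linear_inner_left)
      fix e :: real assume e: "e > 0"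
      obtain d where d: "d > 0" "\<And>x h. norm h < d \<Longrightarrow> \<bar>\<psi> (x + h) - \<psi> x - inner h (\<psi>' x)\<bar> \<le> e / M * norm h"
        using C1_gradient_uniform_remainder[OF \<psi>, of "e / M"] e M by auto
      have "norm ((LINT y|lborel. F y * \<psi> (y - w)) - (LINT y|lborel. F y * \<psi> (y - z))
          - inner (w - z) (- (LINT y|lborel. F y *\<^sub>R \<psi>' (y - z)))) \<le> e * norm (w - z)" if w: "norm (w - z) < d" for w
      proof -
        let ?r = "\<lambda>y. \<psi> (y - w) - \<psi> (y - z) - inner (z - w) (\<psi>' (y - z))"
        have r: "\<bar>?r y\<bar> \<le> e / M * norm (w - z)" for y
          using d(2)[of "z - w" "y - z"] w by (simp add: norm_minus_commute)
        have "inner (z - w) (LINT y|lborel. F y *\<^sub>R \<psi>' (y - z)) = (LINT y|lborel. inner (z - w) (F y *\<^sub>R \<psi>' (y - z)))"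
          by (rule integral_inner_right[symmetric]) (rule int')
        moreover have "integrable lborel (\<lambda>y. inner (z - w) (F y *\<^sub>R \<psi>' (y - z)))"
          by (intro integrable_inner_right int')
        ultimately have eq: "(LINT y|lborel. F y * \<psi> (y - w)) - (LINT y|lborel. F y * \<psi> (y - z))
          - inner (w - z) (- (LINT y|lborel. F y *\<^sub>R \<psi>' (y - z))) = (LINT y|lborel. F y * ?r y)"
          and ir: "integrable lborel (\<lambda>y. F y * ?r y)"
          using int[of w] int[of z]
          by (simp_all add: right_diff_distrib inner_diff_left)
        have "norm (LINT y|lborel. F y * ?r y) \<le> (LINT y|lborel. \<bar>F y\<bar> * (e / M * norm (w - z)))"
        proof (rule order_trans[OF integral_norm_bound integral_mono])
          show "integrable lborel (\<lambda>y. norm (F y * ?r y))"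
            using ir by (rule integrable_norm)
          show "integrable lborel (\<lambda>y. \<bar>F y\<bar> * (e / M * norm (w - z)))"
            using F by (intro integrable_mult_left integrable_abs)
          show "norm (F y * ?r y) \<le> \<bar>F y\<bar> * (e / M * norm (w - z))" for y
            using r[of y] by (simp only: real_norm_def abs_mult mult_left_mono abs_ge_zero)
        qed
        also have "\<dots> = (M - 1) * (e / M * norm (w - z))"
          by (simp add: M_def)
        also have "\<dots> \<le> M * (e / M * norm (w - z))"
          using e M by (intro mult_right_mono) auto
        also have "\<dots> = e * norm (w - z)"
          using M by simp
        finally show ?thesis
          by (simp only: eq)
      qed
      then show "\<exists>d>0. \<forall>w. norm (w - z) < d \<longrightarrow> norm ((LINT y|lborel. F y * \<psi> (y - w)) - (LINT y|lborel. F y * \<psi> (y - z))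
          - inner (w - z) (- (LINT y|lborel. F y *\<^sub>R \<psi>' (y - z)))) \<le> e * norm (w - z)"
        using d(1) by blast
    qed
  next
    have "continuous_on UNIV (\<lambda>z. LINT y|lborel. F y *\<^sub>R \<psi>' (y - z))"
      unfolding continuous_on_iff
    proof (intro ballI allI impI)
      fix z :: 'a and e :: real assume e: "e > 0"
      obtain d where d: "d > 0" "\<And>x y. dist y x < d \<Longrightarrow> dist (\<psi>' y) (\<psi>' x) < e / M"
        using C1_gradient_uniformly_continuous[OF \<psi>] e M unfolding uniformly_continuous_on_def
        by (metis UNIV_I divide_pos_pos)
      have "dist (LINT y|lborel. F y *\<^sub>R \<psi>' (y - w)) (LINT y|lborel. F y *\<^sub>R \<psi>' (y - z)) < e" if w: "dist w z < d" for w
      proof -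
        have "dist (LINT y|lborel. F y *\<^sub>R \<psi>' (y - w)) (LINT y|lborel. F y *\<^sub>R \<psi>' (y - z))
            = norm (LINT y|lborel. F y *\<^sub>R \<psi>' (y - w) - F y *\<^sub>R \<psi>' (y - z))"
          by (simp add: dist_norm int')
        also have "\<dots> \<le> (LINT y|lborel. \<bar>F y\<bar> * (e / M))"
        proof (rule order_trans[OF integral_norm_bound integral_mono])
          show "integrable lborel (\<lambda>y. norm (F y *\<^sub>R \<psi>' (y - w) - F y *\<^sub>R \<psi>' (y - z)))"
            by (intro integrable_norm Bochner_Integration.integrable_diff int')
          show "integrable lborel (\<lambda>y. \<bar>F y\<bar> * (e / M))"
            using F by (intro integrable_mult_left integrable_abs)
          fix y
          have "norm (\<psi>' (y - w) - \<psi>' (y - z)) \<le> e / M"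
            using d(2)[of "y - w" "y - z"] w by (simp add: dist_norm norm_minus_commute)
          then show "norm (F y *\<^sub>R \<psi>' (y - w) - F y *\<^sub>R \<psi>' (y - z)) \<le> \<bar>F y\<bar> * (e / M)"
            unfolding scaleR_diff_right[symmetric] norm_scaleR by (rule mult_left_mono) simp
        qed
        also have "\<dots> = (M - 1) * (e / M)"
          by (simp add: M_def)
        also have "\<dots> < e"
          using e M by (simp add: field_simps)
        finally show ?thesis .
      qed
      then show "\<exists>d>0. \<forall>w\<in>UNIV. dist w z < d \<longrightarrow> dist (LINT y|lborel. F y *\<^sub>R \<psi>' (y - w)) (LINT y|lborel. F y *\<^sub>R \<psi>' (y - z)) < e"
        using d(1) by blast
    qed
    then show "continuous_on UNIV (\<lambda>z. - (LINT y|lborel. F y *\<^sub>R \<psi>' (y - z)))"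
      by (rule continuous_on_minus)
  qed
qed

section \<open>Mollification\<close>

text \<open>The graph of a convex power lies above its tangent at m. Taking m to be a weighted mean
  and integrating gives Jensen's inequality for integer powers.\<close>

lemma bernoulli_tangent:
  fixes a m :: real
  assumes "a \<ge> 0" "m \<ge> 0"
  shows "m ^ Suc q + real (Suc q) * m ^ q * (a - m) \<le> a ^ Suc q"
proof (induction q)
  case (Suc q)
  have "m ^ Suc (Suc q) + real (Suc (Suc q)) * m ^ Suc q * (a - m)
      \<le> m ^ Suc (Suc q) + real (Suc (Suc q)) * m ^ Suc q * (a - m) + real (Suc q) * m ^ q * (a - m)\<^sup>2"
    using assms by simp
  also have "\<dots> = a * (m ^ Suc q + real (Suc q) * m ^ q * (a - m))"
    by (simp add: algebra_simps power2_eq_square)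
  also have "\<dots> \<le> a * a ^ Suc q"
    using assms Suc by (intro mult_left_mono)
  finally show ?case by simp
qed simp

lemma abs_add_power_le: "\<bar>a + b\<bar> ^ p \<le> 2 ^ p * (\<bar>a\<bar> ^ p + \<bar>b\<bar> ^ p)" for a b :: real
proof -
  have "\<bar>a + b\<bar> ^ p \<le> (2 * max \<bar>a\<bar> \<bar>b\<bar>) ^ p"
    by (intro power_mono) auto
  also have "\<dots> = 2 ^ p * max \<bar>a\<bar> \<bar>b\<bar> ^ p"
    by (simp add: power_mult_distrib)
  also have "max \<bar>a\<bar> \<bar>b\<bar> ^ p \<le> \<bar>a\<bar> ^ p + \<bar>b\<bar> ^ p"
    by (simp add: max_def)
  finally show ?thesis by simp
qed

definition mollifier :: "real \<Rightarrow> real^'m::finite \<Rightarrow> real" where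
  "mollifier \<delta> = coord_prod (\<lambda>i x. bump (1 / \<delta> * x + 0))"

text \<open>The kernel is taken at y - z, so that as a function of y it is a translated test
  function, ready for the weak derivative identity. Division by the integral replaces a
  normalisation constant; of this integral only positivity is ever used.\<close>

definition mollify :: "real \<Rightarrow> (real^'m::finite \<Rightarrow> real) \<Rightarrow> real^'m \<Rightarrow> real" where
  "mollify \<delta> F z = (LINT y|lborel. F y * mollifier \<delta> (y - z)) / (LINT y|lborel. mollifier \<delta> (y :: real^'m))"

lemma mollifier_nonneg: "mollifier \<delta> x \<ge> 0"
  by (simp add: mollifier_def coord_prod_def prod_nonneg bump_nonneg)

lemma mollifier_nonzero: "\<delta> > 0 \<Longrightarrow> mollifier \<delta> x \<noteq> 0 \<longleftrightarrow> (\<forall>i. \<bar>x $ i\<bar> < \<delta>)"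
  by (auto simp: mollifier_def coord_prod_nonzero_iff bump_nonzero_iff field_simps)

lemma norm_less_of_components:
  fixes x :: "real^'m::finite" and \<delta> :: real
  assumes "\<And>i. \<bar>x $ i\<bar> < \<delta>"
  shows "norm x < CARD('m) * \<delta>"
proof -
  have "norm x \<le> (\<Sum>i\<in>UNIV. \<bar>x $ i\<bar>)"
    by (rule norm_le_l1_cart)
  also have "\<dots> < (\<Sum>i\<in>(UNIV::'m set). \<delta>)"
    using assms by (intro sum_strict_mono) auto
  finally show ?thesis by simp
qed

lemma mollifier_zero_outside:
  fixes x :: "real^'m::finite" and \<delta> :: real
  assumes "\<delta> > 0" "norm x > CARD('m) * \<delta>"
  shows "mollifier \<delta> x = 0"
  using norm_less_of_components[of x \<delta>] mollifier_nonzero[OF assms(1), of x] assms(2) by force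

lemma Ck_real_bump_scaled: "Ck_real k (\<lambda>x. bump (1 / \<delta> * x + 0))"
  by (rule Ck_real_affine[OF Ck_real_bump])

lemma cc_function_mollifier:
  assumes "\<delta> > 0"
  shows "cc_function (mollifier \<delta> :: real^'m::finite \<Rightarrow> real)"
proof -
  have "continuous_on UNIV (mollifier \<delta> :: real^'m \<Rightarrow> real)"
    unfolding mollifier_def using Ck_real_bump_scaled[of 0 \<delta>] by (intro continuous_coord_prod) simp
  then show ?thesis
    using mollifier_zero_outside[OF assms] unfolding cc_function_def by blast
qed

lemma integral_mollifier_pos:
  assumes "\<delta> > 0"
  shows "(LINT y|lborel. mollifier \<delta> (y :: real^'m::finite)) > 0"
proof -
  let ?\<rho> = "mollifier \<delta> :: real^'m \<Rightarrow> real"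
  have int: "integrable lborel ?\<rho>"
    by (intro integrable_cc_function cc_function_mollifier assms)
  have "(LINT y|lborel. ?\<rho> y) \<noteq> 0"
  proof
    assume "(LINT y|lborel. ?\<rho> y) = 0"
    then have "AE y in lborel. ?\<rho> y = 0"
      using integral_nonneg_eq_0_iff_AE[OF int] mollifier_nonneg by auto
    then have "(LINT y|lborel. ?\<rho> y * ?\<rho> y) = 0"
      by (intro integral_eq_zero_AE) auto
    then have "?\<rho> 0 = 0"
      by (rule cc_function_square_integral_zero[OF cc_function_mollifier[OF assms]])
    then show False
      using mollifier_nonzero[OF assms, of "0 :: real^'m"] assms by simp
  qed
  moreover have "(LINT y|lborel. ?\<rho> y) \<ge> 0"
    by (intro integral_nonneg_AE) (simp add: mollifier_nonneg)
  ultimately show ?thesis by linarith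
qed

lemma integral_lborel_uminus:
  fixes f :: "real^'m::finite \<Rightarrow> real"
  assumes f: "f \<in> borel_measurable borel"
  shows "(LINT x|lborel. f (a - x)) = (LINT x|lborel. f x)"
proof -
  have [measurable]: "f \<in> borel_measurable borel" by (rule f)
  have "(LINT x|lborel. f (a + (\<chi> i. if i \<in> {} then x $ i else - x $ i))) = (LINT x|lborel. f (a + x))"
    by (rule integral_lborel_reflect[of "\<lambda>x. f (a + x)" "{}"]) measurable
  also have "(\<lambda>x::real^'m. a + (\<chi> i. if i \<in> {} then x $ i else - x $ i)) = (\<lambda>x. a - x)"
    by (auto simp: vec_eq_iff)
  finally have "(LINT x|lborel. f (a - x)) = (LINT x|lborel. f (x + a))"
    by (simp add: fun_eq_iff add.commute)
  then show ?thesis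
    by (simp add: integral_lborel_shift[OF f])
qed

lemma integrable_of_power_integrable:
  fixes F :: "'a::euclidean_space \<Rightarrow> real"
  assumes [measurable]: "F \<in> borel_measurable borel"
    and p: "integrable lborel (\<lambda>x. \<bar>F x\<bar> ^ p)" "p > 0" and B: "\<And>x. norm x > B \<Longrightarrow> F x = 0"
  shows "integrable lborel F"
proof (rule Bochner_Integration.integrable_bound)
  show "integrable lborel (\<lambda>x. indicator (cball 0 B) x + \<bar>F x\<bar> ^ p)"
    using p(1) by (intro Bochner_Integration.integrable_add integrable_real_indicator)
      (use emeasure_bounded_finite[of "cball 0 B"] in auto)
  have "norm (F x) \<le> norm (indicator (cball 0 B) x + \<bar>F x\<bar> ^ p)" for x
  proof (cases "norm x > B \<or> \<bar>F x\<bar> \<le> 1")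
    case True
    then show ?thesis
      using B[of x] by (cases "norm x > B") (auto simp: add_increasing2)
  next
    case False
    then have "\<bar>F x\<bar> ^ 1 \<le> \<bar>F x\<bar> ^ p"
      using p(2) by (intro power_increasing) auto
    then show ?thesis by (auto simp: indicator_def)
  qed
  then show "AE x in lborel. norm (F x) \<le> norm (indicator (cball 0 B) x + \<bar>F x\<bar> ^ p)"
    by simp
qed simp

lemma integrable_mult_mollifier:
  fixes F :: "real^'m::finite \<Rightarrow> real"
  assumes "integrable lborel F" "\<delta> > 0"
  shows "integrable lborel (\<lambda>y. F y * mollifier \<delta> (y - z))"
proof -
  obtain C where C: "\<And>x::real^'m. \<bar>mollifier \<delta> x\<bar> \<le> C"
    using bounded_cc_function[OF cc_function_mollifier[OF assms(2)]] by blast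
  have "integrable lborel (\<lambda>y. F y *\<^sub>R mollifier \<delta> (y - z))"
    by (rule integrable_mult_bounded_continuous[OF assms(1)
          continuous_on_minus_shift(1)[OF cc_function_continuous[OF cc_function_mollifier[OF assms(2)]]], where C=C])
      (simp add: C)
  then show ?thesis by simp
qed

lemma integral_mollifier_shift:
  assumes "\<delta> > 0"
  shows "(LINT y|lborel. mollifier \<delta> (y - z :: real^'m::finite)) = (LINT y|lborel. mollifier \<delta> (y :: real^'m))"
    and "(LINT z|lborel. mollifier \<delta> (y - z :: real^'m::finite)) = (LINT y|lborel. mollifier \<delta> (y :: real^'m))"
proof -
  have m: "(mollifier \<delta> :: real^'m \<Rightarrow> real) \<in> borel_measurable borel"
    by (intro borel_measurable_continuous_onI cc_function_continuous cc_function_mollifier assms)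
  show "(LINT y|lborel. mollifier \<delta> (y - z)) = (LINT y|lborel. mollifier \<delta> (y :: real^'m))"
    using integral_lborel_shift[OF m, of "- z"] by simp
  show "(LINT z|lborel. mollifier \<delta> (y - z)) = (LINT y|lborel. mollifier \<delta> (y :: real^'m))"
    by (rule integral_lborel_uminus[OF m])
qed

text \<open>Jensen's inequality for the probability density given by the normalised kernel: the
  tangent of the power function at the mean \<open>m\<close> of \<bar>F\<bar> is integrated against
  it.\<close>

lemma mollify_power_le:
  fixes F :: "real^'m::finite \<Rightarrow> real"
  assumes F: "integrable lborel F" and Fp: "integrable lborel (\<lambda>x. \<bar>F x\<bar> ^ Suc q)" and \<delta>: "\<delta> > 0"
  shows "\<bar>mollify \<delta> F z\<bar> ^ Suc q \<le> (LINT y|lborel. \<bar>F y\<bar> ^ Suc q * mollifier \<delta> (y - z)) / (LINT y|lborel. mollifier \<delta> (y :: real^'m))"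
proof -
  define I where "I = (LINT y|lborel. mollifier \<delta> (y :: real^'m))"
  have I: "I > 0"
    unfolding I_def by (rule integral_mollifier_pos[OF \<delta>])
  let ?\<rho> = "\<lambda>y. mollifier \<delta> (y - z)"
  have int\<rho>: "integrable lborel ?\<rho>"
    using cc_function_shift[OF cc_function_mollifier[OF \<delta>], of "- z"] by (intro integrable_cc_function) simp
  have I': "(LINT y|lborel. ?\<rho> y) = I"
    unfolding I_def by (rule integral_mollifier_shift(1)[OF \<delta>])
  define m where "m = (LINT y|lborel. \<bar>F y\<bar> * ?\<rho> y) / I"
  have int1: "integrable lborel (\<lambda>y. \<bar>F y\<bar> * ?\<rho> y)"
    using F by (intro integrable_mult_mollifier \<delta> integrable_abs)
  have intp: "integrable lborel (\<lambda>y. \<bar>F y\<bar> ^ Suc q * ?\<rho> y)"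
    by (rule integrable_mult_mollifier[OF Fp \<delta>])
  have m0: "m \<ge> 0"
    unfolding m_def using I by (intro divide_nonneg_nonneg integral_nonneg_AE) (auto simp: mollifier_nonneg)
  have "\<bar>mollify \<delta> F z\<bar> \<le> m"
  proof -
    have "\<bar>LINT y|lborel. F y * ?\<rho> y\<bar> \<le> (LINT y|lborel. \<bar>F y * ?\<rho> y\<bar>)"
      using integral_norm_bound[of lborel "\<lambda>y. F y * ?\<rho> y"] by simp
    then show ?thesis
      using I by (simp add: mollify_def m_def abs_mult mollifier_nonneg divide_right_mono flip: I_def)
  qed
  then have "\<bar>mollify \<delta> F z\<bar> ^ Suc q \<le> m ^ Suc q"
    by (intro power_mono) auto
  \<comment> \<open>The linear part of the tangent has integral 0 because \<open>m\<close> is the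
    mean with respect to exactly this weight.\<close>
  also have "m ^ Suc q * I = (LINT y|lborel. (m ^ Suc q + real (Suc q) * m ^ q * (\<bar>F y\<bar> - m)) * ?\<rho> y)"
  proof -
    have "(\<lambda>y. (m ^ Suc q + real (Suc q) * m ^ q * (\<bar>F y\<bar> - m)) * ?\<rho> y)
        = (\<lambda>y. (m ^ Suc q - real (Suc q) * m ^ q * m) * ?\<rho> y + real (Suc q) * m ^ q * (\<bar>F y\<bar> * ?\<rho> y))"
      by (simp add: fun_eq_iff algebra_simps)
    moreover have "(LINT y|lborel. (m ^ Suc q - real (Suc q) * m ^ q * m) * ?\<rho> y + real (Suc q) * m ^ q * (\<bar>F y\<bar> * ?\<rho> y))
        = (m ^ Suc q - real (Suc q) * m ^ q * m) * I + real (Suc q) * m ^ q * (m * I)"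
      using int1 int\<rho> I by (simp add: I' m_def)
    ultimately show ?thesis
      by (simp add: algebra_simps)
  qed
  then have "m ^ Suc q = (LINT y|lborel. (m ^ Suc q + real (Suc q) * m ^ q * (\<bar>F y\<bar> - m)) * ?\<rho> y) / I"
    using I by (simp add: field_simps)
  also have "\<dots> \<le> (LINT y|lborel. \<bar>F y\<bar> ^ Suc q * ?\<rho> y) / I"
  proof (intro divide_right_mono integral_mono)
    have "(\<lambda>y. (m ^ Suc q + real (Suc q) * m ^ q * (\<bar>F y\<bar> - m)) * ?\<rho> y)
        = (\<lambda>y. (m ^ Suc q - real (Suc q) * m ^ q * m) * ?\<rho> y + real (Suc q) * m ^ q * (\<bar>F y\<bar> * ?\<rho> y))"
      by (simp add: fun_eq_iff algebra_simps)
    then show "integrable lborel (\<lambda>y. (m ^ Suc q + real (Suc q) * m ^ q * (\<bar>F y\<bar> - m)) * ?\<rho> y)"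
      using int1 int\<rho> by simp
    show "integrable lborel (\<lambda>y. \<bar>F y\<bar> ^ Suc q * ?\<rho> y)" by (rule intp)
    show "(m ^ Suc q + real (Suc q) * m ^ q * (\<bar>F y\<bar> - m)) * ?\<rho> y \<le> \<bar>F y\<bar> ^ Suc q * ?\<rho> y" for y
      using m0 by (intro mult_right_mono bernoulli_tangent mollifier_nonneg) auto
  qed (use I in simp)
  finally show ?thesis
    by (simp only: I_def)
qed

lemma cc_function_mollify:
  fixes F :: "real^'m::finite \<Rightarrow> real" and B \<delta> :: real
  assumes F: "integrable lborel F" and B: "\<And>x. norm x > B \<Longrightarrow> F x = 0" and \<delta>: "\<delta> > 0"
  shows "cc_function (mollify \<delta> F)"
    and "norm z > B + CARD('m) * \<delta> \<Longrightarrow> mollify \<delta> F z = 0"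
proof -
  have zero: "mollify \<delta> F z = 0" if z: "norm z > B + CARD('m) * \<delta>" for z
  proof -
    have "F y * mollifier \<delta> (y - z) = 0" for y
    proof (cases "norm y > B")
      case False
      then have "norm (y - z) > CARD('m) * \<delta>"
        using z norm_triangle_ineq3[of z y] by (simp add: norm_minus_commute)
      then show ?thesis
        by (simp add: mollifier_zero_outside[OF \<delta>])
    qed (simp add: B)
    then have "(\<lambda>y. F y * mollifier \<delta> (y - z)) = (\<lambda>y. 0)"
      by blast
    then show ?thesis
      by (simp only: mollify_def) simp
  qed
  then show "norm z > B + CARD('m) * \<delta> \<Longrightarrow> mollify \<delta> F z = 0" .
  have "C1_gradient (mollifier \<delta> :: real^'m \<Rightarrow> real) (\<lambda>x. \<chi> j. coord_prod ((\<lambda>i x. bump (1 / \<delta> * x + 0))(j := deriv (\<lambda>x. bump (1 / \<delta> * x + 0)))) x)"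
    unfolding mollifier_def by (rule C1_gradient_coord_prod[OF Ck_real_bump_scaled])
  from C1_gradient_continuous[OF C1_gradient_correlation[OF F this cc_function_mollifier[OF \<delta>]]]
  have "continuous_on UNIV (\<lambda>z. LINT y|lborel. F y * mollifier \<delta> (y - z))" .
  then have "continuous_on UNIV (mollify \<delta> F)"
    unfolding mollify_def[abs_def] using integral_mollifier_pos[OF \<delta>, where 'm='m]
    by (intro continuous_on_divide continuous_on_const) auto
  then show "cc_function (mollify \<delta> F)"
    using zero unfolding cc_function_def by blast
qed

lemma cc_function_abs_power: "cc_function f \<Longrightarrow> cc_function (\<lambda>x. \<bar>f x\<bar> ^ Suc q)"
  unfolding cc_function_def
  by (auto intro!: continuous_on_mult continuous_on_power continuous_on_rabs)

text \<open>Young's inequality for the mollifier: the pointwise Jensen bound is integrated in z, and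
  after exchanging the integrals the kernel integrates to the same constant in z as in y.
  Nonnegative integrals make the exchange free of integrability conditions.\<close>

lemma mollify_Lp_le:
  fixes F :: "real^'m::finite \<Rightarrow> real"
  assumes F [measurable]: "F \<in> borel_measurable borel" and Fp: "integrable lborel (\<lambda>x. \<bar>F x\<bar> ^ Suc q)"
    and B: "\<And>x. norm x > B \<Longrightarrow> F x = 0" and \<delta>: "\<delta> > 0"
  shows "(LINT x|lborel. \<bar>mollify \<delta> F x\<bar> ^ Suc q) \<le> (LINT x|lborel. \<bar>F x\<bar> ^ Suc q)"
proof -
  have Fint: "integrable lborel F"
    by (rule integrable_of_power_integrable[OF F Fp _ B]) simp
  define I where "I = (LINT y|lborel. mollifier \<delta> (y :: real^'m))"
  have I: "I > 0"
    unfolding I_def by (rule integral_mollifier_pos[OF \<delta>])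
  have \<rho>meas [measurable]: "(mollifier \<delta> :: real^'m \<Rightarrow> real) \<in> borel_measurable borel"
    by (intro borel_measurable_continuous_onI cc_function_continuous cc_function_mollifier \<delta>)
  have intp: "integrable lborel (\<lambda>y. \<bar>F y\<bar> ^ Suc q * mollifier \<delta> (y - z))" for z
    by (rule integrable_mult_mollifier[OF Fp \<delta>])
  have "ennreal (LINT x|lborel. \<bar>mollify \<delta> F x\<bar> ^ Suc q) = (\<integral>\<^sup>+x. ennreal (\<bar>mollify \<delta> F x\<bar> ^ Suc q) \<partial>lborel)"
    by (intro nn_integral_eq_integral[symmetric] integrable_cc_function cc_function_abs_power
        cc_function_mollify(1)[OF Fint B \<delta>]) auto
  also have "\<dots> \<le> (\<integral>\<^sup>+z. (\<integral>\<^sup>+y. ennreal (\<bar>F y\<bar> ^ Suc q * mollifier \<delta> (y - z) / I) \<partial>lborel) \<partial>lborel)"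
  proof (rule nn_integral_mono)
    fix z
    have "ennreal (\<bar>mollify \<delta> F z\<bar> ^ Suc q) \<le> ennreal (LINT y|lborel. \<bar>F y\<bar> ^ Suc q * mollifier \<delta> (y - z) / I)"
      using mollify_power_le[OF Fint Fp \<delta>, of z] by (intro ennreal_leI) (simp add: I_def)
    also have "\<dots> = (\<integral>\<^sup>+y. ennreal (\<bar>F y\<bar> ^ Suc q * mollifier \<delta> (y - z) / I) \<partial>lborel)"
      using intp[of z] I by (intro nn_integral_eq_integral[symmetric] integrable_divide_zero) (auto simp: mollifier_nonneg)
    finally show "ennreal (\<bar>mollify \<delta> F z\<bar> ^ Suc q) \<le> (\<integral>\<^sup>+y. ennreal (\<bar>F y\<bar> ^ Suc q * mollifier \<delta> (y - z) / I) \<partial>lborel)" .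
  qed
  also have "\<dots> = (\<integral>\<^sup>+y. (\<integral>\<^sup>+z. ennreal (\<bar>F y\<bar> ^ Suc q * mollifier \<delta> (y - z) / I) \<partial>lborel) \<partial>lborel)"
  proof -
    have "(\<lambda>p. ennreal (\<bar>F (fst p)\<bar> ^ Suc q * mollifier \<delta> (fst p - snd p) / I)) \<in> borel_measurable (lborel \<Otimes>\<^sub>M lborel)"
      by measurable
    then show ?thesis
      using lborel_pair.Fubini'[of "\<lambda>y z. ennreal (\<bar>F y\<bar> ^ Suc q * mollifier \<delta> (y - z) / I)"]
      by (simp add: case_prod_unfold)
  qed
  also have "\<dots> = (\<integral>\<^sup>+y. ennreal (\<bar>F y\<bar> ^ Suc q) \<partial>lborel)"
  proof (rule nn_integral_cong)
    fix y :: "real^'m"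
    have int: "integrable lborel (\<lambda>z. mollifier \<delta> (y - z))"
    proof -
      have "cc_function (\<lambda>z. mollifier \<delta> (y - z))"
        unfolding cc_function_def
      proof (intro conjI exI[of _ "norm y + CARD('m) * \<delta>"] allI impI)
        show "continuous_on UNIV (\<lambda>z. mollifier \<delta> (y - z))"
          by (rule continuous_on_minus_shift(2)[OF cc_function_continuous[OF cc_function_mollifier[OF \<delta>]]])
        show "mollifier \<delta> (y - z) = 0" if "norm z > norm y + CARD('m) * \<delta>" for z
          using that norm_triangle_ineq3[of z y]
          by (intro mollifier_zero_outside[OF \<delta>]) (simp add: norm_minus_commute)
      qed
      then show ?thesis by (rule integrable_cc_function)
    qed
    have "(\<integral>\<^sup>+z. ennreal (\<bar>F y\<bar> ^ Suc q * mollifier \<delta> (y - z) / I) \<partial>lborel)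
        = ennreal (LINT z|lborel. \<bar>F y\<bar> ^ Suc q * mollifier \<delta> (y - z) / I)"
      using int I by (intro nn_integral_eq_integral) (auto simp: mollifier_nonneg)
    also have "(LINT z|lborel. \<bar>F y\<bar> ^ Suc q * mollifier \<delta> (y - z) / I) = \<bar>F y\<bar> ^ Suc q"
      using I integral_mollifier_shift(2)[OF \<delta>, of y] by (simp add: I_def)
    finally show "(\<integral>\<^sup>+z. ennreal (\<bar>F y\<bar> ^ Suc q * mollifier \<delta> (y - z) / I) \<partial>lborel) = ennreal (\<bar>F y\<bar> ^ Suc q)" .
  qed
  also have "\<dots> = ennreal (LINT y|lborel. \<bar>F y\<bar> ^ Suc q)"
    using Fp by (intro nn_integral_eq_integral) auto
  finally show ?thesis
    by (subst (asm) ennreal_le_iff) (auto intro!: integral_nonneg_AE)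
qed

lemma mollify_cc_function_tendsto:
  fixes g :: "real^'m::finite \<Rightarrow> real"
  assumes g: "cc_function g" and e: "e > 0"
  shows "\<exists>d>0. \<forall>\<delta>. 0 < \<delta> \<and> \<delta> < d \<longrightarrow> (LINT x|lborel. \<bar>mollify \<delta> g x - g x\<bar> ^ Suc q) < e"
proof -
  obtain B where B: "\<And>x. norm x > B \<Longrightarrow> g x = 0"
    using g unfolding cc_function_def by blast
  define B' where "B' = \<bar>B\<bar> + CARD('m)"
  define M where "M = measure lborel (cball (0 :: real^'m) B') + 1"
  have M: "M > 0" unfolding M_def by (simp add: add_nonneg_pos)
  define s where "s = min 1 (e / (2 * M))"
  have s: "0 < s" "s \<le> 1"
    using e M by (auto simp: s_def)
  have "s ^ Suc q * M < e"
  proof -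
    have "s ^ Suc q \<le> s"
      using power_decreasing[of 1 "Suc q" s] s by simp
    then have "s ^ Suc q * M \<le> s * M"
      using M by (intro mult_right_mono) auto
    also have "\<dots> \<le> e / (2 * M) * M"
      using M by (intro mult_right_mono) (auto simp: s_def)
    also have "\<dots> < e"
      using M e by simp
    finally show ?thesis .
  qed
  have "uniformly_continuous_on UNIV g"
    by (intro uniformly_continuous_on_UNIV_bounded_support[OF cc_function_continuous[OF g] B])
  then obtain d0 where d0: "d0 > 0" "\<And>x y. dist y x < d0 \<Longrightarrow> dist (g y) (g x) < s"
    using s(1) unfolding uniformly_continuous_on_def by (metis UNIV_I)
  define d where "d = min 1 (d0 / CARD('m))"
  have d: "d > 0"
    using d0 by (simp add: d_def)
  have "(LINT x|lborel. \<bar>mollify \<delta> g x - g x\<bar> ^ Suc q) < e" if \<delta>: "0 < \<delta>" "\<delta> < d" for \<delta>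
  proof -
    define I where "I = (LINT y|lborel. mollifier \<delta> (y :: real^'m))"
    have I: "I > 0"
      unfolding I_def by (rule integral_mollifier_pos[OF \<delta>(1)])
    have gint: "integrable lborel g"
      by (rule integrable_cc_function[OF g])
    have card\<delta>: "CARD('m) * \<delta> < d0" "CARD('m) * \<delta> \<le> CARD('m)"
      using \<delta> by (auto simp: d_def field_simps mult_left_le)
    have ccm: "cc_function (mollify \<delta> g)"
      by (rule cc_function_mollify(1)[OF gint B \<delta>(1)])
    have close: "\<bar>mollify \<delta> g x - g x\<bar> \<le> s" for x
    proof -
      have int\<rho>: "integrable lborel (\<lambda>y. mollifier \<delta> (y - x))"
        using cc_function_shift[OF cc_function_mollifier[OF \<delta>(1)], of "- x"] by (intro integrable_cc_function) simp
      have int1: "integrable lborel (\<lambda>y. g y * mollifier \<delta> (y - x))"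
        by (rule integrable_mult_mollifier[OF gint \<delta>(1)])
      have I': "(LINT y|lborel. mollifier \<delta> (y - x)) = I"
        unfolding I_def by (rule integral_mollifier_shift(1)[OF \<delta>(1)])
      have "mollify \<delta> g x - g x = (LINT y|lborel. (g y - g x) * mollifier \<delta> (y - x)) / I"
        using I int1 int\<rho> by (simp add: mollify_def left_diff_distrib diff_divide_distrib I' flip: I_def)
      also have "\<bar>\<dots>\<bar> \<le> (LINT y|lborel. s * mollifier \<delta> (y - x)) / I"
      proof -
        have "norm (LINT y|lborel. (g y - g x) * mollifier \<delta> (y - x)) \<le> (LINT y|lborel. s * mollifier \<delta> (y - x))"
        proof (rule order_trans[OF integral_norm_bound integral_mono])
          have "integrable lborel (\<lambda>y. (g y - g x) * mollifier \<delta> (y - x))"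
            using int1 int\<rho> by (simp add: left_diff_distrib)
          then show "integrable lborel (\<lambda>y. norm ((g y - g x) * mollifier \<delta> (y - x)))"
            by (rule integrable_norm)
          show "integrable lborel (\<lambda>y. s * mollifier \<delta> (y - x))"
            using int\<rho> by simp
          fix y
          show "norm ((g y - g x) * mollifier \<delta> (y - x)) \<le> s * mollifier \<delta> (y - x)"
          proof (cases "norm (y - x) < d0")
            case True
            then have "\<bar>g y - g x\<bar> \<le> s"
              using d0(2)[of y x] by (simp add: dist_norm)
            then show ?thesis
              by (simp add: abs_mult mollifier_nonneg mult_right_mono)
          next
            case False
            then have "mollifier \<delta> (y - x) = 0"
              using card\<delta> by (intro mollifier_zero_outside[OF \<delta>(1)]) auto
            then show ?thesis by simp
          qed
        qed
        then show ?thesis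
          using I by (simp add: divide_right_mono)
      qed
      also have "\<dots> = s"
        using I by (simp add: I')
      finally show ?thesis .
    qed
    have zero: "mollify \<delta> g x - g x = 0" if "norm x > B'" for x
    proof -
      have "norm x > B + CARD('m) * \<delta>" "norm x > B"
        using that card\<delta>(2) \<delta>(1) abs_ge_self[of B] unfolding B'_def by linarith+
      then show ?thesis
        using cc_function_mollify(2)[OF gint B \<delta>(1)] B by simp
    qed
    have "(LINT x|lborel. \<bar>mollify \<delta> g x - g x\<bar> ^ Suc q) \<le> (LINT x|lborel. indicator (cball (0 :: real^'m) B') x * s ^ Suc q)"
    proof (rule integral_mono)
      show "integrable lborel (\<lambda>x. \<bar>mollify \<delta> g x - g x\<bar> ^ Suc q)"
        by (intro integrable_cc_function cc_function_abs_power cc_function_diff ccm g)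
      show "integrable lborel (\<lambda>x. indicator (cball (0 :: real^'m) B') x * s ^ Suc q)"
        by (intro integrable_mult_left integrable_real_indicator) (use emeasure_bounded_finite[of "cball 0 B'"] in auto)
      fix x
      show "\<bar>mollify \<delta> g x - g x\<bar> ^ Suc q \<le> indicator (cball 0 B') x * s ^ Suc q"
      proof (cases "norm x > B'")
        case False
        have "\<bar>mollify \<delta> g x - g x\<bar> ^ Suc q \<le> s ^ Suc q"
          by (intro power_mono close) auto
        then show ?thesis using False by simp
      qed (use zero[of x] in simp)
    qed
    also have "\<dots> = measure lborel (cball (0 :: real^'m) B') * s ^ Suc q"
      by simp
    also have "\<dots> \<le> s ^ Suc q * M"
      using s by (simp add: M_def mult.commute distrib_right)
    finally show ?thesis
      using \<open>s ^ Suc q * M < e\<close> by linarith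
  qed
  then show ?thesis
    using d by blast
qed

section \<open>Density of continuous functions and strong convergence\<close>

lemma measurable_ae_limit_of_continuous:
  fixes F :: "'a::euclidean_space \<Rightarrow> real"
  assumes "F \<in> borel_measurable borel"
  shows "\<exists>h. (\<forall>n. continuous_on UNIV (h n)) \<and> (AE x in lborel. (\<lambda>n. h n x) \<longlonglongrightarrow> F x)"
proof -
  have "F \<in> borel_measurable lebesgue"
    using assms by (auto intro: measurable_completion)
  then have "F measurable_on UNIV"
    by (rule lebesgue_measurable_imp_measurable_on) simp
  then obtain N h where N: "negligible N" "\<And>n. continuous_on UNIV (h n)" "\<And>x. x \<notin> N \<Longrightarrow> (\<lambda>n. h n x) \<longlonglongrightarrow> F x"
    unfolding measurable_on_def by auto
  have "AE x in lebesgue. x \<notin> N"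
    using N(1) by (intro AE_not_in) (simp add: negligible_iff_null_sets)
  then have "AE x in lborel. x \<notin> N"
    by (simp add: AE_completion_iff)
  then show ?thesis
    using N(2,3) by (intro exI[of _ h]) auto
qed

text \<open>Two successive approximations: F is truncated at a high level K, and the truncation is
  an almost everywhere limit of continuous functions, which are clipped at the same level and cut
  off. Clipping and cutoff provide the common bound for dominated convergence. Each step may use
  half of e, and the factor \<open>2 ^ Suc q\<close> comes from
  \<open>abs_add_power_le\<close>.\<close>

lemma cc_function_dense_Lp:
  fixes F :: "'a::euclidean_space \<Rightarrow> real"
  assumes F [measurable]: "F \<in> borel_measurable borel" and Fp: "integrable lborel (\<lambda>x. \<bar>F x\<bar> ^ Suc q)"
    and B: "\<And>x. norm x > B \<Longrightarrow> F x = 0" and e: "e > 0"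
  shows "\<exists>g. cc_function g \<and> (LINT x|lborel. \<bar>F x - g x\<bar> ^ Suc q) < e"
proof -
  define clip where "clip K y = max (- K) (min K y)" for K y :: real
  have clip_le: "\<bar>clip K y\<bar> \<le> K" if "K \<ge> 0" for K y
    using that by (auto simp: clip_def)
  have clip_abs: "\<bar>y - clip K y\<bar> \<le> \<bar>y\<bar>" if "K \<ge> 0" for K y
    using that by (auto simp: clip_def)
  have clip0: "clip K 0 = 0" if "K \<ge> 0" for K
    using that by (auto simp: clip_def)
  have clip_cont: "continuous_on UNIV (clip K)" for K
    unfolding clip_def[abs_def] by (intro continuous_intros)
  have [measurable]: "clip K \<in> borel_measurable borel" for K
    by (rule borel_measurable_continuous_onI[OF clip_cont])
  have "(\<lambda>n. LINT x|lborel. \<bar>F x - clip (real n) (F x)\<bar> ^ Suc q) \<longlonglongrightarrow> (LINT x|(lborel::'a measure). 0)"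
  proof (rule integral_dominated_convergence[where w="\<lambda>x. \<bar>F x\<bar> ^ Suc q"])
    show "AE x in lborel. (\<lambda>n. \<bar>F x - clip (real n) (F x)\<bar> ^ Suc q) \<longlonglongrightarrow> 0"
    proof (rule AE_I2, rule tendsto_eventually)
      fix x
      obtain m :: nat where "\<bar>F x\<bar> \<le> real m"
        using real_arch_simple by blast
      then have "\<bar>F x - clip (real n) (F x)\<bar> ^ Suc q = 0" if "n \<ge> m" for n
        using that by (auto simp: clip_def)
      then show "\<forall>\<^sub>F n in sequentially. \<bar>F x - clip (real n) (F x)\<bar> ^ Suc q = 0"
        by (auto simp: eventually_sequentially)
    qed
    show "AE x in lborel. norm (\<bar>F x - clip (real n) (F x)\<bar> ^ Suc q) \<le> \<bar>F x\<bar> ^ Suc q" for n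
      using clip_abs[of "real n"] by (intro AE_I2) (simp add: power_mono del: power_Suc)
  qed (use Fp in simp_all)
  then have "\<forall>\<^sub>F n in sequentially. (LINT x|lborel. \<bar>F x - clip (real n) (F x)\<bar> ^ Suc q) < e / (2 * 2 ^ Suc q)"
    using e by (intro order_tendstoD(2)) auto
  then obtain n where n: "(LINT x|lborel. \<bar>F x - clip (real n) (F x)\<bar> ^ Suc q) < e / (2 * 2 ^ Suc q)"
    by (auto simp: eventually_sequentially)
  define K where "K = real n"
  have K: "K \<ge> 0" by (simp add: K_def)
  define f where "f x = clip K (F x)" for x
  have f [measurable]: "f \<in> borel_measurable borel"
    unfolding f_def[abs_def] by measurable
  obtain h where h: "\<And>j. continuous_on UNIV (h j)" "AE x in lborel. (\<lambda>j. h j x) \<longlonglongrightarrow> f x"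
    using measurable_ae_limit_of_continuous[OF f] by auto
  \<comment> \<open>A continuous cutoff equal to 1 on the ball of radius B, outside which F
    vanishes, so multiplication by it leaves the truncated function unchanged while making the
    approximants compactly supported.\<close>
  define \<xi> where "\<xi> x = max 0 (min 1 (\<bar>B\<bar> + 1 - norm x))" for x :: 'a
  define g where "g j x = \<xi> x * clip K (h j x)" for j x
  have \<xi>: "0 \<le> \<xi> x" "\<xi> x \<le> 1" "norm x > \<bar>B\<bar> + 1 \<Longrightarrow> \<xi> x = 0" "norm x \<le> B \<Longrightarrow> \<xi> x = 1" for x
    by (auto simp: \<xi>_def)
  have cont_\<xi>: "continuous_on UNIV \<xi>"
    unfolding \<xi>_def[abs_def] by (intro continuous_intros)
  have ccg: "cc_function (g j)" for j
  proof -
    have "continuous_on UNIV (\<lambda>x. clip K (h j x))"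
      by (rule continuous_on_compose2[OF clip_cont h(1)]) auto
    then have "continuous_on UNIV (g j)"
      unfolding g_def[abs_def] by (intro continuous_on_mult cont_\<xi>)
    moreover have "g j x = 0" if "norm x > \<bar>B\<bar> + 1" for x
      using \<xi>(3)[OF that] by (simp add: g_def)
    ultimately show ?thesis
      unfolding cc_function_def by blast
  qed
  have g_meas [measurable]: "g j \<in> borel_measurable borel" for j
    by (intro borel_measurable_continuous_onI cc_function_continuous ccg)
  have f\<xi>: "f x = \<xi> x * f x" for x
    using \<xi>(4)[of x] B[of x] clip0[OF K] by (cases "norm x \<le> B") (auto simp: f_def)
  have bound: "\<bar>f x - g j x\<bar> \<le> 2 * K * indicator (cball 0 (\<bar>B\<bar> + 1)) x" for x j
  proof (cases "norm x > \<bar>B\<bar> + 1")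
    case True
    then show ?thesis
      using \<xi>(3)[of x] B[of x] clip0[OF K] by (auto simp: g_def f_def)
  next
    case False
    have "\<bar>g j x\<bar> \<le> 1 * K"
      unfolding g_def abs_mult using \<xi>(1,2)[of x] K by (intro mult_mono clip_le) auto
    moreover have "\<bar>f x\<bar> \<le> K"
      unfolding f_def by (rule clip_le[OF K])
    ultimately show ?thesis
      using False by simp
  qed
  have indint: "integrable lborel (\<lambda>x. (2 * K) ^ Suc q * indicator (cball 0 (\<bar>B\<bar> + 1)) (x::'a) :: real)"
    by (intro integrable_mult_right integrable_real_indicator) (use emeasure_bounded_finite[of "cball 0 (\<bar>B\<bar> + 1)"] in auto)
  have bound': "\<bar>f x - g j x\<bar> ^ Suc q \<le> (2 * K) ^ Suc q * indicator (cball 0 (\<bar>B\<bar> + 1)) x" for x j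
    using power_mono[OF bound[of x j], of "Suc q"] by (cases "x \<in> cball 0 (\<bar>B\<bar> + 1)") auto
  have fgint: "integrable lborel (\<lambda>x. \<bar>f x - g j x\<bar> ^ Suc q)" for j
  proof (rule Bochner_Integration.integrable_bound[OF indint])
    have n: "\<bar>\<bar>y\<bar> ^ k\<bar> = \<bar>y\<bar> ^ k" for y :: real and k
      by simp
    show "AE x in lborel. norm (\<bar>f x - g j x\<bar> ^ Suc q) \<le> norm ((2 * K) ^ Suc q * indicator (cball 0 (\<bar>B\<bar> + 1)) x :: real)"
      unfolding real_norm_def n by (intro AE_I2 order_trans[OF bound' abs_ge_self])
  qed measurable
  have "(\<lambda>j. LINT x|lborel. \<bar>f x - g j x\<bar> ^ Suc q) \<longlonglongrightarrow> (LINT x|(lborel::'a measure). 0)"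
  proof (rule integral_dominated_convergence[OF _ _ indint])
    show "AE x in lborel. (\<lambda>j. \<bar>f x - g j x\<bar> ^ Suc q) \<longlonglongrightarrow> 0"
      using h(2)
    proof eventually_elim
      case (elim x)
      have "(\<lambda>j. clip K (h j x)) \<longlonglongrightarrow> clip K (f x)"
        using elim continuous_on_tendsto_compose[OF clip_cont[of K]] by auto
      moreover have "clip K (f x) = f x"
        using K by (auto simp: f_def clip_def)
      ultimately have "(\<lambda>j. \<bar>f x - g j x\<bar> ^ Suc q) \<longlonglongrightarrow> \<bar>f x - \<xi> x * f x\<bar> ^ Suc q"
        unfolding g_def by (auto intro!: tendsto_intros simp del: power_Suc)
      then show ?case
        using f\<xi>[of x] by simp
    qed
    show "AE x in lborel. norm (\<bar>f x - g j x\<bar> ^ Suc q) \<le> (2 * K) ^ Suc q * indicator (cball 0 (\<bar>B\<bar> + 1)) x" for j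
      using bound' by (auto simp del: power_Suc)
  qed simp_all
  then have "\<forall>\<^sub>F j in sequentially. (LINT x|lborel. \<bar>f x - g j x\<bar> ^ Suc q) < e / (2 * 2 ^ Suc q)"
    using e by (intro order_tendstoD(2)) auto
  then obtain j where j: "(LINT x|lborel. \<bar>f x - g j x\<bar> ^ Suc q) < e / (2 * 2 ^ Suc q)"
    by (auto simp: eventually_sequentially)
  have Ffint: "integrable lborel (\<lambda>x. \<bar>F x - f x\<bar> ^ Suc q)"
  proof (rule Bochner_Integration.integrable_bound[OF Fp])
    show "AE x in lborel. norm (\<bar>F x - f x\<bar> ^ Suc q) \<le> norm (\<bar>F x\<bar> ^ Suc q)"
      using clip_abs[OF K] by (intro AE_I2) (simp add: f_def power_mono del: power_Suc)
  qed simp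
  have "(LINT x|lborel. \<bar>F x - g j x\<bar> ^ Suc q) \<le> (LINT x|lborel. 2 ^ Suc q * (\<bar>F x - f x\<bar> ^ Suc q + \<bar>f x - g j x\<bar> ^ Suc q))"
  proof (rule integral_mono_AE')
    show "integrable lborel (\<lambda>x. 2 ^ Suc q * (\<bar>F x - f x\<bar> ^ Suc q + \<bar>f x - g j x\<bar> ^ Suc q))"
      by (intro integrable_mult_right Bochner_Integration.integrable_add Ffint fgint)
    show "AE x in lborel. \<bar>F x - g j x\<bar> ^ Suc q \<le> 2 ^ Suc q * (\<bar>F x - f x\<bar> ^ Suc q + \<bar>f x - g j x\<bar> ^ Suc q)"
    proof (rule AE_I2)
      fix x
      show "\<bar>F x - g j x\<bar> ^ Suc q \<le> 2 ^ Suc q * (\<bar>F x - f x\<bar> ^ Suc q + \<bar>f x - g j x\<bar> ^ Suc q)"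
        using abs_add_power_le[of "F x - f x" "f x - g j x" "Suc q"] by (simp del: power_Suc)
    qed
  qed (auto intro!: AE_I2)
  also have "\<dots> = 2 ^ Suc q * ((LINT x|lborel. \<bar>F x - f x\<bar> ^ Suc q) + (LINT x|lborel. \<bar>f x - g j x\<bar> ^ Suc q))"
    using Bochner_Integration.integral_add[OF Ffint fgint] by (simp del: power_Suc)
  also have "\<dots> < 2 ^ Suc q * (e / (2 * 2 ^ Suc q) + e / (2 * 2 ^ Suc q))"
    using n j by (intro mult_strict_left_mono add_strict_mono) (auto simp: f_def K_def simp del: power_Suc)
  also have "\<dots> = e"
    by simp
  finally show ?thesis
    using ccg by blast
qed

lemma mollify_diff:
  fixes F :: "real^'m::finite \<Rightarrow> real"
  assumes "integrable lborel F" "integrable lborel G" "\<delta> > 0"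
  shows "mollify \<delta> (\<lambda>x. F x - G x) z = mollify \<delta> F z - mollify \<delta> G z"
  using integrable_mult_mollifier[OF assms(1,3), of z] integrable_mult_mollifier[OF assms(2,3), of z]
  by (simp add: mollify_def left_diff_distrib diff_divide_distrib)

text \<open>Density combined with contraction: for g continuous and close to F, the error splits
  into the mollification of F - g, the mollification error of g and g - F. The first is no larger
  than the third by \<open>mollify_Lp_le\<close>, and the second is small by uniform
  continuity.\<close>

lemma mollify_tendsto_Lp:
  fixes F :: "real^'m::finite \<Rightarrow> real"
  assumes F [measurable]: "F \<in> borel_measurable borel" and Fp: "integrable lborel (\<lambda>x. \<bar>F x\<bar> ^ Suc q)"
    and B: "\<And>x. norm x > B \<Longrightarrow> F x = 0" and e: "e > 0"
  shows "\<exists>d>0. \<forall>\<delta>. 0 < \<delta> \<and> \<delta> < d \<longrightarrow>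
    integrable lborel (\<lambda>x. \<bar>mollify \<delta> F x - F x\<bar> ^ Suc q) \<and> (LINT x|lborel. \<bar>mollify \<delta> F x - F x\<bar> ^ Suc q) < e"
proof -
  \<comment> \<open>Three summands, separated by two applications of
    \<open>abs_add_power_le\<close>, each of which costs a factor \<open>2 ^ Suc q\<close>.\<close>
  define s where "s = e / (3 * (2 ^ Suc q * 2 ^ Suc q))"
  have s: "s > 0" using e by (simp add: s_def)
  obtain g where g: "cc_function g" "(LINT x|lborel. \<bar>F x - g x\<bar> ^ Suc q) < s"
    using cc_function_dense_Lp[OF F Fp B s] by blast
  obtain d where d: "d > 0" "\<And>\<delta>. 0 < \<delta> \<Longrightarrow> \<delta> < d \<Longrightarrow> (LINT x|lborel. \<bar>mollify \<delta> g x - g x\<bar> ^ Suc q) < s"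
    using mollify_cc_function_tendsto[OF g(1) s] by blast
  obtain Bg where Bg: "\<And>x. norm x > Bg \<Longrightarrow> g x = 0"
    using g(1) unfolding cc_function_def by blast
  have gm [measurable]: "g \<in> borel_measurable borel"
    by (intro borel_measurable_continuous_onI cc_function_continuous g)
  have gint: "integrable lborel g"
    by (rule integrable_cc_function[OF g(1)])
  have Fint: "integrable lborel F"
    by (rule integrable_of_power_integrable[OF F Fp _ B]) simp
  have Fgint: "integrable lborel (\<lambda>x. \<bar>F x - g x\<bar> ^ Suc q)"
  proof (rule Bochner_Integration.integrable_bound)
    show "integrable lborel (\<lambda>x. 2 ^ Suc q * (\<bar>F x\<bar> ^ Suc q + \<bar>g x\<bar> ^ Suc q))"
      by (intro integrable_mult_right Bochner_Integration.integrable_add Fp integrable_cc_function cc_function_abs_power g)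
    show "AE x in lborel. norm (\<bar>F x - g x\<bar> ^ Suc q) \<le> norm (2 ^ Suc q * (\<bar>F x\<bar> ^ Suc q + \<bar>g x\<bar> ^ Suc q))"
      using abs_add_power_le[of "F _" "- g _" "Suc q"] by (intro AE_I2) (simp del: power_Suc)
  qed simp
  have Fg0: "F x - g x = 0" if "norm x > max B Bg" for x
    using that B Bg by simp
  have "integrable lborel (\<lambda>x. \<bar>mollify \<delta> F x - F x\<bar> ^ Suc q) \<and> (LINT x|lborel. \<bar>mollify \<delta> F x - F x\<bar> ^ Suc q) < e"
    if \<delta>: "0 < \<delta>" "\<delta> < d" for \<delta>
  proof -
    define a where "a x = mollify \<delta> (\<lambda>x. F x - g x) x" for x
    define b where "b x = mollify \<delta> g x - g x" for x
    define c where "c x = g x - F x" for x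
    have cca: "cc_function a"
      unfolding a_def[abs_def]
      by (rule cc_function_mollify(1)[where B="max B Bg"])
        (use Fint gint Fg0 \<delta> in auto)
    have ccb: "cc_function b"
    proof -
      have "cc_function (mollify \<delta> g)"
        by (rule cc_function_mollify(1)[where B=Bg]) (use gint Bg \<delta> in auto)
      then show ?thesis
        unfolding b_def[abs_def] using g(1) by (rule cc_function_diff)
    qed
    have am [measurable]: "a \<in> borel_measurable borel" "b \<in> borel_measurable borel"
      by (intro borel_measurable_continuous_onI cc_function_continuous cca ccb)+
    have ia: "integrable lborel (\<lambda>x. \<bar>a x\<bar> ^ Suc q)" and ib: "integrable lborel (\<lambda>x. \<bar>b x\<bar> ^ Suc q)"
      by (intro integrable_cc_function cc_function_abs_power cca ccb)+
    have ic: "integrable lborel (\<lambda>x. \<bar>c x\<bar> ^ Suc q)"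
      using Fgint by (simp add: c_def abs_minus_commute)
    have sum: "mollify \<delta> F x - F x = a x + (b x + c x)" for x
      by (simp add: a_def b_def c_def mollify_diff[OF Fint gint \<delta>(1)])
    have cm [measurable]: "c \<in> borel_measurable borel"
      unfolding c_def[abs_def] by measurable
    let ?H = "\<lambda>x. 2 ^ Suc q * (\<bar>a x\<bar> ^ Suc q + 2 ^ Suc q * (\<bar>b x\<bar> ^ Suc q + \<bar>c x\<bar> ^ Suc q))"
    have iH: "integrable lborel ?H"
      by (intro integrable_mult_right Bochner_Integration.integrable_add ia ib ic)
    have le: "\<bar>mollify \<delta> F x - F x\<bar> ^ Suc q \<le> ?H x" for x
      unfolding sum
      by (intro order_trans[OF abs_add_power_le] mult_left_mono add_left_mono abs_add_power_le) simp
    have int: "integrable lborel (\<lambda>x. \<bar>mollify \<delta> F x - F x\<bar> ^ Suc q)"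
    proof (rule Bochner_Integration.integrable_bound[OF iH])
      show "(\<lambda>x. \<bar>mollify \<delta> F x - F x\<bar> ^ Suc q) \<in> borel_measurable lborel"
        unfolding sum by measurable
      show "AE x in lborel. norm (\<bar>mollify \<delta> F x - F x\<bar> ^ Suc q) \<le> norm (?H x)"
        using le by (intro AE_I2) (metis abs_ge_self abs_ge_zero norm_power order_trans power_abs real_norm_def abs_abs)
    qed
    have a_lt: "(LINT x|lborel. \<bar>a x\<bar> ^ Suc q) < s"
    proof -
      have "(LINT x|lborel. \<bar>a x\<bar> ^ Suc q) \<le> (LINT x|lborel. \<bar>F x - g x\<bar> ^ Suc q)"
        unfolding a_def by (rule mollify_Lp_le[where B="max B Bg"]) (use Fgint Fg0 \<delta> in \<open>auto simp del: power_Suc\<close>)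
      then show ?thesis using g(2) by linarith
    qed
    have b_lt: "(LINT x|lborel. \<bar>b x\<bar> ^ Suc q) < s"
      using d(2)[OF \<delta>] by (simp only: b_def)
    have c_lt: "(LINT x|lborel. \<bar>c x\<bar> ^ Suc q) < s"
      using g(2) by (simp only: c_def abs_minus_commute[of "g _" "F _"])
    have "(LINT x|lborel. \<bar>mollify \<delta> F x - F x\<bar> ^ Suc q) \<le> (LINT x|lborel. ?H x)"
      by (intro integral_mono int iH le)
    also have "\<dots> = 2 ^ Suc q * ((LINT x|lborel. \<bar>a x\<bar> ^ Suc q) + 2 ^ Suc q * ((LINT x|lborel. \<bar>b x\<bar> ^ Suc q) + (LINT x|lborel. \<bar>c x\<bar> ^ Suc q)))"
      using ia ib ic by (simp del: power_Suc)
    also have "\<dots> \<le> 2 ^ Suc q * (2 ^ Suc q * (LINT x|lborel. \<bar>a x\<bar> ^ Suc q) + 2 ^ Suc q * ((LINT x|lborel. \<bar>b x\<bar> ^ Suc q) + (LINT x|lborel. \<bar>c x\<bar> ^ Suc q)))"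
    proof (intro mult_left_mono add_right_mono)
      have "1 * (LINT x|lborel. \<bar>a x\<bar> ^ Suc q) \<le> 2 ^ Suc q * (LINT x|lborel. \<bar>a x\<bar> ^ Suc q)"
        by (intro mult_right_mono one_le_power integral_nonneg_AE) auto
      then show "(LINT x|lborel. \<bar>a x\<bar> ^ Suc q) \<le> 2 ^ Suc q * (LINT x|lborel. \<bar>a x\<bar> ^ Suc q)"
        by simp
    qed simp
    also have "\<dots> = (2 ^ Suc q * 2 ^ Suc q) * ((LINT x|lborel. \<bar>a x\<bar> ^ Suc q) + (LINT x|lborel. \<bar>b x\<bar> ^ Suc q) + (LINT x|lborel. \<bar>c x\<bar> ^ Suc q))"
      by (simp add: algebra_simps del: power_Suc)
    also have "\<dots> < (2 ^ Suc q * 2 ^ Suc q) * (s + s + s)"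
      using a_lt b_lt c_lt by (intro mult_strict_left_mono add_strict_mono) auto
    also have "\<dots> = e"
      by (simp add: s_def)
    finally show ?thesis
      using int by blast
  qed
  then show ?thesis
    using d(1) by blast
qed

text \<open>Continuity of composition from L^p to L^1 under growth of order p. The subsequence
  serves only to obtain pointwise convergence almost everywhere and is chosen before \<psi>, so that
  one subsequence handles all integrands at once. Outside the ball of radius R both compositions
  equal \<psi> 0 and cancel.\<close>

lemma Nemytskii_L1_subseq:
  fixes G :: "'a::euclidean_space \<Rightarrow> 'b::euclidean_space" and g :: "nat \<Rightarrow> 'a \<Rightarrow> 'b"
  assumes [measurable]: "G \<in> borel_measurable borel" "\<And>i. g i \<in> borel_measurable borel"
    and Gp: "integrable lborel (\<lambda>x. norm (G x) ^ p)"
    and gG: "\<And>i. integrable lborel (\<lambda>x. norm (g i x - G x) ^ p)" "(\<lambda>i. LINT x|lborel. norm (g i x - G x) ^ p) \<longlonglongrightarrow> 0"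
    and R: "\<And>x. norm x > R \<Longrightarrow> G x = 0" "\<And>i x. norm x > R \<Longrightarrow> g i x = 0"
    and p: "p > 0"
  shows "\<exists>r. strict_mono r \<and> (\<forall>\<psi>. continuous_on UNIV \<psi> \<and> (\<exists>C. \<forall>X. \<bar>\<psi> X\<bar> \<le> C * (1 + norm X ^ p)) \<longrightarrow>
    (\<lambda>i. LINT x|lborel. \<bar>\<psi> (g (r i) x) - \<psi> (G x)\<bar>) \<longlonglongrightarrow> 0)"
proof -
  obtain r :: "nat \<Rightarrow> nat" where r: "strict_mono r" "AE x in lborel. (\<lambda>i. norm (g (r i) x - G x) ^ p) \<longlonglongrightarrow> 0"
    using tendsto_L1_AE_subseq[of lborel "\<lambda>i x. norm (g i x - G x) ^ p", OF gG(1)] gG(2) by auto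
  have ae: "AE x in lborel. (\<lambda>i. g (r i) x) \<longlonglongrightarrow> G x"
    using r(2)
  proof eventually_elim
    case (elim x)
    have "(\<lambda>i. root p (norm (g (r i) x - G x) ^ p)) \<longlonglongrightarrow> root p 0"
      by (intro tendsto_real_root elim)
    then have "(\<lambda>i. norm (g (r i) x - G x)) \<longlonglongrightarrow> 0"
      using p by (simp add: real_root_power_cancel)
    then show ?case
      by (rule LIM_zero_cancel[OF tendsto_norm_zero_cancel])
  qed
  have "(\<lambda>i. LINT x|lborel. \<bar>\<psi> (g (r i) x) - \<psi> (G x)\<bar>) \<longlonglongrightarrow> 0"
    if \<psi>: "continuous_on UNIV \<psi>" "\<And>X. \<bar>\<psi> X\<bar> \<le> C * (1 + norm X ^ p)" for \<psi> C
  proof -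
    have [measurable]: "\<psi> \<in> borel_measurable borel"
      by (rule borel_measurable_continuous_onI[OF \<psi>(1)])
    have "\<bar>\<psi> 0\<bar> \<le> C"
      using \<psi>(2)[of 0] p by (simp add: zero_power)
    then have C: "C \<ge> 0"
      by linarith
    define H where "H x = 2 * C * indicator (cball 0 R) x + (C * 2 ^ p + C) * norm (G x) ^ p" for x
    define D where "D i x = C * 2 ^ p * norm (g (r i) x - G x) ^ p" for i x
    have H_int: "integrable lborel H"
      unfolding H_def[abs_def]
      by (intro Bochner_Integration.integrable_add integrable_mult_right integrable_real_indicator Gp)
        (use emeasure_bounded_finite[of "cball 0 R"] in auto)
    have D_int: "integrable lborel (D i)" for i
      unfolding D_def[abs_def] by (intro integrable_mult_right gG)
    have H0: "H x \<ge> 0" and D0: "D i x \<ge> 0" for i x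
      using C by (auto simp: H_def D_def)
    have le: "\<bar>\<psi> (g (r i) x) - \<psi> (G x)\<bar> \<le> H x + D i x" for i x
    proof (cases "norm x > R")
      case True
      then show ?thesis
        using R H0[of x] D0[of i x] by simp
    next
      case False
      have "norm (g (r i) x) ^ p \<le> (norm (g (r i) x - G x) + norm (G x)) ^ p"
        using norm_triangle_ineq[of "g (r i) x - G x" "G x"] by (intro power_mono) auto
      also have "\<dots> \<le> 2 ^ p * (norm (g (r i) x - G x) ^ p + norm (G x) ^ p)"
        using abs_add_power_le[of "norm (g (r i) x - G x)" "norm (G x)" p] by simp
      finally have "C * (1 + norm (g (r i) x) ^ p) \<le> C * (1 + 2 ^ p * (norm (g (r i) x - G x) ^ p + norm (G x) ^ p))"
        using C by (intro mult_left_mono) auto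
      then have "\<bar>\<psi> (g (r i) x)\<bar> \<le> C * (1 + 2 ^ p * (norm (g (r i) x - G x) ^ p + norm (G x) ^ p))"
        using \<psi>(2)[of "g (r i) x"] by linarith
      then have "\<bar>\<psi> (g (r i) x) - \<psi> (G x)\<bar> \<le> C * (1 + 2 ^ p * (norm (g (r i) x - G x) ^ p + norm (G x) ^ p)) + C * (1 + norm (G x) ^ p)"
        using \<psi>(2)[of "G x"] by linarith
      also have "\<dots> = H x + D i x"
        using False by (simp add: H_def D_def algebra_simps)
      finally show ?thesis .
    qed
    \<comment> \<open>The error is at most \<open>H x + D i x\<close>, where \<open>H\<close> is
      integrable and does not depend on i. Capping by \<open>H\<close> allows dominated convergence,
      and the excess is at most \<open>D i x\<close>, whose integral tends to 0.\<close>
    define m where "m i x = min \<bar>\<psi> (g (r i) x) - \<psi> (G x)\<bar> (H x)" for i x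
    have [measurable]: "H \<in> borel_measurable borel"
      using borel_measurable_integrable[OF H_int] by simp
    have m_meas [measurable]: "m i \<in> borel_measurable borel" for i
      unfolding m_def[abs_def] by measurable
    have m_lim: "(\<lambda>i. LINT x|lborel. m i x) \<longlonglongrightarrow> (LINT x|(lborel::'a measure). 0)"
    proof (rule integral_dominated_convergence[OF _ _ H_int])
      show "AE x in lborel. (\<lambda>i. m i x) \<longlonglongrightarrow> 0"
        using ae
      proof eventually_elim
        case (elim x)
        have "(\<lambda>i. \<psi> (g (r i) x)) \<longlonglongrightarrow> \<psi> (G x)"
          using continuous_on_tendsto_compose[OF \<psi>(1) elim] by auto
        then have "(\<lambda>i. m i x) \<longlonglongrightarrow> min \<bar>\<psi> (G x) - \<psi> (G x)\<bar> (H x)"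
          unfolding m_def by (intro tendsto_intros)
        then show ?case
          using H0[of x] by simp
      qed
      show "AE x in lborel. norm (m i x) \<le> H x" for i
        using H0 by (auto simp: m_def)
    qed auto
    have m_int: "integrable lborel (m i)" for i
      by (rule Bochner_Integration.integrable_bound[OF H_int]) (use H0 in \<open>auto simp: m_def\<close>)
    have "(\<lambda>i. C * 2 ^ p * (LINT x|lborel. norm (g (r i) x - G x) ^ p)) \<longlonglongrightarrow> C * 2 ^ p * 0"
      using LIMSEQ_subseq_LIMSEQ[OF gG(2) r(1)] by (intro tendsto_intros) (simp add: o_def)
    then have D_lim: "(\<lambda>i. LINT x|lborel. D i x) \<longlonglongrightarrow> 0"
      by (simp add: D_def)
    have lim: "(\<lambda>i. (LINT x|lborel. m i x) + (LINT x|lborel. D i x)) \<longlonglongrightarrow> 0"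
      using tendsto_add[OF m_lim D_lim] by simp
    show ?thesis
    proof (rule tendsto_sandwich[OF _ _ tendsto_const lim])
      show "\<forall>\<^sub>F i in sequentially. 0 \<le> (LINT x|lborel. \<bar>\<psi> (g (r i) x) - \<psi> (G x)\<bar>)"
        by (intro always_eventually allI integral_nonneg_AE) auto
      show "\<forall>\<^sub>F i in sequentially. (LINT x|lborel. \<bar>\<psi> (g (r i) x) - \<psi> (G x)\<bar>) \<le> (LINT x|lborel. m i x) + (LINT x|lborel. D i x)"
      proof (intro always_eventually allI)
        fix i
        have "(LINT x|lborel. \<bar>\<psi> (g (r i) x) - \<psi> (G x)\<bar>) \<le> (LINT x|lborel. m i x + D i x)"
        proof (rule integral_mono_AE')
          show "integrable lborel (\<lambda>x. m i x + D i x)"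
            by (intro Bochner_Integration.integrable_add m_int D_int)
          show "AE x in lborel. \<bar>\<psi> (g (r i) x) - \<psi> (G x)\<bar> \<le> m i x + D i x"
            using le[of i] D0[of i] by (intro AE_I2) (auto simp: m_def min_def)
          show "AE x in lborel. 0 \<le> m i x + D i x"
            using D0[of i] H0 by (intro AE_I2) (auto simp: m_def)
        qed
        then show "(LINT x|lborel. \<bar>\<psi> (g (r i) x) - \<psi> (G x)\<bar>) \<le> (LINT x|lborel. m i x) + (LINT x|lborel. D i x)"
          using m_int D_int by simp
      qed
    qed
  qed
  then show ?thesis
    using r(1) by blast
qed

section \<open>Smooth approximation of weak gradients\<close>

text \<open>The definitions integrate Lebesgue measurable functions over \<Omega>, whereas
  mollification and the Fubini arguments live on the whole space with Borel functions. The bridge is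
  a Borel representative of the extension by zero.\<close>

lemma lebesgue_on_transfer:
  fixes u u1 :: "'a::euclidean_space \<Rightarrow> real"
  assumes \<Omega>: "\<Omega> \<in> sets lebesgue" and u1 [measurable]: "u1 \<in> borel_measurable borel"
    and eq: "AE x in lebesgue. u1 x = indicator \<Omega> x * u x" and u: "u \<in> borel_measurable (lebesgue_on \<Omega>)"
  shows "integrable (lebesgue_on \<Omega>) u \<longleftrightarrow> integrable lborel u1"
    and "(LINT x|lebesgue_on \<Omega>. u x) = (LINT x|lborel. u1 x)"
proof -
  have um: "(\<lambda>x. indicator \<Omega> x * u x) \<in> borel_measurable lebesgue"
    using u \<Omega> borel_measurable_restrict_space_iff[of \<Omega> lebesgue u] by (simp add: mult.commute)
  have u1m: "u1 \<in> borel_measurable lebesgue"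
    using u1 by (auto intro: measurable_completion)
  have "integrable (lebesgue_on \<Omega>) u \<longleftrightarrow> integrable lebesgue (\<lambda>x. indicator \<Omega> x * u x)"
    using \<Omega> integrable_restrict_space[of \<Omega> lebesgue u] by simp
  also have "\<dots> \<longleftrightarrow> integrable lebesgue u1"
    using eq by (intro integrable_cong_AE um u1m) auto
  also have "\<dots> \<longleftrightarrow> integrable lborel u1"
    by (rule integrable_completion) simp
  finally show "integrable (lebesgue_on \<Omega>) u \<longleftrightarrow> integrable lborel u1" .
  have "(LINT x|lebesgue_on \<Omega>. u x) = (LINT x|lebesgue. indicator \<Omega> x * u x)"
    using \<Omega> integral_restrict_space[of \<Omega> lebesgue u] by simp
  also have "\<dots> = (LINT x|lebesgue. u1 x)"
    using eq by (intro integral_cong_AE um u1m) auto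
  also have "\<dots> = (LINT x|lborel. u1 x)"
    by (rule integral_completion) simp
  finally show "(LINT x|lebesgue_on \<Omega>. u x) = (LINT x|lborel. u1 x)" .
qed

lemma borel_representative:
  fixes G :: "'a::euclidean_space \<Rightarrow> real^'n::finite^'k::finite"
  assumes \<Omega>: "open \<Omega>" and G: "G \<in> borel_measurable (lebesgue_on \<Omega>)"
  shows "\<exists>G1. G1 \<in> borel_measurable borel \<and> (AE x in lebesgue. G1 x = indicator \<Omega> x *\<^sub>R G x) \<and> (\<forall>x. x \<notin> \<Omega> \<longrightarrow> G1 x = 0)"
proof -
  have \<Omega>': "\<Omega> \<in> sets lebesgue" "\<Omega> \<in> sets borel"
    using \<Omega> by auto
  have "\<exists>F. F \<in> borel_measurable borel \<and> (AE x in lborel. indicator \<Omega> x * G x $ i $ l = F x)" for i l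
  proof -
    have "(\<lambda>x. G x $ i $ l) \<in> borel_measurable (lebesgue_on \<Omega>)"
      by (intro measurable_compose[OF measurable_compose[OF G]]) (auto intro!: borel_measurable_continuous_onI continuous_intros)
    then have "(\<lambda>x. indicator \<Omega> x * G x $ i $ l) \<in> borel_measurable lebesgue"
      using \<Omega>'(1) borel_measurable_restrict_space_iff[of \<Omega> lebesgue "\<lambda>x. G x $ i $ l"] by (simp add: mult.commute)
    then show ?thesis
      using completion_ex_borel_measurable_real[of "\<lambda>x. indicator \<Omega> x * G x $ i $ l" lborel] by auto
  qed
  then obtain F where F: "\<And>i l. F i l \<in> borel_measurable borel" "\<And>i l. AE x in lborel. indicator \<Omega> x * G x $ i $ l = F i l x"
    by metis
  define G1 where "G1 x = (\<chi> i l. indicator \<Omega> x * F i l x)" for x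
  have "G1 \<in> borel_measurable borel"
  proof (rule borel_measurable_euclidean_space[THEN iffD2], rule ballI)
    fix b :: "real^'n^'k" assume "b \<in> Basis"
    then obtain i l where b: "b = axis i (axis l 1)"
      by (auto simp: Basis_vec_def)
    have "(\<lambda>x. G1 x \<bullet> b) = (\<lambda>x. indicator \<Omega> x * F i l x)"
      by (simp add: b G1_def inner_axis)
    then show "(\<lambda>x. G1 x \<bullet> b) \<in> borel_measurable borel"
      using F(1) \<Omega>'(2) by simp
  qed
  moreover have "AE x in lborel. \<forall>i l. indicator \<Omega> x * G x $ i $ l = F i l x"
    using F(2) by (simp add: AE_all_countable)
  then have "AE x in lebesgue. \<forall>i l. indicator \<Omega> x * G x $ i $ l = F i l x"
    by (rule AE_completion)
  then have "AE x in lebesgue. G1 x = indicator \<Omega> x *\<^sub>R G x"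
    by eventually_elim (auto simp: G1_def vec_eq_iff indicator_def split: if_splits)
  moreover have "\<forall>x. x \<notin> \<Omega> \<longrightarrow> G1 x = 0"
    by (simp add: G1_def vec_eq_iff)
  ultimately show ?thesis by blast
qed

lemma norm_matrix_le_sum: "norm X \<le> (\<Sum>i\<in>UNIV. \<Sum>l\<in>UNIV. \<bar>X $ i $ l\<bar>)" for X :: "real^'n::finite^'k::finite"
proof -
  have "norm X \<le> (\<Sum>i\<in>UNIV. norm (X $ i))"
    unfolding norm_vec_def[of X] by (rule L2_set_le_sum) auto
  also have "\<dots> \<le> (\<Sum>i\<in>UNIV. \<Sum>l\<in>UNIV. \<bar>X $ i $ l\<bar>)"
    by (intro sum_mono norm_le_l1_cart)
  finally show ?thesis .
qed

lemma sum_power_le: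
  fixes a :: "'s \<Rightarrow> real"
  assumes "finite S" "\<And>s. s \<in> S \<Longrightarrow> a s \<ge> 0" "p > 0"
  shows "(\<Sum>s\<in>S. a s) ^ p \<le> real (card S) ^ p * (\<Sum>s\<in>S. a s ^ p)"
proof (cases "S = {}")
  case True
  then show ?thesis using assms(3) by (simp add: zero_power)
next
  case False
  define M where "M = Max (a ` S)"
  have M: "a s \<le> M" if "s \<in> S" for s
    using that assms(1) by (simp add: M_def)
  have "M \<in> a ` S"
    unfolding M_def using assms(1) False by (intro Max_in) auto
  then obtain s0 where s0: "s0 \<in> S" "a s0 = M"
    by blast
  have "(\<Sum>s\<in>S. a s) \<le> real (card S) * M"
    using sum_bounded_above[of S a M] M by simp
  then have "(\<Sum>s\<in>S. a s) ^ p \<le> (real (card S) * M) ^ p"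
    using assms(2) by (intro power_mono sum_nonneg)
  also have "\<dots> = real (card S) ^ p * a s0 ^ p"
    by (simp add: power_mult_distrib s0)
  also have "\<dots> \<le> real (card S) ^ p * (\<Sum>s\<in>S. a s ^ p)"
    using assms s0(1) by (intro mult_left_mono member_le_sum) auto
  finally show ?thesis .
qed

lemma mollifier_gradient:
  "C1_gradient (mollifier \<delta> :: real^'m::finite \<Rightarrow> real)
    (\<lambda>x. \<chi> j. coord_prod ((\<lambda>i x. bump (1 / \<delta> * x + 0))(j := deriv (\<lambda>x. bump (1 / \<delta> * x + 0)))) x)"
  unfolding mollifier_def by (rule C1_gradient_coord_prod[OF Ck_real_bump_scaled])

definition mollify_gradient :: "real \<Rightarrow> (real^'m::finite \<Rightarrow> real) \<Rightarrow> real^'m \<Rightarrow> real^'m" where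
  "mollify_gradient \<delta> F z = (1 / (LINT y|lborel. mollifier \<delta> (y :: real^'m))) *\<^sub>R
    (- (LINT y|lborel. F y *\<^sub>R (\<chi> j. coord_prod ((\<lambda>i x. bump (1 / \<delta> * x + 0))(j := deriv (\<lambda>x. bump (1 / \<delta> * x + 0)))) (y - z))))"

lemma C1_gradient_mollify:
  fixes F :: "real^'m::finite \<Rightarrow> real"
  assumes F: "integrable lborel F" and \<delta>: "\<delta> > 0"
  shows "C1_gradient (mollify \<delta> F) (mollify_gradient \<delta> F)"
proof -
  let ?I = "LINT y|lborel. mollifier \<delta> (y :: real^'m)"
  let ?\<rho>' = "\<lambda>x::real^'m. \<chi> j. coord_prod ((\<lambda>i x. bump (1 / \<delta> * x + 0))(j := deriv (\<lambda>x. bump (1 / \<delta> * x + 0)))) x"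
  have c: "C1_gradient (\<lambda>z::real^'m. 1 / ?I) (\<lambda>z. 0)"
    by (simp add: C1_gradient_def GDERIV_const)
  have "C1_gradient (\<lambda>z. 1 / ?I * (LINT y|lborel. F y * mollifier \<delta> (y - z)))
      (\<lambda>z. (1 / ?I) *\<^sub>R (- (LINT y|lborel. F y *\<^sub>R ?\<rho>' (y - z))) + (LINT y|lborel. F y * mollifier \<delta> (y - z)) *\<^sub>R 0)"
    by (rule C1_gradient_mult[OF c C1_gradient_correlation[OF F mollifier_gradient cc_function_mollifier[OF \<delta>]]])
  then show ?thesis
    by (simp add: mollify_def[abs_def] mollify_gradient_def[abs_def])
qed

lemma deriv_zero_outside:
  assumes f: "Ck_real (Suc 0) f" and zero: "\<And>x. \<bar>x\<bar> \<ge> \<delta> \<Longrightarrow> f x = 0" and x: "\<bar>x\<bar> > (\<delta>::real)"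
  shows "deriv f x = 0"
proof -
  have "open {x::real. \<bar>x\<bar> > \<delta>}"
    by (intro open_Collect_less continuous_intros)
  then have "((\<lambda>x. 0) has_real_derivative deriv f x) (at x)"
    using x zero by (intro has_field_derivative_transform_within_open[OF Ck_real_deriv[OF f], of "{x. \<bar>x\<bar> > \<delta>}"]) auto
  then show ?thesis
    by (intro DERIV_unique[OF _ DERIV_const])
qed

text \<open>Differentiating the mollified (i, l) entry along k differentiates the kernel along k;
  the weak derivative identity moves l onto the kernel as well and leaves \<open>f\<close> against a
  second derivative, which is symmetric in k and l. The cube around z must lie in \<Omega>, for
  otherwise the translated kernel is no test function there.\<close>

lemma mollify_gradient_symmetric:
  fixes f :: "real^'m::finite \<Rightarrow> real^'k::finite" and G G1 :: "real^'m \<Rightarrow> real^'m^'k"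
  assumes \<Omega>: "open \<Omega>" and weak: "\<And>\<phi> i j. test_function \<Omega> \<phi> \<Longrightarrow>
      (LINT x|lebesgue_on \<Omega>. f x $ i * partial_deriv j \<phi> x) = - (LINT x|lebesgue_on \<Omega>. G x $ i $ j * \<phi> x)"
    and G: "G \<in> borel_measurable (lebesgue_on \<Omega>)"
    and G1 [measurable]: "G1 \<in> borel_measurable borel" and eq: "AE x in lebesgue. G1 x = indicator \<Omega> x *\<^sub>R G x"
    and int: "\<And>i l. integrable lborel (\<lambda>x. G1 x $ i $ l)"
    and \<delta>: "\<delta> > 0" and inside: "\<And>y. (\<And>c. \<bar>y $ c - z $ c\<bar> \<le> \<delta>) \<Longrightarrow> y \<in> \<Omega>"
  shows "mollify_gradient \<delta> (\<lambda>x. G1 x $ i $ l) z $ k = mollify_gradient \<delta> (\<lambda>x. G1 x $ i $ k) z $ l"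
proof -
  define b where "b = (\<lambda>(i::'m) x. bump (1 / \<delta> * x + 0))"
  define db where "db = deriv (\<lambda>x. bump (1 / \<delta> * x + 0))"
  have b_Ck: "Ck_real n (b i)" for n i
    unfolding b_def by (rule Ck_real_bump_scaled)
  have db_Ck: "Ck_real n db" for n
    using Ck_real_bump_scaled[of "Suc n" \<delta>] unfolding db_def by simp
  have b_zero: "b i x = 0" if "\<bar>x\<bar> \<ge> \<delta>" for i x
    using bump_nonzero_iff[of "1 / \<delta> * x + 0"] that \<delta> by (auto simp: b_def field_simps)
  have db_zero: "db x = 0" if "\<bar>x\<bar> > \<delta>" for x
    unfolding db_def using Ck_real_bump_scaled b_zero[unfolded b_def] that by (rule deriv_zero_outside)
  \<comment> \<open>For distinct k and l the two derivatives replace two different factors of the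
    product, and the order of replacement is irrelevant. Equal indices need no argument, so the
    second derivative of a single factor never occurs.\<close>
  have key: "(LINT y|lborel. G1 y $ i $ l * coord_prod (b(k := db)) (y - z))
      = - (LINT y|lebesgue_on \<Omega>. f y $ i * coord_prod (b(k := db, l := db)) (y - z))" if "k \<noteq> l" for k l
  proof -
    define c where "c = (\<lambda>j x. (b(k := db)) j (1 * x + (- z $ j)))"
    have c_Ck: "Ck_real n (c j)" for n j
      unfolding c_def using b_Ck db_Ck by (intro Ck_real_affine) auto
    have shift: "coord_prod c y = coord_prod (b(k := db)) (y - z)" for y
      by (simp add: coord_prod_def c_def)
    have c_zero: "c j x = 0" if "\<bar>x - z $ j\<bar> > \<delta>" for j x
      using that b_zero db_zero by (auto simp: c_def)
    have test: "test_function \<Omega> (coord_prod c)"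
      unfolding test_function_def
    proof (intro conjI allI exI[of _ "cbox (z - (\<chi> j. \<delta>)) (z + (\<chi> j. \<delta>))"] impI)
      show "C_k n (coord_prod c)" for n
        by (rule C_k_coord_prod[OF c_Ck])
      show "compact (cbox (z - (\<chi> j. \<delta>)) (z + (\<chi> j. \<delta>)))"
        by (rule compact_cbox)
      show "cbox (z - (\<chi> j. \<delta>)) (z + (\<chi> j. \<delta>)) \<subseteq> \<Omega>"
      proof
        fix y assume y: "y \<in> cbox (z - (\<chi> j. \<delta>)) (z + (\<chi> j. \<delta>))"
        have "\<bar>y $ c - z $ c\<bar> \<le> \<delta>" for c
        proof -
          have "z $ c - \<delta> \<le> y $ c" "y $ c \<le> z $ c + \<delta>"
            using y by (auto simp: mem_box_cart)
          then show ?thesis by (simp add: abs_le_iff)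
        qed
        then show "y \<in> \<Omega>" by (rule inside)
      qed
      show "coord_prod c y = 0" if "y \<notin> cbox (z - (\<chi> j. \<delta>)) (z + (\<chi> j. \<delta>))" for y
      proof -
        have "\<exists>j. \<not> (z $ j - \<delta> \<le> y $ j \<and> y $ j \<le> z $ j + \<delta>)"
          using that by (simp add: mem_box_cart)
        then obtain j where "\<not> (z $ j - \<delta> \<le> y $ j \<and> y $ j \<le> z $ j + \<delta>)"
          by blast
        then have "\<bar>y $ j - z $ j\<bar> > \<delta>"
          by (auto simp: abs_if split: if_splits)
        then show ?thesis
          using c_zero coord_prod_nonzero_iff[of c y] by blast
      qed
    qed
    have "partial_deriv l (coord_prod c) y = coord_prod (c(l := deriv (c l))) y" for y
      using partial_deriv_GDERIV[OF GDERIV_coord_prod[of c "\<lambda>i. deriv (c i)", OF Ck_real_deriv[OF c_Ck]], of l y] by simp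
    moreover have "deriv (c l) x = db (x - z $ l)" for x
    proof -
      have "((\<lambda>x. bump (1 / \<delta> * x + 0)) has_real_derivative db (x - z $ l)) (at (1 * x + (- z $ l)))"
        using Ck_real_deriv[OF Ck_real_bump_scaled[of "Suc 0" \<delta>], of "x - z $ l"] by (simp only: db_def) simp
      moreover have "((\<lambda>x. 1 * x + (- z $ l)) has_real_derivative 1) (at x)"
        by (auto intro!: derivative_eq_intros)
      ultimately have "((\<lambda>x. bump (1 / \<delta> * (1 * x + (- z $ l)) + 0)) has_real_derivative db (x - z $ l) * 1) (at x)"
        by (rule DERIV_chain2)
      moreover have "c l = (\<lambda>x. bump (1 / \<delta> * (1 * x + (- z $ l)) + 0))"
        using that by (simp add: c_def b_def)
      ultimately have "(c l has_real_derivative db (x - z $ l)) (at x)"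
        by simp
      then show ?thesis
        by (simp add: DERIV_imp_deriv)
    qed
    ultimately have pd: "partial_deriv l (coord_prod c) y = coord_prod (b(k := db, l := db)) (y - z)" for y
      using that by (auto simp: coord_prod_def c_def intro!: prod.cong)
    have cont_c: "continuous_on UNIV (coord_prod c)"
      using c_Ck[of 0] by (intro continuous_coord_prod) simp
    then have [measurable]: "coord_prod c \<in> borel_measurable borel"
      by (rule borel_measurable_continuous_onI)
    have "(LINT y|lebesgue_on \<Omega>. G y $ i $ l * coord_prod c y) = (LINT y|lborel. G1 y $ i $ l * coord_prod c y)"
    proof (rule lebesgue_on_transfer(2))
      show "\<Omega> \<in> sets lebesgue"
        using \<Omega> by auto
      show "(\<lambda>y. G1 y $ i $ l * coord_prod c y) \<in> borel_measurable borel"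
        using borel_measurable_integrable[OF int[of i l]] by simp
      show "AE x in lebesgue. G1 x $ i $ l * coord_prod c x = indicator \<Omega> x * (G x $ i $ l * coord_prod c x)"
        using eq by eventually_elim (simp add: mult.assoc)
      have "(\<lambda>x. G x $ i $ l) \<in> borel_measurable (lebesgue_on \<Omega>)"
        by (intro measurable_compose[OF measurable_compose[OF G]]) (auto intro!: borel_measurable_continuous_onI continuous_intros)
      moreover have "coord_prod c \<in> borel_measurable (lebesgue_on \<Omega>)"
        by (intro measurable_restrict_space1 measurable_completion) simp
      ultimately show "(\<lambda>x. G x $ i $ l * coord_prod c x) \<in> borel_measurable (lebesgue_on \<Omega>)"
        by simp
    qed
    then show ?thesis
      using weak[OF test, of i l] by (simp add: pd shift)
  qed
  have comp: "mollify_gradient \<delta> (\<lambda>x. G1 x $ i $ l) z $ k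
      = - ((LINT y|lborel. G1 y $ i $ l * coord_prod (b(k := db)) (y - z)) / (LINT y|lborel. mollifier \<delta> (y :: real^'m)))" for k l
  proof -
    let ?V = "\<lambda>y. G1 y $ i $ l *\<^sub>R (\<chi> j. coord_prod (b(j := db)) (y - z))"
    have cont: "continuous_on UNIV (\<lambda>x::real^'m. \<chi> j. coord_prod (b(j := db)) x)"
      by (intro continuous_on_vec_lambda continuous_coord_prod) (use b_Ck[of 0] db_Ck[of 0] in auto)
    obtain C where C: "\<And>x::real^'m. norm (\<chi> j. coord_prod (b(j := db)) x) \<le> C"
    proof -
      have "\<exists>E. \<forall>x k. \<bar>(\<chi> j. coord_prod (b(j := db)) x) $ k\<bar> \<le> E"
        using cc_function_component_bounded[OF mollifier_gradient cc_function_mollifier[OF \<delta>]]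
        by (simp add: b_def db_def)
      then obtain E where E: "\<And>x k. \<bar>coord_prod (b(k := db)) x\<bar> \<le> E"
        by auto
      have "norm (\<chi> j. coord_prod (b(j := db)) x) \<le> (\<Sum>k\<in>(UNIV::'m set). E)" for x :: "real^'m"
        by (intro order_trans[OF norm_le_l1_cart] sum_mono) (simp add: E)
      then show ?thesis using that by blast
    qed
    have "integrable lborel ?V"
      by (rule integrable_mult_bounded_continuous[OF int continuous_on_minus_shift(1)[OF cont], where C=C]) (rule C)
    then have "inner (axis k 1) (LINT y|lborel. ?V y) = (LINT y|lborel. inner (axis k 1) (?V y))"
      by (intro integral_inner_right[symmetric])
    then have "(LINT y|lborel. ?V y) $ k = (LINT y|lborel. G1 y $ i $ l * coord_prod (b(k := db)) (y - z))"
      by (simp add: inner_axis')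
    then show ?thesis
      by (simp add: mollify_gradient_def b_def db_def)
  qed
  show ?thesis
  proof (cases "k = l")
    case False
    then have "b(k := db, l := db) = b(l := db, k := db)"
      by auto
    then show ?thesis
      using False by (simp add: comp key)
  qed simp
qed

text \<open>The weak gradient is extended by zero and mollified entrywise. The extension jumps at
  the boundary, so the result is curl free only where a cube of half side r fits into \<Omega>; that
  is enough, because the minors need symmetric derivatives and no potential. The condition \<psi> 0
  = 0 removes the region outside \<Omega> from the integrals. The error bound is uniform in the
  weight \<Phi>, so one approximation serves every weight.\<close>

lemma smooth_gradient_approx:
  fixes f :: "real^'m::finite \<Rightarrow> real^'k::finite" and G :: "real^'m \<Rightarrow> real^'m^'k" and p :: nat
  assumes \<Omega>: "bounded \<Omega>" "open \<Omega>" and sob: "sobolev_with_gradient (real p) \<Omega> f G" and p: "p > 0" and r: "r > 0"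
    and S: "finite S" and \<psi>: "\<And>\<psi>. \<psi> \<in> S \<Longrightarrow> continuous_on UNIV \<psi> \<and> (\<exists>C. \<forall>X. \<bar>\<psi> X\<bar> \<le> C * (1 + norm X ^ p)) \<and> \<psi> 0 = 0"
    and e: "e > 0"
  shows "\<exists>g g'. (\<forall>i l. C1_gradient (\<lambda>x. g x $ i $ l) (g' i l) \<and> cc_function (\<lambda>x. g x $ i $ l)) \<and>
    (\<forall>z. (\<forall>y. (\<forall>c. \<bar>y $ c - z $ c\<bar> \<le> r) \<longrightarrow> y \<in> \<Omega>) \<longrightarrow> (\<forall>i k l. g' i l z $ k = g' i k z $ l)) \<and>
    (\<forall>\<psi>\<in>S. \<forall>\<Phi>. continuous_on UNIV \<Phi> \<and> (\<forall>x. \<bar>\<Phi> x\<bar> \<le> 1) \<longrightarrow>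
      \<bar>(LINT x|lborel. \<Phi> x * \<psi> (g x)) - (LINT x|lebesgue_on \<Omega>. \<psi> (G x) * \<Phi> x)\<bar> \<le> e)"
proof -
  obtain q where q: "p = Suc q"
    using p gr0_implies_Suc by blast
  have weak: "\<And>\<phi> i j. test_function \<Omega> \<phi> \<Longrightarrow>
      (LINT x|lebesgue_on \<Omega>. f x $ i * partial_deriv j \<phi> x) = - (LINT x|lebesgue_on \<Omega>. G x $ i $ j * \<phi> x)"
    and Gm: "G \<in> borel_measurable (lebesgue_on \<Omega>)"
    and Gp: "integrable (lebesgue_on \<Omega>) (\<lambda>x. norm (G x) ^ p)"
    using sob p unfolding sobolev_with_gradient_def L_p_def by (auto simp: powr_realpow')
  have \<Omega>_leb: "\<Omega> \<in> sets lebesgue"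
    using \<Omega> by auto
  obtain G1 where G1m [measurable]: "G1 \<in> borel_measurable borel"
    and G1: "AE x in lebesgue. G1 x = indicator \<Omega> x *\<^sub>R G x" "\<And>x. x \<notin> \<Omega> \<Longrightarrow> G1 x = 0"
    using borel_representative[OF \<Omega>(2) Gm] by blast
  obtain B where B: "\<And>x. x \<in> \<Omega> \<Longrightarrow> norm x \<le> B"
    using \<Omega>(1) unfolding bounded_iff by blast
  have G1_zero: "G1 x = 0" if "norm x > B" for x
    using that B[of x] G1(2)[of x] by fastforce
  have G1p: "integrable lborel (\<lambda>x. norm (G1 x) ^ p)"
  proof (rule lebesgue_on_transfer(1)[THEN iffD1, OF \<Omega>_leb _ _ _ Gp])
    show "AE x in lebesgue. norm (G1 x) ^ p = indicator \<Omega> x * norm (G x) ^ p"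
      using G1(1) by eventually_elim (use p in \<open>auto simp: indicator_def zero_power\<close>)
  qed (use Gm in measurable)
  have entry_le: "\<bar>X $ i $ l\<bar> \<le> norm X" for X :: "real^'m^'k" and i l
    by (metis Finite_Cartesian_Product.norm_nth_le order_trans real_norm_def)
  have Fm [measurable]: "(\<lambda>x. G1 x $ i $ l) \<in> borel_measurable borel" for i l
    by (rule measurable_compose[OF measurable_compose[OF G1m]]) (auto intro!: borel_measurable_continuous_onI continuous_intros)
  have Fp: "integrable lborel (\<lambda>x. \<bar>G1 x $ i $ l\<bar> ^ Suc q)" for i l
  proof (rule Bochner_Integration.integrable_bound[OF G1p])
    show "AE x in lborel. norm (\<bar>G1 x $ i $ l\<bar> ^ Suc q) \<le> norm (norm (G1 x) ^ p)"
      using entry_le by (intro AE_I2) (simp add: q power_mono del: power_Suc)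
  qed measurable
  have F0: "G1 x $ i $ l = 0" if "norm x > B" for x i l
    using G1_zero[OF that] by simp
  have Fint: "integrable lborel (\<lambda>x. G1 x $ i $ l)" for i l
    by (rule integrable_of_power_integrable[OF Fm Fp _ F0]) simp_all
  define s where "s n = 1 / real (Suc n)" for n
  have s: "s n > 0" for n by (simp add: s_def)
  define good where "good n i l \<delta> \<longleftrightarrow> integrable lborel (\<lambda>x. \<bar>mollify \<delta> (\<lambda>x. G1 x $ i $ l) x - G1 x $ i $ l\<bar> ^ Suc q)
      \<and> (LINT x|lborel. \<bar>mollify \<delta> (\<lambda>x. G1 x $ i $ l) x - G1 x $ i $ l\<bar> ^ Suc q) < s n" for n i l \<delta>
  have "\<exists>d>0. \<forall>\<delta> i l. 0 < \<delta> \<and> \<delta> < d \<longrightarrow> good n i l \<delta>" for n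
  proof -
    have "\<exists>d>0. \<forall>\<delta>. 0 < \<delta> \<and> \<delta> < d \<longrightarrow> good n i l \<delta>" for i l
      unfolding good_def by (rule mollify_tendsto_Lp[OF Fm Fp F0 s])
    then obtain d where d: "\<And>i l. d i l > 0" "\<And>i l \<delta>. 0 < \<delta> \<Longrightarrow> \<delta> < d i l \<Longrightarrow> good n i l \<delta>"
      by metis
    define d0 where "d0 = Min (range (\<lambda>(i, l). d i l))"
    have "d0 \<le> d i l" for i l
      unfolding d0_def by (intro Min_le) (auto intro: range_eqI[of _ _ "(i, l)"])
    moreover have "d0 > 0"
      using d(1) unfolding d0_def by (subst Min_gr_iff) auto
    ultimately show ?thesis
      using d(2) by (intro exI[of _ d0]) (meson less_le_trans)
  qed
  then obtain d where d: "\<And>n. d n > 0" "\<And>n \<delta> i l. 0 < \<delta> \<Longrightarrow> \<delta> < d n \<Longrightarrow> good n i l \<delta>"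
    by metis
  \<comment> \<open>The bound \<open>r\<close> keeps the kernel inside the cube granted by the
    symmetry statement; \<open>d n / 2\<close> makes the L^p error of every entry less than
    \<open>s n\<close>.\<close>
  define \<delta> where "\<delta> n = min r (d n / 2)" for n
  have \<delta>: "\<delta> n > 0" "\<delta> n \<le> r" "\<delta> n < d n" for n
    using d(1)[of n] r by (auto simp: \<delta>_def min_def)
  define g where "g n x = (\<chi> i l. mollify (\<delta> n) (\<lambda>x. G1 x $ i $ l) x)" for n x
  define g' where "g' n i l = mollify_gradient (\<delta> n) (\<lambda>x. G1 x $ i $ l)" for n i l
  have g_nth: "g n x $ i $ l = mollify (\<delta> n) (\<lambda>x. G1 x $ i $ l) x" for n x i l
    by (simp add: g_def)
  have g_C1: "C1_gradient (\<lambda>x. g n x $ i $ l) (g' n i l)" for n i l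
    unfolding g_nth g'_def by (rule C1_gradient_mollify[OF Fint \<delta>(1)])
  have g_cc: "cc_function (\<lambda>x. g n x $ i $ l)" for n i l
    unfolding g_nth by (rule cc_function_mollify(1)[where B=B]) (use Fint F0 \<delta> in auto)
  have g_sym: "g' n i l z $ k = g' n i k z $ l" if "\<And>y. (\<And>c. \<bar>y $ c - z $ c\<bar> \<le> r) \<Longrightarrow> y \<in> \<Omega>" for n i k l z
    unfolding g'_def
  proof (rule mollify_gradient_symmetric[OF \<Omega>(2) weak Gm G1m G1(1) Fint \<delta>(1)])
    show "y \<in> \<Omega>" if "\<And>c. \<bar>y $ c - z $ c\<bar> \<le> \<delta> n" for y
      using \<open>\<And>y. (\<And>c. \<bar>y $ c - z $ c\<bar> \<le> r) \<Longrightarrow> y \<in> \<Omega>\<close> order_trans[OF that \<delta>(2)[of n]] by blast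
  qed
  have g_cont: "continuous_on UNIV (g n)" for n
    unfolding g_def[abs_def] by (intro continuous_on_vec_lambda) (use g_cc in \<open>simp add: g_nth cc_function_continuous\<close>)
  have gm [measurable]: "g n \<in> borel_measurable borel" for n
    by (rule borel_measurable_continuous_onI[OF g_cont])
  define R where "R = B + CARD('m) * r"
  have g_zero: "g n x = 0" if "norm x > R" for n x
  proof -
    have "B + CARD('m) * \<delta> n \<le> R"
      using \<delta>(2)[of n] by (simp add: R_def)
    then have "mollify (\<delta> n) (\<lambda>x. G1 x $ i $ l) x = 0" for i l
      using that by (intro cc_function_mollify(2)[where B=B]) (use Fint F0 \<delta> in auto)
    then show ?thesis
      by (simp add: g_def vec_eq_iff)
  qed
  have G1_zero': "G1 x = 0" if "norm x > R" for x
    using that r by (intro G1_zero) (auto simp: R_def intro: le_less_trans[rotated])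
  define N where "N = real (card (UNIV :: ('k \<times> 'm) set)) ^ p"
  have norm_le: "norm X ^ p \<le> N * (\<Sum>(i, l)\<in>UNIV. \<bar>X $ i $ l\<bar> ^ Suc q)" for X :: "real^'m^'k"
  proof -
    have "norm X \<le> (\<Sum>(i, l)\<in>UNIV. \<bar>X $ i $ l\<bar>)"
      using norm_matrix_le_sum[of X] by (simp add: sum.cartesian_product)
    then have "norm X ^ p \<le> (\<Sum>(i, l)\<in>UNIV. \<bar>X $ i $ l\<bar>) ^ p"
      by (intro power_mono) auto
    also have "\<dots> \<le> N * (\<Sum>s\<in>UNIV. (case s of (i, l) \<Rightarrow> \<bar>X $ i $ l\<bar>) ^ p)"
      unfolding N_def by (rule sum_power_le) (use p in auto)
    also have "(\<Sum>s\<in>UNIV. (case s of (i, l) \<Rightarrow> \<bar>X $ i $ l\<bar>) ^ p) = (\<Sum>(i, l)\<in>UNIV. \<bar>X $ i $ l\<bar> ^ Suc q)"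
      by (intro sum.cong refl) (auto simp: q)
    finally show ?thesis .
  qed
  let ?D = "\<lambda>n x. N * (\<Sum>(i, l)\<in>UNIV. \<bar>g n x $ i $ l - G1 x $ i $ l\<bar> ^ Suc q)"
  have D_int: "integrable lborel (?D n)" for n
    using d(2)[OF \<delta>(1) \<delta>(3), of n] unfolding good_def by (auto simp: g_nth case_prod_unfold simp del: power_Suc)
  have diff_le: "norm (g n x - G1 x) ^ p \<le> ?D n x" for n x
    using norm_le[of "g n x - G1 x"] by simp
  have diff_int: "integrable lborel (\<lambda>x. norm (g n x - G1 x) ^ p)" for n
  proof (rule Bochner_Integration.integrable_bound[OF D_int])
    show "AE x in lborel. norm (norm (g n x - G1 x) ^ p) \<le> norm (?D n x)"
    proof (rule AE_I2)
      fix x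
      have "norm (norm (g n x - G1 x) ^ p) = norm (g n x - G1 x) ^ p"
        by simp
      also have "\<dots> \<le> ?D n x" by (rule diff_le)
      also have "\<dots> \<le> norm (?D n x)" by simp
      finally show "norm (norm (g n x - G1 x) ^ p) \<le> norm (?D n x)" .
    qed
  qed measurable
  have diff_lim: "(\<lambda>n. LINT x|lborel. norm (g n x - G1 x) ^ p) \<longlonglongrightarrow> 0"
  proof (rule tendsto_sandwich[OF _ _ tendsto_const])
    show "\<forall>\<^sub>F n in sequentially. 0 \<le> (LINT x|lborel. norm (g n x - G1 x) ^ p)"
      by (intro always_eventually allI integral_nonneg_AE) auto
    show "\<forall>\<^sub>F n in sequentially. (LINT x|lborel. norm (g n x - G1 x) ^ p) \<le> N * (\<Sum>(i::'k, l::'m)\<in>UNIV. s n)"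
    proof (intro always_eventually allI)
      fix n
      have "(LINT x|lborel. norm (g n x - G1 x) ^ p) \<le> (LINT x|lborel. ?D n x)"
        by (intro integral_mono diff_int D_int diff_le)
      also have "\<dots> = N * (\<Sum>(i, l)\<in>UNIV. LINT x|lborel. \<bar>g n x $ i $ l - G1 x $ i $ l\<bar> ^ Suc q)"
        using d(2)[OF \<delta>(1) \<delta>(3), of n] unfolding good_def by (simp add: g_nth case_prod_unfold del: power_Suc)
      also have "\<dots> \<le> N * (\<Sum>(i::'k, l::'m)\<in>UNIV. s n)"
      proof (intro mult_left_mono sum_mono)
        show "N \<ge> 0" by (simp add: N_def)
        show "(case il of (i, l) \<Rightarrow> LINT x|lborel. \<bar>g n x $ i $ l - G1 x $ i $ l\<bar> ^ Suc q) \<le> (case il of (i, l) \<Rightarrow> s n)" for il :: "'k \<times> 'm"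
          using d(2)[OF \<delta>(1) \<delta>(3), of n "fst il" "snd il"] unfolding good_def by (simp add: g_nth case_prod_unfold del: power_Suc)
      qed
      finally show "(LINT x|lborel. norm (g n x - G1 x) ^ p) \<le> N * (\<Sum>(i::'k, l::'m)\<in>UNIV. s n)" .
    qed
    have "s \<longlonglongrightarrow> 0"
      unfolding s_def[abs_def] by (rule LIMSEQ_Suc[OF lim_1_over_n])
    then have "(\<lambda>n. N * (real CARD('k \<times> 'm) * s n)) \<longlonglongrightarrow> N * (real CARD('k \<times> 'm) * 0)"
      by (intro tendsto_intros)
    then show "(\<lambda>n. N * (\<Sum>(i::'k, l::'m)\<in>UNIV. s n)) \<longlonglongrightarrow> 0"
      by (simp add: case_prod_unfold)
  qed
  have "\<exists>\<rho>. strict_mono \<rho> \<and> (\<forall>\<psi>. continuous_on UNIV \<psi> \<and> (\<exists>C. \<forall>X. \<bar>\<psi> X\<bar> \<le> C * (1 + norm X ^ p)) \<longrightarrow>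
    (\<lambda>i. LINT x|lborel. \<bar>\<psi> (g (\<rho> i) x) - \<psi> (G1 x)\<bar>) \<longlonglongrightarrow> 0)"
    by (rule Nemytskii_L1_subseq[where R=R, OF G1m gm G1p diff_int diff_lim]) (rule G1_zero' g_zero p; assumption?)+
  then obtain \<rho> where \<rho>: "strict_mono \<rho>" "\<forall>\<psi>. continuous_on UNIV \<psi> \<and> (\<exists>C. \<forall>X. \<bar>\<psi> X\<bar> \<le> C * (1 + norm X ^ p)) \<longrightarrow>
    (\<lambda>i. LINT x|lborel. \<bar>\<psi> (g (\<rho> i) x) - \<psi> (G1 x)\<bar>) \<longlonglongrightarrow> 0"
    by blast
  have lim\<psi>: "(\<lambda>i. LINT x|lborel. \<bar>\<psi> (g (\<rho> i) x) - \<psi> (G1 x)\<bar>) \<longlonglongrightarrow> 0" if "\<psi> \<in> S" for \<psi>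
    using \<psi>[OF that] by (intro \<rho>(2)[rule_format]) auto
  have "\<forall>\<^sub>F i in sequentially. \<forall>\<psi>\<in>S. (LINT x|lborel. \<bar>\<psi> (g (\<rho> i) x) - \<psi> (G1 x)\<bar>) < e"
    using S order_tendstoD(2)[OF lim\<psi> e] by (intro eventually_ball_finite) auto
  then obtain i where i: "\<And>\<psi>. \<psi> \<in> S \<Longrightarrow> (LINT x|lborel. \<bar>\<psi> (g (\<rho> i) x) - \<psi> (G1 x)\<bar>) < e"
    by (auto simp: eventually_sequentially)
  define n where "n = \<rho> i"
  have main: "\<bar>(LINT x|lborel. \<Phi> x * \<psi> (g n x)) - (LINT x|lebesgue_on \<Omega>. \<psi> (G x) * \<Phi> x)\<bar> \<le> e"
    if \<psi>S: "\<psi> \<in> S" and \<Phi>: "continuous_on UNIV \<Phi>" "\<And>x. \<bar>\<Phi> x\<bar> \<le> 1" for \<psi> \<Phi>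
  proof -
    have \<psi>c: "continuous_on UNIV \<psi>" and \<psi>0: "\<psi> 0 = 0"
      using \<psi>[OF \<psi>S] by auto
    obtain C where C: "\<And>X. \<bar>\<psi> X\<bar> \<le> C * (1 + norm X ^ p)"
      using \<psi>[OF \<psi>S] by auto
    have \<psi>m [measurable]: "\<psi> \<in> borel_measurable borel" and \<Phi>m [measurable]: "\<Phi> \<in> borel_measurable borel"
      by (intro borel_measurable_continuous_onI \<psi>c \<Phi>)+
    have "\<bar>\<psi> 0\<bar> \<le> C"
      using C[of 0] p by (simp add: zero_power)
    then have C0: "C \<ge> 0" by linarith
    have tr: "(LINT x|lebesgue_on \<Omega>. \<psi> (G x) * \<Phi> x) = (LINT x|lborel. \<psi> (G1 x) * \<Phi> x)"
    proof (rule lebesgue_on_transfer(2)[OF \<Omega>_leb])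
      show "AE x in lebesgue. \<psi> (G1 x) * \<Phi> x = indicator \<Omega> x * (\<psi> (G x) * \<Phi> x)"
        using G1(1) by eventually_elim (auto simp: indicator_def \<psi>0)
      have "\<Phi> \<in> borel_measurable (lebesgue_on \<Omega>)"
        by (intro measurable_restrict_space1 measurable_completion) simp
      then show "(\<lambda>x. \<psi> (G x) * \<Phi> x) \<in> borel_measurable (lebesgue_on \<Omega>)"
        using measurable_compose[OF Gm \<psi>m] by simp
    qed measurable
    have ind: "integrable lborel (\<lambda>x. indicator (cball 0 R) (x :: real^'m) :: real)"
      by (intro integrable_real_indicator) (use emeasure_bounded_finite[of "cball 0 R"] in auto)
    have int_g: "integrable lborel (\<lambda>x. \<psi> (g n x))"
    proof (rule integrable_cc_function)
      have "continuous_on UNIV (\<lambda>x. \<psi> (g n x))"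
        by (rule continuous_on_compose2[OF \<psi>c g_cont]) auto
      then show "cc_function (\<lambda>x. \<psi> (g n x))"
        using g_zero \<psi>0 unfolding cc_function_def by metis
    qed
    have int_G: "integrable lborel (\<lambda>x. \<psi> (G1 x))"
    proof (rule Bochner_Integration.integrable_bound)
      show "integrable lborel (\<lambda>x. C * (indicator (cball 0 R) x + norm (G1 x) ^ p))"
        by (intro integrable_mult_right Bochner_Integration.integrable_add ind G1p)
      have "\<bar>\<psi> (G1 x)\<bar> \<le> C * (indicator (cball 0 R) x + norm (G1 x) ^ p)" for x
        using C[of "G1 x"] G1_zero'[of x] \<psi>0 C0 by (cases "norm x > R") auto
      then show "AE x in lborel. norm (\<psi> (G1 x)) \<le> norm (C * (indicator (cball 0 R) x + norm (G1 x) ^ p))"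
        by (intro AE_I2) (metis abs_ge_self order_trans real_norm_def)
    qed measurable
    have int_mult: "integrable lborel (\<lambda>x. \<Phi> x * w x)" if "integrable lborel w" for w :: "real^'m \<Rightarrow> real"
    proof (rule Bochner_Integration.integrable_bound[OF that])
      show "(\<lambda>x. \<Phi> x * w x) \<in> borel_measurable lborel"
        using borel_measurable_integrable[OF that] by simp
      show "AE x in lborel. norm (\<Phi> x * w x) \<le> norm (w x)"
        using \<Phi>(2) by (intro AE_I2) (simp add: abs_mult mult_left_le_one_le)
    qed
    have "(LINT x|lborel. \<Phi> x * \<psi> (g n x)) - (LINT x|lborel. \<psi> (G1 x) * \<Phi> x) = (LINT x|lborel. \<Phi> x * (\<psi> (g n x) - \<psi> (G1 x)))"
      using int_mult[OF int_g] int_mult[OF int_G] by (simp add: right_diff_distrib mult.commute)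
    also have "\<bar>\<dots>\<bar> \<le> (LINT x|lborel. \<bar>\<psi> (g n x) - \<psi> (G1 x)\<bar>)"
    proof -
      have i1: "integrable lborel (\<lambda>x. \<Phi> x * (\<psi> (g n x) - \<psi> (G1 x)))"
        by (intro int_mult Bochner_Integration.integrable_diff int_g int_G)
      have "norm (LINT x|lborel. \<Phi> x * (\<psi> (g n x) - \<psi> (G1 x))) \<le> (LINT x|lborel. \<bar>\<psi> (g n x) - \<psi> (G1 x)\<bar>)"
      proof (rule order_trans[OF integral_norm_bound integral_mono])
        show "integrable lborel (\<lambda>x. norm (\<Phi> x * (\<psi> (g n x) - \<psi> (G1 x))))"
          by (rule integrable_norm[OF i1])
        show "integrable lborel (\<lambda>x. \<bar>\<psi> (g n x) - \<psi> (G1 x)\<bar>)"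
          by (intro integrable_abs Bochner_Integration.integrable_diff int_g int_G)
        show "norm (\<Phi> x * (\<psi> (g n x) - \<psi> (G1 x))) \<le> \<bar>\<psi> (g n x) - \<psi> (G1 x)\<bar>" for x
          using \<Phi>(2)[of x] by (simp add: abs_mult mult_left_le_one_le)
      qed
      then show ?thesis by simp
    qed
    also have "\<dots> \<le> e"
      using i[OF \<psi>S] by (simp add: n_def)
    finally show ?thesis
      by (simp only: tr)
  qed
  show ?thesis
  proof (intro exI[of _ "g n"] exI[of _ "g' n"] conjI allI ballI impI)
    show "C1_gradient (\<lambda>x. g n x $ i $ l) (g' n i l)" "cc_function (\<lambda>x. g n x $ i $ l)" for i l
      by (rule g_C1 g_cc)+
    show "g' n i l z $ k = g' n i k z $ l" if "\<forall>y. (\<forall>c. \<bar>y $ c - z $ c\<bar> \<le> r) \<longrightarrow> y \<in> \<Omega>" for z i k l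
      using that by (intro g_sym) blast
    show "\<bar>(LINT x|lborel. \<Phi> x * \<psi> (g n x)) - (LINT x|lebesgue_on \<Omega>. \<psi> (G x) * \<Phi> x)\<bar> \<le> e"
      if "\<psi> \<in> S" "continuous_on UNIV \<Phi> \<and> (\<forall>x. \<bar>\<Phi> x\<bar> \<le> 1)" for \<psi> \<Phi>
      using that by (intro main) auto
  qed
qed

section \<open>Minors of gradients\<close>

lemma C1_gradient_const: "C1_gradient (\<lambda>x. c) (\<lambda>x. 0)"
  by (simp add: C1_gradient_def GDERIV_const)

lemma C1_gradient_sum:
  "(\<And>i. i \<in> I \<Longrightarrow> C1_gradient (f i) (f' i)) \<Longrightarrow> C1_gradient (\<lambda>x. \<Sum>i\<in>I. f i x) (\<lambda>x. \<Sum>i\<in>I. f' i x)"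
  by (induction I rule: infinite_finite_induct) (simp_all add: C1_gradient_const C1_gradient_add)

lemma C1_gradient_cmult:
  assumes "C1_gradient f f'"
  shows "C1_gradient (\<lambda>x. c * f x) (\<lambda>x. c *\<^sub>R f' x)"
proof -
  show ?thesis
    using C1_gradient_mult[OF C1_gradient_const[of c] assms] by simp
qed

lemma C1_gradient_prod:
  assumes "finite I" "\<And>i. i \<in> I \<Longrightarrow> C1_gradient (f i) (f' i)"
  shows "C1_gradient (\<lambda>x. \<Prod>i\<in>I. f i x) (\<lambda>x. \<Sum>i\<in>I. (\<Prod>j\<in>I - {i}. f j x) *\<^sub>R f' i x)"
  using assms
proof (induction I rule: finite_induct)
  case empty
  then show ?case
    by (simp add: C1_gradient_def GDERIV_const)
next
  case (insert a I)
  have "C1_gradient (\<lambda>x. f a x * (\<Prod>i\<in>I. f i x))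
      (\<lambda>x. f a x *\<^sub>R (\<Sum>i\<in>I. (\<Prod>j\<in>I - {i}. f j x) *\<^sub>R f' i x) + (\<Prod>i\<in>I. f i x) *\<^sub>R f' a x)"
    using insert by (intro C1_gradient_mult) auto
  moreover have "f a x *\<^sub>R (\<Sum>i\<in>I. (\<Prod>j\<in>I - {i}. f j x) *\<^sub>R f' i x) + (\<Prod>i\<in>I. f i x) *\<^sub>R f' a x
      = (\<Sum>i\<in>insert a I. (\<Prod>j\<in>insert a I - {i}. f j x) *\<^sub>R f' i x)" for x
  proof -
    have "(\<Prod>j\<in>insert a I - {i}. f j x) = f a x * (\<Prod>j\<in>I - {i}. f j x)" if "i \<in> I" for i
    proof -
      have "insert a I - {i} = insert a (I - {i})"
        using that insert by auto
      then show ?thesis using insert by simp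
    qed
    moreover have "insert a I - {a} = I"
      using insert by auto
    ultimately show ?thesis
      using insert by (simp add: scaleR_sum_right add.commute)
  qed
  ultimately show ?case
    using insert by simp
qed

lemma C1_gradient_det:
  fixes E :: "'n::finite \<Rightarrow> 'n \<Rightarrow> real^'m::finite \<Rightarrow> real"
  assumes E: "\<And>b a. C1_gradient (E b a) (E' b a)"
  shows "C1_gradient (\<lambda>x. det (\<chi> b a. E b a x))
    (\<lambda>x. \<chi> k. \<Sum>c\<in>UNIV. det (\<chi> b a. if b = c then E' c a x $ k else E b a x))"
proof -
  let ?P = "{p. p permutes (UNIV :: 'n set)}"
  have "C1_gradient (\<lambda>x. \<Sum>p\<in>?P. of_int (sign p) * (\<Prod>b\<in>UNIV. E b (p b) x))
     (\<lambda>x. \<Sum>p\<in>?P. of_int (sign p) *\<^sub>R (\<Sum>c\<in>UNIV. (\<Prod>b\<in>UNIV - {c}. E b (p b) x) *\<^sub>R E' c (p c) x))"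
    by (intro C1_gradient_sum C1_gradient_cmult C1_gradient_prod E) auto
  moreover have "(\<Sum>p\<in>?P. of_int (sign p) *\<^sub>R (\<Sum>c\<in>UNIV. (\<Prod>b\<in>UNIV - {c}. E b (p b) x) *\<^sub>R E' c (p c) x))
      = (\<chi> k. \<Sum>c\<in>UNIV. det (\<chi> b a. if b = c then E' c a x $ k else E b a x))" for x
  proof (rule vec_eq_iff[THEN iffD2], rule allI)
    fix k
    have "(\<Prod>b\<in>UNIV. if b = c then E' c (p b) x $ k else E b (p b) x) = (\<Prod>b\<in>UNIV - {c}. E b (p b) x) * E' c (p c) x $ k" for c p
      by (subst prod.remove[of _ c]) (auto intro!: prod.cong)
    then have "(\<Sum>c\<in>UNIV. det (\<chi> b a. if b = c then E' c a x $ k else E b a x))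
        = (\<Sum>c\<in>UNIV. \<Sum>p\<in>?P. of_int (sign p) * ((\<Prod>b\<in>UNIV - {c}. E b (p b) x) * E' c (p c) x $ k))"
      by (simp add: det_def)
    also have "\<dots> = (\<Sum>p\<in>?P. of_int (sign p) * (\<Sum>c\<in>UNIV. (\<Prod>b\<in>UNIV - {c}. E b (p b) x) * E' c (p c) x $ k))"
      by (subst sum.swap) (simp add: sum_distrib_left)
    finally show "(\<Sum>p\<in>?P. of_int (sign p) *\<^sub>R (\<Sum>c\<in>UNIV. (\<Prod>b\<in>UNIV - {c}. E b (p b) x) *\<^sub>R E' c (p c) x)) $ k
        = (\<chi> k. \<Sum>c\<in>UNIV. det (\<chi> b a. if b = c then E' c a x $ k else E b a x)) $ k"
      by simp
  qed
  ultimately show ?thesis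
    by (simp add: det_def)
qed

lemma det_swap_rows:
  fixes A :: "real^'n::finite^'n"
  assumes "c \<noteq> d"
  shows "det (\<chi> b. A $ (Transposition.transpose c d b)) = - det A"
  using det_permute_rows[OF permutes_swap_id[of c UNIV d], of A] assms
  by (simp add: sign_swap_id)

text \<open>The matrix is transposed: row b of the determinant is column \<open>\<sigma> b\<close>
  of X, restricted to the rows \<open>I\<close>. Replacing a column of X then changes one row of the
  determinant, which suits the row-wise product rule of \<open>C1_gradient_det\<close>, and it is
  expressed by changing one value of \<sigma>.\<close>

definition minor :: "('n::finite \<Rightarrow> 'k::finite) \<Rightarrow> ('n \<Rightarrow> 'm::finite) \<Rightarrow> real^'m^'k \<Rightarrow> real" where
  "minor I \<sigma> X = det (\<chi> b a. X $ I a $ \<sigma> b)"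

definition minor_gradient ::
  "('n::finite \<Rightarrow> 'k::finite) \<Rightarrow> ('n \<Rightarrow> 'm::finite) \<Rightarrow> (real^'m \<Rightarrow> real^'m^'k) \<Rightarrow> ('k \<Rightarrow> 'm \<Rightarrow> real^'m \<Rightarrow> real^'m) \<Rightarrow> real^'m \<Rightarrow> real^'m" where
  "minor_gradient I \<sigma> g g' x = (\<chi> k. \<Sum>c\<in>UNIV. det (\<chi> b a. if b = c then g' (I a) (\<sigma> c) x $ k else g x $ I a $ \<sigma> b))"

lemma C1_gradient_minor:
  assumes "\<And>i l. C1_gradient (\<lambda>x. g x $ i $ l) (g' i l)"
  shows "C1_gradient (\<lambda>x. minor I \<sigma> (g x)) (minor_gradient I \<sigma> g g')"
  unfolding minor_def minor_gradient_def[abs_def] by (intro C1_gradient_det assms)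

(* The terms with two derivatives of g on the right-hand side cancel in pairs because the rows
   involved are interchanged. *)
lemma minor_divergence:
  fixes I :: "'n::finite \<Rightarrow> 'k::finite" and \<sigma> :: "'n \<Rightarrow> 'm::finite"
  assumes \<sigma>: "inj \<sigma>" and sym: "\<And>i k l. g' i l x $ k = g' i k x $ l"
  shows "minor_gradient I \<sigma> g g' x $ k
    = (\<Sum>l\<in>range \<sigma>. minor_gradient I (\<lambda>b. if \<sigma> b = l then k else \<sigma> b) g g' x $ l)"
proof -
  \<comment> \<open>In \<open>T c d\<close> the row c carries the replacement column k, and the
    derivative in direction \<open>\<sigma> c\<close> falls on row d. The symmetry of the
    derivatives makes exchanging c and d amount to swapping two rows.\<close>
  define T where "T c d = det (\<chi> b a. if b = d then g' (I a) (\<sigma> d) x $ \<sigma> c else if b = c then g x $ I a $ k else g x $ I a $ \<sigma> b)" for c d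
  have anti: "T c d = - T d c" if "c \<noteq> d" for c d
  proof -
    have "T c d = det (\<chi> b. (\<chi> b a. if b = c then g' (I a) (\<sigma> c) x $ \<sigma> d else if b = d then g x $ I a $ k else g x $ I a $ \<sigma> b)
        $ (Transposition.transpose c d b))"
      unfolding T_def using that
      by (intro arg_cong[where f=det]) (auto simp: vec_eq_iff Transposition.transpose_def sym[of _ "\<sigma> d" "\<sigma> c"])
    also have "\<dots> = - T d c"
      using that unfolding T_def by (rule det_swap_rows)
    finally show ?thesis .
  qed
  have "(\<Sum>l\<in>range \<sigma>. minor_gradient I (\<lambda>b. if \<sigma> b = l then k else \<sigma> b) g g' x $ l)
      = (\<Sum>c\<in>UNIV. minor_gradient I (\<lambda>b. if \<sigma> b = \<sigma> c then k else \<sigma> b) g g' x $ \<sigma> c)"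
    using \<sigma> by (simp add: sum.reindex)
  also have "\<dots> = (\<Sum>c\<in>UNIV. (\<Sum>d\<in>UNIV. if d = c then det (\<chi> b a. if b = c then g' (I a) (\<sigma> c) x $ k else g x $ I a $ \<sigma> b) else T c d))"
  proof (intro sum.cong refl)
    fix c
    have "minor_gradient I (\<lambda>b. if \<sigma> b = \<sigma> c then k else \<sigma> b) g g' x $ \<sigma> c
       = (\<Sum>d\<in>UNIV. det (\<chi> b a. if b = d then g' (I a) (if d = c then k else \<sigma> d) x $ \<sigma> c else g x $ I a $ (if b = c then k else \<sigma> b)))"
      using \<sigma> by (simp add: minor_gradient_def inj_eq)
    \<comment> \<open>For d = c the replaced row is the differentiated one. Symmetry turns the
      derivative of column k in direction \<open>\<sigma> c\<close> into that of column
      \<open>\<sigma> c\<close> in direction k, which is the corresponding term of the gradient on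
      the left.\<close>
    also have "\<dots> = (\<Sum>d\<in>UNIV. if d = c then det (\<chi> b a. if b = c then g' (I a) (\<sigma> c) x $ k else g x $ I a $ \<sigma> b) else T c d)"
    proof (intro sum.cong refl)
      fix d
      show "det (\<chi> b a. if b = d then g' (I a) (if d = c then k else \<sigma> d) x $ \<sigma> c else g x $ I a $ (if b = c then k else \<sigma> b))
        = (if d = c then det (\<chi> b a. if b = c then g' (I a) (\<sigma> c) x $ k else g x $ I a $ \<sigma> b) else T c d)"
        unfolding T_def using sym
        by (auto intro!: arg_cong[where f=det] simp: vec_eq_iff)
    qed
    finally show "minor_gradient I (\<lambda>b. if \<sigma> b = \<sigma> c then k else \<sigma> b) g g' x $ \<sigma> c
       = (\<Sum>d\<in>UNIV. if d = c then det (\<chi> b a. if b = c then g' (I a) (\<sigma> c) x $ k else g x $ I a $ \<sigma> b) else T c d)" .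
  qed
  also have "\<dots> = (\<Sum>c\<in>UNIV. det (\<chi> b a. if b = c then g' (I a) (\<sigma> c) x $ k else g x $ I a $ \<sigma> b))
      + (\<Sum>c\<in>UNIV. \<Sum>d\<in>UNIV. if d = c then 0 else T c d)"
  proof -
    have *: "(\<Sum>d\<in>UNIV. if d = c then D else T c d) = D + (\<Sum>d\<in>UNIV. if d = c then 0 else T c d)" for c and D :: real
    proof -
      have "(\<Sum>d\<in>UNIV. if d = c then D else T c d) = (\<Sum>d\<in>UNIV. (if d = c then D else 0) + (if d = c then 0 else T c d))"
        by (intro sum.cong refl) simp
      then show ?thesis
        by (simp add: sum.distrib)
    qed
    show ?thesis
      unfolding sum.distrib[symmetric] by (intro sum.cong refl) (rule *)
  qed
  also have "(\<Sum>c\<in>UNIV. \<Sum>d\<in>UNIV. if d = c then 0 else T c d) = 0"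
  proof -
    define Z where "Z = (\<Sum>c\<in>(UNIV::'n set). \<Sum>d\<in>(UNIV::'n set). if d = c then 0 else T c d)"
    have "Z = (\<Sum>d\<in>(UNIV::'n set). \<Sum>c\<in>(UNIV::'n set). if d = c then 0 else T c d)"
      unfolding Z_def by (rule sum.swap)
    also have "\<dots> = (\<Sum>d\<in>(UNIV::'n set). \<Sum>c\<in>(UNIV::'n set). - (if c = d then 0 else T d c))"
    proof (intro sum.cong refl)
      fix c d
      show "(if d = c then 0 else T c d) = - (if c = d then 0 else T d c)"
        using anti[of c d] by (cases "c = d") simp_all
    qed
    also have "\<dots> = - Z"
      unfolding Z_def by (simp add: sum_negf)
    finally show ?thesis
      unfolding Z_def by simp
  qed
  finally show ?thesis
    by (simp add: minor_gradient_def)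
qed

lemma continuous_minor: "continuous_on S (minor I \<sigma>)"
  unfolding minor_def[abs_def] det_def by (auto intro!: continuous_intros)

lemma minor_zero:
  fixes I :: "'n::finite \<Rightarrow> 'k::finite" and \<sigma> :: "'n \<Rightarrow> 'm::finite"
  shows "minor I \<sigma> 0 = 0"
proof -
  have "(\<chi> b a. (0 :: real^'m^'k) $ I a $ \<sigma> b) = (0 :: real^'n^'n)"
    by (simp add: vec_eq_iff)
  then show ?thesis
    using det_0[where 'a=real and 'n='n] by (simp add: minor_def mat_0)
qed

lemma abs_minor_le:
  fixes I :: "'n::finite \<Rightarrow> 'k::finite" and \<sigma> :: "'n \<Rightarrow> 'm::finite"
  shows "\<bar>minor I \<sigma> X\<bar> \<le> real (card {p. p permutes (UNIV :: 'n set)}) * norm X ^ CARD('n)"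
proof -
  let ?P = "{p. p permutes (UNIV :: 'n set)}"
  have entry: "\<bar>X $ i $ l\<bar> \<le> norm X" for i l
    by (metis Finite_Cartesian_Product.norm_nth_le order_trans real_norm_def)
  have "\<bar>minor I \<sigma> X\<bar> \<le> (\<Sum>p\<in>?P. \<bar>of_int (sign p) * (\<Prod>b\<in>UNIV. X $ I (p b) $ \<sigma> b)\<bar>)"
    unfolding minor_def det_def by (intro order_trans[OF sum_abs]) simp
  also have "\<dots> \<le> (\<Sum>p\<in>?P. norm X ^ CARD('n))"
  proof (rule sum_mono)
    fix p
    have "\<bar>\<Prod>b\<in>UNIV. X $ I (p b) $ \<sigma> b\<bar> \<le> (\<Prod>b\<in>(UNIV::'n set). norm X)"
      unfolding abs_prod by (intro prod_mono) (auto simp: entry)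
    moreover have "\<bar>of_int (sign p) :: real\<bar> = 1"
      by (simp add: sign_def)
    ultimately show "\<bar>of_int (sign p) * (\<Prod>b\<in>UNIV. X $ I (p b) $ \<sigma> b)\<bar> \<le> norm X ^ CARD('n)"
      by (simp add: abs_mult)
  qed
  finally show ?thesis by simp
qed

section \<open>Averages of Young measures\<close>

text \<open>A relation instead of a function, because the weak limits in the definition of a
  gradient Young measure are determined only almost everywhere. Integrability of \<psi> is recorded
  so that a vanishing integral really gives information on \<open>\<nu> x\<close>.\<close>

definition young_average ::
  "(real^'m::finite) set \<Rightarrow> (real^'m \<Rightarrow> (real^'m^'k::finite) measure) \<Rightarrow> (real^'m^'k \<Rightarrow> real) \<Rightarrow> (real^'m \<Rightarrow> real) \<Rightarrow> bool" where
  "young_average \<Omega> \<nu> \<psi> a \<longleftrightarrow> integrable (lebesgue_on \<Omega>) a \<and>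
    (AE x in lebesgue_on \<Omega>. integrable (\<nu> x) \<psi> \<and> a x = (LINT X|\<nu> x. \<psi> X))"

definition power_growth :: "nat \<Rightarrow> ('b::real_normed_vector \<Rightarrow> real) \<Rightarrow> bool" where
  "power_growth p \<psi> \<longleftrightarrow> continuous_on UNIV \<psi> \<and> (\<exists>C. \<forall>X. \<bar>\<psi> X\<bar> \<le> C * (1 + norm X ^ p))"

lemma power_growth_positive_constant:
  assumes "\<And>X::'b::real_normed_vector. \<bar>\<psi> X\<bar> \<le> C * (1 + norm X ^ p)" and p: "p > 0"
  shows "\<exists>C>0. \<forall>X. \<bar>\<psi> X\<bar> \<le> C * (1 + norm X powr real p)"
proof (intro exI[of _ "\<bar>C\<bar> + 1"] conjI allI)
  fix X
  have "\<bar>\<psi> X\<bar> \<le> C * (1 + norm X ^ p)"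
    by (rule assms)
  also have "\<dots> \<le> (\<bar>C\<bar> + 1) * (1 + norm X ^ p)"
    by (intro mult_right_mono) auto
  finally show "\<bar>\<psi> X\<bar> \<le> (\<bar>C\<bar> + 1) * (1 + norm X powr real p)"
    using p by (simp add: powr_realpow')
qed simp

lemma young_average_unique:
  assumes "young_average \<Omega> \<nu> \<psi> a" "young_average \<Omega> \<nu> \<psi> b"
  shows "AE x in lebesgue_on \<Omega>. a x = b x"
  using assms unfolding young_average_def by (auto elim: eventually_elim2)

lemma young_average_exists:
  assumes "gradient_young_measure (real p) \<Omega> \<nu>" "power_growth p \<psi>" "p > 0"
  shows "\<exists>a. young_average \<Omega> \<nu> \<psi> a"
  using assms power_growth_positive_constant[of \<psi> _ p]
  unfolding gradient_young_measure_def power_growth_def young_average_def weakly_L1_def by meson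

lemma supported_in_AE:
  fixes \<Omega> :: "(real^'m::finite) set" and \<nu> :: "real^'m \<Rightarrow> (real^'m^'k::finite) measure"
  assumes \<nu>: "\<nu> \<in> \<Omega> \<rightarrow> space (prob_algebra borel)" and A: "supported_in \<Omega> \<nu> A"
  shows "AE x in lebesgue_on \<Omega>. x \<in> \<Omega> \<and> (AE X in \<nu> x. X \<in> A)"
proof -
  have "AE x in lebesgue_on \<Omega>. x \<in> \<Omega>"
    by (rule AE_I2) simp
  moreover have "AE x in lebesgue_on \<Omega>. emeasure (\<nu> x) (UNIV - A) = 0"
    using A unfolding supported_in_def by blast
  ultimately show ?thesis
  proof eventually_elim
    case (elim x)
    have sets: "sets (\<nu> x) = sets borel"
      using \<nu> elim(1) by (auto simp: space_prob_algebra)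
    have "UNIV - A \<in> sets (\<nu> x)"
      using A unfolding sets supported_in_def by (metis borel_comp Compl_eq_Diff_UNIV)
    then have "AE X in \<nu> x. X \<notin> UNIV - A"
      using elim(2) by (intro AE_not_in null_setsI)
    then show ?case
      using elim(1) by simp
  qed
qed

lemma young_average_zero:
  fixes \<Omega> :: "(real^'m::finite) set" and \<nu> :: "real^'m \<Rightarrow> (real^'m^'k::finite) measure"
  assumes \<nu>: "\<nu> \<in> \<Omega> \<rightarrow> space (prob_algebra borel)" and A: "supported_in \<Omega> \<nu> A"
    and w: "young_average \<Omega> \<nu> \<psi> w" and zero: "\<And>X. X \<in> A \<Longrightarrow> \<psi> X = 0"
  shows "AE x in lebesgue_on \<Omega>. w x = 0"
proof -
  have "AE x in lebesgue_on \<Omega>. w x = (LINT X|\<nu> x. \<psi> X)"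
    using w unfolding young_average_def by auto
  with supported_in_AE[OF \<nu> A] show ?thesis
  proof eventually_elim
    case (elim x)
    then have "AE X in \<nu> x. X \<in> A" by blast
    then have "AE X in \<nu> x. \<psi> X = 0"
      by eventually_elim (rule zero)
    then show ?case
      using elim(2) by (simp add: integral_eq_zero_AE)
  qed
qed

text \<open>The place where the exponent 2n is spent: a minor has degree n, so products of two
  minors, and in particular squares, are still admissible integrands. A single minor is covered as
  well, since a power n is at most 1 plus the power 2n.\<close>

lemma minor_power_growth:
  fixes I J :: "'n::finite \<Rightarrow> 'k::finite" and \<sigma> \<tau> :: "'n \<Rightarrow> 'm::finite"
  shows "power_growth (2 * CARD('n)) (minor I \<sigma>)"
    and "power_growth (2 * CARD('n)) (\<lambda>X. minor I \<sigma> X * minor J \<tau> X)"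
proof -
  let ?K = "real (card {p. p permutes (UNIV :: 'n set)})"
  have le: "norm X ^ CARD('n) \<le> 1 + norm X ^ (2 * CARD('n))" for X :: "real^'m^'k"
  proof (cases "norm X \<le> 1")
    case True
    then show ?thesis
      by (intro order_trans[OF power_le_one]) auto
  next
    case False
    then have "norm X ^ CARD('n) \<le> norm X ^ (2 * CARD('n))"
      by (intro power_increasing) auto
    then show ?thesis by simp
  qed
  have "\<bar>minor I \<sigma> X\<bar> \<le> ?K * (1 + norm X ^ (2 * CARD('n)))" for X
    by (rule order_trans[OF abs_minor_le mult_left_mono[OF le]]) simp
  then show "power_growth (2 * CARD('n)) (minor I \<sigma>)"
    unfolding power_growth_def using continuous_minor by blast
  have "\<bar>minor I \<sigma> X * minor J \<tau> X\<bar> \<le> (?K * ?K) * (1 + norm X ^ (2 * CARD('n)))" for X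
  proof -
    have "\<bar>minor I \<sigma> X * minor J \<tau> X\<bar> \<le> (?K * norm X ^ CARD('n)) * (?K * norm X ^ CARD('n))"
      unfolding abs_mult by (intro mult_mono abs_minor_le) auto
    also have "\<dots> = (?K * ?K) * norm X ^ (2 * CARD('n))"
      by (simp add: mult_2 power_add)
    also have "\<dots> \<le> (?K * ?K) * (1 + norm X ^ (2 * CARD('n)))"
      by (intro mult_left_mono) auto
    finally show ?thesis .
  qed
  then show "power_growth (2 * CARD('n)) (\<lambda>X. minor I \<sigma> X * minor J \<tau> X)"
    unfolding power_growth_def using continuous_on_mult[OF continuous_minor continuous_minor] by blast
qed

section \<open>Cutoffs on cubes and the product identity for Young measures\<close>

lemma bump_le_1: "bump x \<le> 1"
proof -
  have "flat_exp 1 t \<ge> 0" "flat_exp 1 t \<le> 1" for t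
    by (auto simp: flat_exp_def)
  then show ?thesis
    unfolding bump_def by (intro mult_le_one) auto
qed

lemma cc_function_minor_compose:
  fixes g :: "real^'m::finite \<Rightarrow> real^'m^'k::finite"
  assumes C1: "\<And>i l. C1_gradient (\<lambda>x. g x $ i $ l) (g' i l)" and cc: "\<And>i l. cc_function (\<lambda>x. g x $ i $ l)"
  shows "cc_function (\<lambda>x. minor I \<sigma> (g x))"
proof -
  have "\<exists>B. \<forall>x. norm x > B \<longrightarrow> g x $ i $ l = 0" for i l
    using cc[of i l] unfolding cc_function_def by blast
  then obtain B where B: "\<And>i l x. norm x > B i l \<Longrightarrow> g x $ i $ l = 0"
    by metis
  define B0 where "B0 = Max (range (\<lambda>(i, l). B i l))"
  have "B i l \<le> B0" for i l
    unfolding B0_def by (intro Max_ge) (auto intro: range_eqI[of _ _ "(i, l)"])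
  then have "g x $ i $ l = 0" if "norm x > B0" for x i l
    using that B le_less_trans by blast
  then have "g x = 0" if "norm x > B0" for x
    using that by (simp add: vec_eq_iff)
  then have "minor I \<sigma> (g x) = 0" if "norm x > B0" for x
    using that minor_zero by metis
  moreover have "continuous_on UNIV (\<lambda>x. minor I \<sigma> (g x))"
    by (rule C1_gradient_continuous[OF C1_gradient_minor[OF C1]])
  ultimately show ?thesis
    unfolding cc_function_def by blast
qed

definition box_bump :: "real^'m::finite \<Rightarrow> real \<Rightarrow> real^'m \<Rightarrow> real" where
  "box_bump z \<kappa> = coord_prod (\<lambda>i t. bump (1 / \<kappa> * t + (- z $ i / \<kappa>)))"

lemma bump_affine_nonzero_iff: "\<kappa> > 0 \<Longrightarrow> bump (1 / \<kappa> * t + (- s / \<kappa>)) \<noteq> 0 \<longleftrightarrow> \<bar>t - s\<bar> < \<kappa>"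
  by (simp add: bump_nonzero_iff flip: diff_divide_distrib)

lemma box_bump_nonzero_iff: "\<kappa> > 0 \<Longrightarrow> box_bump z \<kappa> x \<noteq> 0 \<longleftrightarrow> (\<forall>i. \<bar>x $ i - z $ i\<bar> < \<kappa>)"
  unfolding box_bump_def coord_prod_nonzero_iff by (simp only: bump_affine_nonzero_iff)

lemma C1_gradient_box_bump: "\<exists>\<beta>'. C1_gradient (box_bump z \<kappa>) \<beta>'"
  unfolding box_bump_def by (rule exI, rule C1_gradient_coord_prod, rule Ck_real_affine[OF Ck_real_bump])

lemma cc_function_box_bump:
  assumes "\<kappa> > 0"
  shows "cc_function (box_bump z \<kappa> :: real^'m::finite \<Rightarrow> real)"
proof -
  have "box_bump z \<kappa> x = 0" if "norm x > norm z + CARD('m) * \<kappa>" for x :: "real^'m"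
  proof (rule ccontr)
    assume "box_bump z \<kappa> x \<noteq> 0"
    then have "norm (x - z) < CARD('m) * \<kappa>"
      using box_bump_nonzero_iff[OF assms] by (intro norm_less_of_components) auto
    then show False
      using that norm_triangle_ineq[of z "x - z"] by simp
  qed
  moreover have "continuous_on UNIV (box_bump z \<kappa>)"
    using C1_gradient_box_bump C1_gradient_continuous by blast
  ultimately show ?thesis
    unfolding cc_function_def by blast
qed

lemma box_bump_nonneg: "box_bump z \<kappa> x \<ge> 0"
  by (simp add: box_bump_def coord_prod_def prod_nonneg bump_nonneg)

lemma box_bump_le_1: "box_bump z \<kappa> x \<le> 1"
  unfolding box_bump_def coord_prod_def by (intro prod_le_1) (auto simp: bump_nonneg bump_le_1)

text \<open>The generating sequence is replaced by smooth fields, so that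
  \<open>product_weak_continuity\<close> applies, and the resulting limit is read off from the Young
  measure. The averages of the squared minors give the L^2 bounds; mixed minors vanish on
  \<open>A\<close>, so their squares have average 0. The row choices \<open>I\<close> and
  \<open>J\<close> are independent of each other, which allows factors from the same or from
  different rows.\<close>

lemma young_measure_product:
  fixes \<Omega> :: "(real^'m::finite) set" and \<nu> :: "real^'m \<Rightarrow> (real^'m^'k::finite) measure"
    and I J :: "'n::finite \<Rightarrow> 'k" and \<sigma> \<tau> :: "'n \<Rightarrow> 'm"
  assumes \<Omega>: "bounded \<Omega>" "open \<Omega>" and \<nu>: "gradient_young_measure (real (2 * CARD('n))) \<Omega> \<nu>"
    and \<sigma>: "inj \<sigma>" and \<tau>: "inj \<tau>" and range: "range \<tau> = - range \<sigma>"
    and A: "supported_in \<Omega> \<nu> A"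
    and mixI: "\<And>X l k. X \<in> A \<Longrightarrow> l \<in> range \<sigma> \<Longrightarrow> k \<in> range \<tau> \<Longrightarrow> minor I (\<lambda>b. if \<sigma> b = l then k else \<sigma> b) X = 0"
    and mixJ: "\<And>X l k. X \<in> A \<Longrightarrow> l \<in> range \<sigma> \<Longrightarrow> k \<in> range \<tau> \<Longrightarrow> minor J (\<lambda>b. if \<tau> b = k then l else \<tau> b) X = 0"
    and \<kappa>: "\<kappa> > 0" and cube: "\<And>y. (\<And>c. \<bar>y $ c - z $ c\<bar> \<le> 2 * \<kappa>) \<Longrightarrow> y \<in> \<Omega>"
    and a: "young_average \<Omega> \<nu> (minor I \<sigma>) a" and b: "young_average \<Omega> \<nu> (minor J \<tau>) b"
    and ab: "young_average \<Omega> \<nu> (\<lambda>X. minor I \<sigma> X * minor J \<tau> X) ab"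
  defines "\<Phi> \<equiv> \<lambda>x. (box_bump z \<kappa> x)\<^sup>2"
  shows "(LINT x|lborel. \<Phi> x) * (LINT x|lebesgue_on \<Omega>. ab x * \<Phi> x)
    = (LINT x|lebesgue_on \<Omega>. a x * \<Phi> x) * (LINT x|lebesgue_on \<Omega>. b x * \<Phi> x)"
proof -
  define p where "p = 2 * CARD('n)"
  have p: "p > 0" by (simp add: p_def)
  obtain f :: "nat \<Rightarrow> real^'m \<Rightarrow> real^'k" and G where
    sob: "\<And>j. sobolev_with_gradient (real p) \<Omega> (f j) (G j)" and
    ym: "\<And>\<psi> :: real^'m^'k \<Rightarrow> real. continuous_on UNIV \<psi> \<Longrightarrow> \<exists>C>0. \<forall>X. \<bar>\<psi> X\<bar> \<le> C * (1 + norm X powr real p) \<Longrightarrow>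
      \<exists>\<psi>'. (AE x in lebesgue_on \<Omega>. integrable (\<nu> x) \<psi> \<and> \<psi>' x = (LINT X|\<nu> x. \<psi> X)) \<and> weakly_L1 \<Omega> (\<lambda>j x. \<psi> (G j x)) \<psi>'"
    and \<nu>_prob: "\<nu> \<in> \<Omega> \<rightarrow> space (prob_algebra borel)"
    using \<nu> unfolding gradient_young_measure_def p_def[symmetric] by blast
  \<comment> \<open>The definition supplies some limit function for each integrand. It agrees almost
    everywhere with the prescribed average, which may therefore take its place under the
    integral.\<close>
  have young_lim: "(\<lambda>j. LINT x|lebesgue_on \<Omega>. \<psi> (G j x) * h x) \<longlonglongrightarrow> (LINT x|lebesgue_on \<Omega>. w x * h x)"
    if \<psi>: "power_growth p \<psi>" and w: "young_average \<Omega> \<nu> \<psi> w" and h: "continuous_on UNIV h" "\<And>x. \<bar>h x\<bar> \<le> 1" for \<psi> w h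
  proof -
    have hm: "h \<in> borel_measurable (lebesgue_on \<Omega>)"
      by (intro measurable_restrict_space1 measurable_completion) (simp add: borel_measurable_continuous_onI[OF h(1)])
    have hinf: "h \<in> L_infinity \<Omega>"
      unfolding L_infinity_def using hm h(2) by auto
    have "continuous_on UNIV \<psi>" "\<exists>C>0. \<forall>X. \<bar>\<psi> X\<bar> \<le> C * (1 + norm X powr real p)"
      using \<psi> power_growth_positive_constant[of \<psi> _ p] p unfolding power_growth_def by auto
    from ym[OF this] obtain \<psi>' where \<psi>': "AE x in lebesgue_on \<Omega>. integrable (\<nu> x) \<psi> \<and> \<psi>' x = (LINT X|\<nu> x. \<psi> X)"
      "weakly_L1 \<Omega> (\<lambda>j x. \<psi> (G j x)) \<psi>'"
      by blast
    have avg: "young_average \<Omega> \<nu> \<psi> \<psi>'"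
      using \<psi>' unfolding young_average_def weakly_L1_def by blast
    have "(LINT x|lebesgue_on \<Omega>. \<psi>' x * h x) = (LINT x|lebesgue_on \<Omega>. w x * h x)"
    proof (rule integral_cong_AE)
      show "(\<lambda>x. \<psi>' x * h x) \<in> borel_measurable (lebesgue_on \<Omega>)" "(\<lambda>x. w x * h x) \<in> borel_measurable (lebesgue_on \<Omega>)"
        using avg w hm unfolding young_average_def by (auto intro: borel_measurable_times)
      show "AE x in lebesgue_on \<Omega>. \<psi>' x * h x = w x * h x"
        using young_average_unique[OF avg w] by eventually_elim simp
    qed
    moreover have "(\<lambda>j. LINT x|lebesgue_on \<Omega>. \<psi> (G j x) * h x) \<longlonglongrightarrow> (LINT x|lebesgue_on \<Omega>. \<psi>' x * h x)"
      using \<psi>'(2) hinf unfolding weakly_L1_def by blast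
    ultimately show ?thesis by simp
  qed
  define mI where "mI l k = minor I (\<lambda>b. if \<sigma> b = l then k else \<sigma> b)" for l k
  define mJ where "mJ k l = minor J (\<lambda>b. if \<tau> b = k then l else \<tau> b)" for k l
  \<comment> \<open>All integrands that the argument tests: the two minors and their product for the
    identity itself, the squares for L^2 bounds, and the squares of all mixed minors for their
    decay. The set is finite, so one smooth field per index j approximates all of them.\<close>
  define S where "S = {minor I \<sigma>, minor J \<tau>, \<lambda>X. minor I \<sigma> X * minor J \<tau> X, \<lambda>X. minor I \<sigma> X * minor I \<sigma> X, \<lambda>X. minor J \<tau> X * minor J \<tau> X}
    \<union> range (\<lambda>(l, k) X. mI l k X * mI l k X) \<union> range (\<lambda>(k, l) X. mJ k l X * mJ k l X)"
  have S_growth: "power_growth p \<psi>" and S_zero: "\<psi> 0 = 0" if "\<psi> \<in> S" for \<psi>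
    using that minor_power_growth unfolding S_def p_def mI_def mJ_def by (auto simp: minor_zero)
  have S_fin: "finite S"
    by (simp add: S_def)
  define app where "app j g g' \<longleftrightarrow> (\<forall>i l. C1_gradient (\<lambda>x. g x $ i $ l) (g' i l) \<and> cc_function (\<lambda>x. g x $ i $ l)) \<and>
    (\<forall>z. (\<forall>y. (\<forall>c. \<bar>y $ c - z $ c\<bar> \<le> \<kappa>) \<longrightarrow> y \<in> \<Omega>) \<longrightarrow> (\<forall>i k l. g' i l z $ k = g' i k z $ l)) \<and>
    (\<forall>\<psi>\<in>S. \<forall>\<Phi>. continuous_on UNIV \<Phi> \<and> (\<forall>x. \<bar>\<Phi> x\<bar> \<le> 1) \<longrightarrow>
      \<bar>(LINT x|lborel. \<Phi> x * \<psi> (g x)) - (LINT x|lebesgue_on \<Omega>. \<psi> (G j x) * \<Phi> x)\<bar> \<le> 1 / real (Suc j))"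
    for j :: nat and g :: "real^'m \<Rightarrow> real^'m^'k" and g' :: "'k \<Rightarrow> 'm \<Rightarrow> real^'m \<Rightarrow> real^'m"
  have "\<exists>g g'. app j g g'" for j
    unfolding app_def
    by (rule smooth_gradient_approx[OF \<Omega> sob p \<kappa> S_fin]) (use S_growth S_zero in \<open>auto simp: power_growth_def\<close>)
  then obtain g g' where app: "\<And>j. app j (g j) (g' j)"
    by metis
  have C1: "\<And>j i l. C1_gradient (\<lambda>x. g j x $ i $ l) (g' j i l)" and cc: "\<And>j i l. cc_function (\<lambda>x. g j x $ i $ l)"
    using app unfolding app_def by blast+
  \<comment> \<open>The cutoff lives in the cube of half side \<kappa> and the mollification reaches
    a further \<kappa>; together they account for the 2 * \<kappa> in \<open>cube\<close>.\<close>
  have sym: "g' j i l y $ k = g' j i k y $ l" if "box_bump z \<kappa> y \<noteq> 0" for j y i k l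
  proof -
    have "x \<in> \<Omega>" if x: "\<forall>c. \<bar>x $ c - y $ c\<bar> \<le> \<kappa>" for x
    proof (rule cube)
      fix c
      have "\<bar>y $ c - z $ c\<bar> < \<kappa>"
        using \<open>box_bump z \<kappa> y \<noteq> 0\<close> box_bump_nonzero_iff[OF \<kappa>] by blast
      then show "\<bar>x $ c - z $ c\<bar> \<le> 2 * \<kappa>"
        using x[rule_format, of c] by linarith
    qed
    then show ?thesis
      using app[of j] unfolding app_def by blast
  qed
  have lim: "(\<lambda>j. LINT x|lborel. h x * \<psi> (g j x)) \<longlonglongrightarrow> (LINT x|lebesgue_on \<Omega>. w x * h x)"
    if \<psi>: "\<psi> \<in> S" and w: "young_average \<Omega> \<nu> \<psi> w" and h: "continuous_on UNIV h" "\<And>x. \<bar>h x\<bar> \<le> 1" for \<psi> w h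
  proof -
    have "(\<lambda>j. (LINT x|lborel. h x * \<psi> (g j x)) - (LINT x|lebesgue_on \<Omega>. \<psi> (G j x) * h x)) \<longlonglongrightarrow> 0"
    proof (rule Lim_null_comparison)
      show "\<forall>\<^sub>F j in sequentially. norm ((LINT x|lborel. h x * \<psi> (g j x)) - (LINT x|lebesgue_on \<Omega>. \<psi> (G j x) * h x)) \<le> 1 / real (Suc j)"
        using app \<psi> h unfolding app_def by (intro always_eventually allI) auto
      show "(\<lambda>j. 1 / real (Suc j)) \<longlonglongrightarrow> 0"
        by (rule LIMSEQ_Suc[OF lim_1_over_n])
    qed
    from tendsto_add[OF this young_lim[OF S_growth[OF \<psi>] w h]] show ?thesis
      by simp
  qed
  have minor_cc: "cc_function (\<lambda>x. minor I' \<sigma>' (g j x))" for I' :: "'n \<Rightarrow> 'k" and \<sigma>' :: "'n \<Rightarrow> 'm" and j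
    by (rule cc_function_minor_compose[OF C1 cc])
  have norm_sq: "(norm (Abs_cc (\<lambda>x. minor I' \<sigma>' (g j x))))\<^sup>2 = (LINT x|lborel. 1 * (minor I' \<sigma>' (g j x) * minor I' \<sigma>' (g j x)))"
    for I' :: "'n \<Rightarrow> 'k" and \<sigma>' :: "'n \<Rightarrow> 'm" and j
    using minor_cc by (simp add: power2_norm_eq_inner inner_Abs_cc)
  have one: "continuous_on UNIV (\<lambda>x::real^'m. 1::real)" "\<And>x::real^'m. \<bar>1::real\<bar> \<le> 1"
    by auto
  have bounded: "\<exists>C. \<forall>j. norm (Abs_cc (\<lambda>x. minor I' \<sigma>' (g j x))) \<le> C"
    if inS: "(\<lambda>X. minor I' \<sigma>' X * minor I' \<sigma>' X) \<in> S" for I' :: "'n \<Rightarrow> 'k" and \<sigma>' :: "'n \<Rightarrow> 'm"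
  proof -
    obtain w where "young_average \<Omega> \<nu> (\<lambda>X. minor I' \<sigma>' X * minor I' \<sigma>' X) w"
      using young_average_exists[OF \<nu>[folded p_def] S_growth[OF inS] p] by blast
    from lim[OF inS this one] have "Bseq (\<lambda>j. (norm (Abs_cc (\<lambda>x. minor I' \<sigma>' (g j x))))\<^sup>2)"
      unfolding norm_sq by (intro convergent_imp_Bseq convergentI)
    then obtain C where "\<And>j. norm ((norm (Abs_cc (\<lambda>x. minor I' \<sigma>' (g j x))))\<^sup>2) \<le> C"
      unfolding Bseq_def by blast
    then have "norm (Abs_cc (\<lambda>x. minor I' \<sigma>' (g j x))) \<le> sqrt C" for j
      by (intro real_le_rsqrt) simp
    then show ?thesis by blast
  qed
  \<comment> \<open>The averaged square is 0 almost everywhere, and the constant 1 is an admissible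
    weight, so the weak L^1 convergence of the squares gives convergence to 0 in norm.\<close>
  have vanish: "(\<lambda>j. norm (Abs_cc (\<lambda>x. minor I' \<sigma>' (g j x)))) \<longlonglongrightarrow> 0"
    if S: "(\<lambda>X. minor I' \<sigma>' X * minor I' \<sigma>' X) \<in> S" and zero: "\<And>X. X \<in> A \<Longrightarrow> minor I' \<sigma>' X = 0"
    for I' :: "'n \<Rightarrow> 'k" and \<sigma>' :: "'n \<Rightarrow> 'm"
  proof -
    obtain w where w: "young_average \<Omega> \<nu> (\<lambda>X. minor I' \<sigma>' X * minor I' \<sigma>' X) w"
      using young_average_exists[OF \<nu>[folded p_def] S_growth[OF S] p] by blast
    have "AE x in lebesgue_on \<Omega>. w x = 0"
      by (rule young_average_zero[OF \<nu>_prob A w]) (simp add: zero)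
    then have "AE x in lebesgue_on \<Omega>. w x * 1 = 0"
      by simp
    then have "(LINT x|lebesgue_on \<Omega>. w x * 1) = 0"
      by (rule integral_eq_zero_AE)
    then have "(\<lambda>j. (norm (Abs_cc (\<lambda>x. minor I' \<sigma>' (g j x))))\<^sup>2) \<longlonglongrightarrow> 0"
      unfolding norm_sq using lim[OF S w one] by simp
    then have "(\<lambda>j. sqrt ((norm (Abs_cc (\<lambda>x. minor I' \<sigma>' (g j x))))\<^sup>2)) \<longlonglongrightarrow> sqrt 0"
      by (rule tendsto_real_sqrt)
    then show ?thesis by simp
  qed
  obtain C1 where CI: "\<And>j. norm (Abs_cc (\<lambda>x. minor I \<sigma> (g j x))) \<le> C1"
    using bounded[of I \<sigma>] by (auto simp: S_def)
  obtain C2 where CJ: "\<And>j. norm (Abs_cc (\<lambda>x. minor J \<tau> (g j x))) \<le> C2"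
    using bounded[of J \<tau>] by (auto simp: S_def)
  obtain \<beta>' where \<beta>': "C1_gradient (box_bump z \<kappa>) \<beta>'"
    using C1_gradient_box_bump by blast
  have PLlim: "(\<lambda>j. (LINT x|lborel. (box_bump z \<kappa> x)\<^sup>2) * (LINT x|lborel. (box_bump z \<kappa> x)\<^sup>2 * (minor I \<sigma> (g j x) * minor J \<tau> (g j x)))
      - (LINT x|lborel. (box_bump z \<kappa> x)\<^sup>2 * minor I \<sigma> (g j x)) * (LINT x|lborel. (box_bump z \<kappa> x)\<^sup>2 * minor J \<tau> (g j x))) \<longlonglongrightarrow> 0"
  proof (rule product_weak_continuity[where X="range \<sigma>" and Y="range \<tau>"
        and u="\<lambda>j x. minor I \<sigma> (g j x)" and u'="\<lambda>j. minor_gradient I \<sigma> (g j) (g' j)"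
        and v="\<lambda>j x. minor J \<tau> (g j x)" and v'="\<lambda>j. minor_gradient J \<tau> (g j) (g' j)"
        and m="\<lambda>j l k x. mI l k (g j x)" and m'="\<lambda>j l k. minor_gradient I (\<lambda>b. if \<sigma> b = l then k else \<sigma> b) (g j) (g' j)"
        and n="\<lambda>j k l x. mJ k l (g j x)" and n'="\<lambda>j k l. minor_gradient J (\<lambda>b. if \<tau> b = k then l else \<tau> b) (g j) (g' j)"
        and b="\<lambda>i t. bump (1 / \<kappa> * t + (- z $ i / \<kappa>))" and C="max C1 C2", OF range])
    show "range \<sigma> \<noteq> {}" "range \<tau> \<noteq> {}" by auto
    show "C1_gradient (\<lambda>x. minor I \<sigma> (g j x)) (minor_gradient I \<sigma> (g j) (g' j))"
      "C1_gradient (\<lambda>x. minor J \<tau> (g j x)) (minor_gradient J \<tau> (g j) (g' j))"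
      "C1_gradient (\<lambda>x. mI l k (g j x)) (minor_gradient I (\<lambda>b. if \<sigma> b = l then k else \<sigma> b) (g j) (g' j))"
      "C1_gradient (\<lambda>x. mJ k l (g j x)) (minor_gradient J (\<lambda>b. if \<tau> b = k then l else \<tau> b) (g j) (g' j))" for j l k
      unfolding mI_def mJ_def by (intro C1_gradient_minor C1)+
    show "cc_function (\<lambda>x. minor I \<sigma> (g j x))" "cc_function (\<lambda>x. minor J \<tau> (g j x))"
      "cc_function (\<lambda>x. mI l k (g j x))" "cc_function (\<lambda>x. mJ k l (g j x))" for j l k
      unfolding mI_def mJ_def by (rule minor_cc)+
    show "C1_gradient (box_bump z \<kappa>) \<beta>'" by (rule \<beta>')
    show "cc_function (box_bump z \<kappa>)" by (rule cc_function_box_bump[OF \<kappa>])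
    show "box_bump z \<kappa> x = (\<Prod>i\<in>UNIV. bump (1 / \<kappa> * x $ i + - z $ i / \<kappa>))" for x
      by (simp add: box_bump_def coord_prod_def)
    show "bump (1 / \<kappa> * (s + r * (t - s)) + - z $ i / \<kappa>) \<noteq> 0"
      if "bump (1 / \<kappa> * s + - z $ i / \<kappa>) \<noteq> 0" "bump (1 / \<kappa> * t + - z $ i / \<kappa>) \<noteq> 0" "0 \<le> r" "r \<le> 1" for i s t r
    proof -
      have st: "\<bar>s - z $ i\<bar> < \<kappa>" "\<bar>t - z $ i\<bar> < \<kappa>"
        using that(1,2) by (simp_all only: bump_affine_nonzero_iff[OF \<kappa>])
      have "s + r * (t - s) - z $ i = (1 - r) * (s - z $ i) + r * (t - z $ i)"
        by (simp add: algebra_simps)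
      also have "\<bar>\<dots>\<bar> \<le> (1 - r) * \<bar>s - z $ i\<bar> + r * \<bar>t - z $ i\<bar>"
        using that(3,4) by (intro order_trans[OF abs_triangle_ineq]) (simp add: abs_mult)
      also have "\<dots> < \<kappa>"
        using convex_bound_lt[OF st, of "1 - r" r] that(3,4) by simp
      finally show ?thesis
        by (simp only: bump_affine_nonzero_iff[OF \<kappa>] not_False_eq_True)
    qed
    show "minor_gradient I \<sigma> (g j) (g' j) x $ k = (\<Sum>l\<in>range \<sigma>. minor_gradient I (\<lambda>b. if \<sigma> b = l then k else \<sigma> b) (g j) (g' j) x $ l)"
      if "box_bump z \<kappa> x \<noteq> 0" for j x k
      using sym[OF that] by (intro minor_divergence \<sigma>)
    show "minor_gradient J \<tau> (g j) (g' j) x $ l = (\<Sum>k\<in>range \<tau>. minor_gradient J (\<lambda>b. if \<tau> b = k then l else \<tau> b) (g j) (g' j) x $ k)"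
      if "box_bump z \<kappa> x \<noteq> 0" for j x l
      using sym[OF that] by (intro minor_divergence \<tau>)
    show "norm (Abs_cc (\<lambda>x. minor I \<sigma> (g j x))) \<le> max C1 C2" "norm (Abs_cc (\<lambda>x. minor J \<tau> (g j x))) \<le> max C1 C2" for j
      using CI[of j] CJ[of j] by auto
    show "(\<lambda>j. norm (Abs_cc (\<lambda>x. mI l k (g j x)))) \<longlonglongrightarrow> 0" if "l \<in> range \<sigma>" "k \<in> range \<tau>" for l k
      unfolding mI_def
    proof (rule vanish)
      show "(\<lambda>X. minor I (\<lambda>b. if \<sigma> b = l then k else \<sigma> b) X * minor I (\<lambda>b. if \<sigma> b = l then k else \<sigma> b) X) \<in> S"
        unfolding S_def mI_def by (intro UnI1 UnI2 range_eqI[of _ _ "(l, k)"]) simp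
    qed (use mixI that in auto)
    show "(\<lambda>j. norm (Abs_cc (\<lambda>x. mJ k l (g j x)))) \<longlonglongrightarrow> 0" if "k \<in> range \<tau>" "l \<in> range \<sigma>" for l k
      unfolding mJ_def
    proof (rule vanish)
      show "(\<lambda>X. minor J (\<lambda>b. if \<tau> b = k then l else \<tau> b) X * minor J (\<lambda>b. if \<tau> b = k then l else \<tau> b) X) \<in> S"
        unfolding S_def mJ_def by (intro UnI2 range_eqI[of _ _ "(k, l)"]) simp
    qed (use mixJ that in auto)
  qed
  have \<Phi>_cont: "continuous_on UNIV \<Phi>"
    unfolding \<Phi>_def by (intro continuous_on_power cc_function_continuous cc_function_box_bump \<kappa>)
  have \<Phi>_le: "\<bar>\<Phi> x\<bar> \<le> 1" for x
    unfolding \<Phi>_def using box_bump_nonneg[of z \<kappa> x] box_bump_le_1[of z \<kappa> x] by (simp add: power_le_one)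
  have la: "(\<lambda>j. LINT x|lborel. \<Phi> x * minor I \<sigma> (g j x)) \<longlonglongrightarrow> (LINT x|lebesgue_on \<Omega>. a x * \<Phi> x)"
    by (rule lim[OF _ a \<Phi>_cont \<Phi>_le]) (simp add: S_def)
  have lb: "(\<lambda>j. LINT x|lborel. \<Phi> x * minor J \<tau> (g j x)) \<longlonglongrightarrow> (LINT x|lebesgue_on \<Omega>. b x * \<Phi> x)"
    by (rule lim[OF _ b \<Phi>_cont \<Phi>_le]) (simp add: S_def)
  have lab: "(\<lambda>j. LINT x|lborel. \<Phi> x * (minor I \<sigma> (g j x) * minor J \<tau> (g j x))) \<longlonglongrightarrow> (LINT x|lebesgue_on \<Omega>. ab x * \<Phi> x)"
    by (rule lim[OF _ ab \<Phi>_cont \<Phi>_le]) (simp add: S_def)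
  have "(\<lambda>j. (LINT x|lborel. \<Phi> x) * (LINT x|lborel. \<Phi> x * (minor I \<sigma> (g j x) * minor J \<tau> (g j x)))
      - (LINT x|lborel. \<Phi> x * minor I \<sigma> (g j x)) * (LINT x|lborel. \<Phi> x * minor J \<tau> (g j x)))
    \<longlonglongrightarrow> (LINT x|lborel. \<Phi> x) * (LINT x|lebesgue_on \<Omega>. ab x * \<Phi> x)
      - (LINT x|lebesgue_on \<Omega>. a x * \<Phi> x) * (LINT x|lebesgue_on \<Omega>. b x * \<Phi> x)"
    by (intro tendsto_diff tendsto_mult tendsto_const la lb lab)
  from LIMSEQ_unique[OF this[unfolded \<Phi>_def] PLlim] show ?thesis
    by (simp add: \<Phi>_def)
qed

section \<open>Block matrices\<close>

lemma sum_UNIV_Plus: "(\<Sum>i\<in>(UNIV :: ('a::finite + 'b::finite) set). f i) = (\<Sum>a\<in>UNIV. f (Inl a)) + (\<Sum>b\<in>UNIV. f (Inr b))"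
  by (simp add: UNIV_Plus_UNIV[symmetric] sum.Plus del: UNIV_Plus_UNIV)

lemma prod_UNIV_Plus: "(\<Prod>i\<in>(UNIV :: ('a::finite + 'b::finite) set). f i) = (\<Prod>a\<in>UNIV. f (Inl a)) * (\<Prod>b\<in>UNIV. f (Inr b))"
  by (simp add: UNIV_Plus_UNIV[symmetric] prod.Plus del: UNIV_Plus_UNIV)

lemma block_matrix_nth [simp]:
  "block_matrix A B C D $ Inl a $ Inl b = A $ a $ b" "block_matrix A B C D $ Inl a $ Inr b = B $ a $ b"
  "block_matrix A B C D $ Inr a $ Inl b = C $ a $ b" "block_matrix A B C D $ Inr a $ Inr b = D $ a $ b"
  by (simp_all add: block_matrix_def)

lemma matrix_eq_blocks:
  fixes X Y :: "real^('n::finite + 'n)^('n + 'n)"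
  assumes "\<And>a b. X $ Inl a $ Inl b = Y $ Inl a $ Inl b" "\<And>a b. X $ Inl a $ Inr b = Y $ Inl a $ Inr b"
    "\<And>a b. X $ Inr a $ Inl b = Y $ Inr a $ Inl b" "\<And>a b. X $ Inr a $ Inr b = Y $ Inr a $ Inr b"
  shows "X = Y"
proof -
  have "X $ i $ j = Y $ i $ j" for i j
    using assms by (cases i; cases j) simp_all
  then show ?thesis
    by (simp add: vec_eq_iff)
qed

lemma block_matrix_mult:
  "block_matrix A B C D ** block_matrix A' B' C' D'
    = block_matrix (A ** A' + B ** C') (A ** B' + B ** D') (C ** A' + D ** C') (C ** B' + D ** D')"
  by (rule matrix_eq_blocks) (simp_all add: matrix_matrix_mult_def sum_UNIV_Plus)

lemma mat_1_block: "mat 1 = block_matrix (mat 1) 0 0 (mat 1)"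
  by (rule matrix_eq_blocks) (simp_all add: mat_def)

lemma det_elementary_add:
  fixes m n :: "'n::finite" and c :: real
  assumes "m \<noteq> n"
  shows "det (\<chi> i j. if i = m \<and> j = n then c else of_bool (i = j)) = 1"
proof -
  have "(\<chi> i j. if i = m \<and> j = n then c else of_bool (i = j))
      = (\<chi> k. if k = m then row m (mat 1) + c *s row n (mat 1) else row k (mat 1 :: real^'n^'n))"
    using assms by (auto simp: vec_eq_iff row_def mat_def)
  then show ?thesis
    using det_row_operation[OF assms, of "mat 1" c] by simp
qed

lemma det_elementary_swap:
  fixes m n :: "'n::finite"
  assumes "m \<noteq> n"
  shows "det (\<chi> i j. (mat 1 :: real^'n^'n) $ i $ Transposition.transpose m n j) = - 1"
  using det_permute_columns[OF permutes_swap_id[of m UNIV n], of "mat 1 :: real^'n^'n"] assms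
  by (simp add: sign_swap_id)

text \<open>Bordering by an identity block is multiplicative and preserves each type of matrix in
  the induction: zero row, diagonal, transposition, elementary addition. In each case the
  determinant is read off directly.\<close>

lemma det_block_matrix_upper:
  fixes A :: "real^'n::finite^'n"
  shows "det (block_matrix A 0 0 (mat 1)) = det A"
proof (induction A rule: induct_matrix_elementary)
  case (1 A B)
  have "block_matrix (A ** B) 0 0 (mat 1) = block_matrix A 0 0 (mat 1) ** block_matrix B 0 0 (mat 1)"
    by (simp add: block_matrix_mult)
  then show ?case
    using 1 by (simp add: det_mul)
next
  case (2 A i)
  have "row (Inl i) (block_matrix A 0 0 (mat 1)) $ j = 0" for j
    using 2 by (cases j) (auto simp: row_def vec_eq_iff)
  then have "row (Inl i) (block_matrix A 0 0 (mat 1)) = 0"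
    by (simp add: vec_eq_iff)
  then show ?case
    using det_zero_row(2)[OF 2] det_zero_row(2) by metis
next
  case (3 A)
  have "block_matrix A 0 0 (mat 1) $ i $ j = 0" if "i \<noteq> j" for i j
    using that 3 by (cases i; cases j) (auto simp: mat_def)
  then show ?case
    using 3 by (simp add: det_diagonal prod_UNIV_Plus) (simp add: mat_def)
next
  case (4 m n)
  have "block_matrix (\<chi> i j. mat 1 $ i $ Transposition.transpose m n j) 0 0 (mat 1)
      = (\<chi> i j. (mat 1 :: real^('n + 'n)^('n + 'n)) $ i $ Transposition.transpose (Inl m) (Inl n) j)"
    by (rule matrix_eq_blocks) (auto simp: mat_def Transposition.transpose_def)
  then show ?case
    using det_elementary_swap[OF 4] det_elementary_swap[of "Inl m" "Inl n :: 'n + 'n"] 4 by simp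
next
  case (5 m n c)
  have "block_matrix (\<chi> i j. if i = m \<and> j = n then c else of_bool (i = j)) 0 0 (mat 1)
      = (\<chi> i j. if i = (Inl m :: 'n + 'n) \<and> j = Inl n then c else of_bool (i = j))"
    by (rule matrix_eq_blocks) (auto simp: mat_def)
  then show ?case
    using det_elementary_add[OF 5, of c] det_elementary_add[of "Inl m" "Inl n :: 'n + 'n" c] 5 by simp
qed

text \<open>Conjugation with it moves the lower diagonal block to the upper place. Its determinant
  is (-1)^n, but that value is never computed: the square is 1, and in antidiagonal blocks the
  determinant is carried along as a sign.\<close>

definition block_swap :: "real^('n::finite + 'n)^('n + 'n)" where
  "block_swap = block_matrix 0 (mat 1) (mat 1) 0"

lemma det_block_swap: "det (block_swap :: real^('n::finite + 'n)^('n + 'n)) * det (block_swap :: real^('n + 'n)^('n + 'n)) = 1"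
proof -
  have "block_swap ** block_swap = (mat 1 :: real^('n + 'n)^('n + 'n))"
    by (simp add: block_swap_def block_matrix_mult mat_1_block)
  then show ?thesis
    by (metis det_I det_mul)
qed

lemma det_block_diagonal: "det (block_matrix A 0 0 D) = det A * det D"
proof -
  have "block_matrix A 0 0 D = block_matrix A 0 0 (mat 1) ** (block_swap ** (block_matrix D 0 0 (mat 1) ** block_swap))"
    by (simp add: block_swap_def block_matrix_mult)
  then have "det (block_matrix A 0 0 D) = det A * (det D * (det (block_swap :: real^('a + 'a)^('a + 'a)) * det (block_swap :: real^('a + 'a)^('a + 'a))))"
    by (simp add: det_mul det_block_matrix_upper)
  then show ?thesis
    by (simp add: det_block_swap)
qed

lemma det_block_antidiagonal:
  fixes B C :: "real^'n::finite^'n"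
  shows "det (block_matrix 0 B C 0) = det (block_swap :: real^('n + 'n)^('n + 'n)) * (det B * det C)"
proof -
  have "block_matrix 0 B C 0 = block_swap ** block_matrix C 0 0 B"
    by (simp add: block_swap_def block_matrix_mult)
  then have "det (block_matrix 0 B C 0) = det (block_swap :: real^('n + 'n)^('n + 'n)) * (det C * det B)"
    by (simp add: det_mul det_block_diagonal)
  then show ?thesis
    by (simp only: mult.commute[of "det B"])
qed

section \<open>Minors of block matrices and their vanishing on \<open>L\<close>\<close>

lemma minor_zero_row:
  assumes "\<And>a. X $ I a $ \<sigma> b = 0"
  shows "minor I \<sigma> X = 0"
proof -
  have "row b (\<chi> b a. X $ I a $ \<sigma> b) = 0"
    using assms by (simp add: row_def vec_eq_iff)
  then show ?thesis
    unfolding minor_def by (rule det_zero_row(2))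
qed

lemma minor_block_matrix:
  "minor Inl Inl (block_matrix A B C D) = det A" "minor Inl Inr (block_matrix A B C D) = det B"
  "minor Inr Inl (block_matrix A B C D) = det C" "minor Inr Inr (block_matrix A B C D) = det D"
proof -
  have t: "det (\<chi> b a. M $ a $ b) = det M" for M :: "real^'a^'a"
    using det_transpose[of M] by (simp add: transpose_def)
  show "minor Inl Inl (block_matrix A B C D) = det A" "minor Inl Inr (block_matrix A B C D) = det B"
    "minor Inr Inl (block_matrix A B C D) = det C" "minor Inr Inr (block_matrix A B C D) = det D"
    by (simp_all add: minor_def t)
qed

lemma det_zero_matrix: "det (0 :: real^'n::finite^'n) = 0"
  using det_0[where 'a=real and 'n='n] by (simp add: mat_0)

lemma L_offdiagonal:
  fixes X :: "real^('n::finite + 'n)^('n + 'n)"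
  assumes "X \<in> L" and I: "I = Inl \<or> I = Inr"
  shows "(\<forall>a b. X $ I a $ Inl b = 0) \<or> (\<forall>a b. X $ I a $ Inr b = 0)"
  using assms unfolding L_def L1_def L2_def by auto

text \<open>Within one row group a matrix of \<open>L\<close> is nonzero in at most one of the two
  column groups. A mixed minor has the new column from one group and, because of n \<ge> 2, still a
  column \<open>bl\<close> or \<open>bk\<close> from the other, so it contains a zero column in
  either case.\<close>

lemma mixed_minors_vanish:
  fixes X :: "real^('n::finite + 'n)^('n + 'n)" and I :: "'n \<Rightarrow> 'n + 'n"
  assumes n: "CARD('n) \<ge> 2" and X: "X \<in> L" and I: "I = Inl \<or> I = Inr"
  shows "minor I (\<lambda>b. if Inl b = (Inl l :: 'n + 'n) then Inr k else Inl b) X = 0"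
    and "minor I (\<lambda>b. if Inr b = (Inr k :: 'n + 'n) then Inl l else Inr b) X = 0"
proof -
  have other: "\<exists>b. b \<noteq> c" for c :: 'n
  proof (rule ccontr)
    assume "\<nexists>b. b \<noteq> c"
    then have "(UNIV :: 'n set) = {c}" by auto
    then have "CARD('n) = 1" by (metis card_1_singleton_iff One_nat_def)
    with n show False by simp
  qed
  obtain bl bk where b: "bl \<noteq> l" "bk \<noteq> k"
    using other by metis
  consider "\<forall>a b. X $ I a $ Inl b = 0" | "\<forall>a b. X $ I a $ Inr b = 0"
    using L_offdiagonal[OF X I] by blast
  then show "minor I (\<lambda>b. if Inl b = (Inl l :: 'n + 'n) then Inr k else Inl b) X = 0"
  proof cases
    case 1
    show ?thesis by (rule minor_zero_row[of _ _ _ bl]) (use 1 b in simp)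
  next
    case 2
    show ?thesis by (rule minor_zero_row[of _ _ _ l]) (use 2 in simp)
  qed
  consider "\<forall>a b. X $ I a $ Inl b = 0" | "\<forall>a b. X $ I a $ Inr b = 0"
    using L_offdiagonal[OF X I] by blast
  then show "minor I (\<lambda>b. if Inr b = (Inr k :: 'n + 'n) then Inl l else Inr b) X = 0"
  proof cases
    case 1
    show ?thesis by (rule minor_zero_row[of _ _ _ k]) (use 1 in simp)
  next
    case 2
    show ?thesis by (rule minor_zero_row[of _ _ _ bk]) (use 2 b in simp)
  qed
qed

lemma borel_Sigma_plus: "Sigma_plus \<in> sets (borel :: (real^'m::finite^'m) measure)"
proof -
  have "continuous_on UNIV (\<lambda>X :: real^'m^'m. det X)"
    unfolding det_def by (auto intro!: continuous_intros)
  then have "open (Sigma_plus :: (real^'m^'m) set)"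
    unfolding Sigma_plus_def by (intro open_Collect_less continuous_intros)
  then show ?thesis by simp
qed

lemma block_matrix_self:
  fixes X :: "real^('n::finite + 'n)^('n + 'n)"
  shows "X = block_matrix (\<chi> a b. X $ Inl a $ Inl b) (\<chi> a b. X $ Inl a $ Inr b) (\<chi> a b. X $ Inr a $ Inl b) (\<chi> a b. X $ Inr a $ Inr b)"
  by (rule matrix_eq_blocks) simp_all

lemma L1_eq: "(L1 :: (real^('n::finite + 'n)^('n + 'n)) set) = (\<Inter>a. \<Inter>b. {X. X $ Inl a $ Inr b = 0} \<inter> {X. X $ Inr a $ Inl b = 0})"
proof (intro set_eqI iffI)
  fix X :: "real^('n + 'n)^('n + 'n)"
  assume "X \<in> (\<Inter>a. \<Inter>b. {X. X $ Inl a $ Inr b = 0} \<inter> {X. X $ Inr a $ Inl b = 0})"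
  then have "(\<chi> a b. X $ Inl a $ Inr b) = 0" "(\<chi> a b. X $ Inr a $ Inl b) = 0"
    by (simp_all add: vec_eq_iff)
  then show "X \<in> L1"
    unfolding L1_def using block_matrix_self[of X] by auto
qed (auto simp: L1_def)

lemma L2_eq: "(L2 :: (real^('n::finite + 'n)^('n + 'n)) set) = (\<Inter>a. \<Inter>b. {X. X $ Inl a $ Inl b = 0} \<inter> {X. X $ Inr a $ Inr b = 0})"
proof (intro set_eqI iffI)
  fix X :: "real^('n + 'n)^('n + 'n)"
  assume "X \<in> (\<Inter>a. \<Inter>b. {X. X $ Inl a $ Inl b = 0} \<inter> {X. X $ Inr a $ Inr b = 0})"
  then have "(\<chi> a b. X $ Inl a $ Inl b) = 0" "(\<chi> a b. X $ Inr a $ Inr b) = 0"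
    by (simp_all add: vec_eq_iff)
  then show "X \<in> L2"
    unfolding L2_def using block_matrix_self[of X] by auto
qed (auto simp: L2_def)

lemma borel_L1_L2:
  "(L1 :: (real^('n::finite + 'n)^('n + 'n)) set) \<in> sets borel" "(L2 :: (real^('n::finite + 'n)^('n + 'n)) set) \<in> sets borel"
proof -
  have "closed (L1 :: (real^('n + 'n)^('n + 'n)) set)" "closed (L2 :: (real^('n + 'n)^('n + 'n)) set)"
    unfolding L1_eq L2_eq by (intro closed_INT ballI closed_Int closed_Collect_eq continuous_intros)+
  then show "(L1 :: (real^('n + 'n)^('n + 'n)) set) \<in> sets borel" "(L2 :: (real^('n + 'n)^('n + 'n)) set) \<in> sets borel"
    by auto
qed

text \<open>A vanishing integral of a nonnegative function is used twice: over \<Omega> to make the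
  average vanish almost everywhere on the support of the weight, and then with respect to
  \<open>\<nu> x\<close> to make \<psi> itself vanish almost surely.\<close>

lemma AE_support_of_young_average_zero:
  fixes \<Omega> :: "(real^'m::finite) set" and \<nu> :: "real^'m \<Rightarrow> (real^'m^'k::finite) measure"
  assumes \<nu>: "\<nu> \<in> \<Omega> \<rightarrow> space (prob_algebra borel)" and A: "supported_in \<Omega> \<nu> A" and B: "B \<in> sets borel"
    and \<psi>_nonneg: "\<And>X. X \<in> A \<Longrightarrow> \<psi> X \<ge> 0" and \<psi>_zero: "\<And>X. X \<in> A \<Longrightarrow> \<psi> X = 0 \<Longrightarrow> X \<in> B"
    and w: "young_average \<Omega> \<nu> \<psi> w" and \<Phi>: "continuous_on UNIV \<Phi>" "\<And>x. 0 \<le> \<Phi> x" "\<And>x. \<Phi> x \<le> 1"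
    and zero: "(LINT x|lebesgue_on \<Omega>. w x * \<Phi> x) = 0"
  shows "AE x in lebesgue_on \<Omega>. \<Phi> x \<noteq> 0 \<longrightarrow> emeasure (\<nu> x) (UNIV - B) = 0"
proof -
  have supp: "AE x in lebesgue_on \<Omega>. x \<in> \<Omega> \<and> (AE X in \<nu> x. X \<in> A)"
    by (rule supported_in_AE[OF \<nu> A])
  have avg: "AE x in lebesgue_on \<Omega>. integrable (\<nu> x) \<psi> \<and> w x = (LINT X|\<nu> x. \<psi> X)"
    using w unfolding young_average_def by blast
  have w_nonneg: "AE x in lebesgue_on \<Omega>. w x \<ge> 0"
    using supp avg
  proof eventually_elim
    case (elim x)
    then have "AE X in \<nu> x. X \<in> A" by blast
    then have "AE X in \<nu> x. \<psi> X \<ge> 0"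
      by eventually_elim (rule \<psi>_nonneg)
    then show ?case
      using elim(2) by (simp add: integral_nonneg_AE)
  qed
  have w_int: "integrable (lebesgue_on \<Omega>) w"
    using w unfolding young_average_def by blast
  have \<Phi>m: "\<Phi> \<in> borel_measurable (lebesgue_on \<Omega>)"
    by (intro measurable_restrict_space1 measurable_completion) (simp add: borel_measurable_continuous_onI[OF \<Phi>(1)])
  have "integrable (lebesgue_on \<Omega>) (\<lambda>x. w x * \<Phi> x)"
  proof (rule Bochner_Integration.integrable_bound[OF w_int])
    show "(\<lambda>x. w x * \<Phi> x) \<in> borel_measurable (lebesgue_on \<Omega>)"
      using \<Phi>m w_int by (intro borel_measurable_times) auto
    have "\<bar>w x\<bar> * \<bar>\<Phi> x\<bar> \<le> \<bar>w x\<bar> * 1" for x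
      using \<Phi> by (intro mult_left_mono) auto
    then show "AE x in lebesgue_on \<Omega>. norm (w x * \<Phi> x) \<le> norm (w x)"
      by (intro AE_I2) (simp add: abs_mult)
  qed
  moreover have "AE x in lebesgue_on \<Omega>. 0 \<le> w x * \<Phi> x"
    using w_nonneg by eventually_elim (simp add: \<Phi>)
  ultimately have "AE x in lebesgue_on \<Omega>. w x * \<Phi> x = 0"
    using integral_nonneg_eq_0_iff_AE zero by blast
  then show ?thesis
    using supp avg
  proof eventually_elim
    case (elim x)
    show ?case
    proof
      assume "\<Phi> x \<noteq> 0"
      then have "(LINT X|\<nu> x. \<psi> X) = 0"
        using elim by simp
      moreover have AEA: "AE X in \<nu> x. X \<in> A"
        using elim(2) by blast
      then have "AE X in \<nu> x. 0 \<le> \<psi> X"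
        by eventually_elim (rule \<psi>_nonneg)
      ultimately have "AE X in \<nu> x. \<psi> X = 0"
        using integral_nonneg_eq_0_iff_AE[of "\<nu> x" \<psi>] elim(3) by blast
      with AEA have "AE X in \<nu> x. X \<in> B"
        by eventually_elim (rule \<psi>_zero)
      moreover have "sets (\<nu> x) = sets borel"
        using \<nu> elim(2) by (auto simp: space_prob_algebra)
      moreover then have "space (\<nu> x) = UNIV"
        using sets_eq_imp_space_eq by fastforce
      ultimately show "emeasure (\<nu> x) (UNIV - B) = 0"
        using B by (subst (asm) AE_iff_measurable[of "UNIV - B"]) auto
    qed
  qed
qed

section \<open>Local and global separation\<close>

lemma small_cube:
  fixes \<Omega> :: "(real^'m::finite) set"
  assumes "open \<Omega>" "z \<in> \<Omega>"
  shows "\<exists>\<kappa>>0. \<forall>y. (\<forall>c. \<bar>y $ c - z $ c\<bar> \<le> 2 * \<kappa>) \<longrightarrow> y \<in> \<Omega>"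
proof -
  obtain e where e: "e > 0" "ball z e \<subseteq> \<Omega>"
    using assms by (meson open_contains_ball)
  \<comment> \<open>The Euclidean norm is bounded by the sum of the coordinates, each at most 2 *
    \<kappa>, which adds up to e / 2.\<close>
  define \<kappa> where "\<kappa> = e / (4 * CARD('m))"
  have "\<kappa> > 0"
    using e by (simp add: \<kappa>_def)
  moreover have "y \<in> \<Omega>" if y: "\<forall>c. \<bar>y $ c - z $ c\<bar> \<le> 2 * \<kappa>" for y
  proof -
    have "norm (y - z) \<le> (\<Sum>c\<in>UNIV. \<bar>(y - z) $ c\<bar>)"
      by (rule norm_le_l1_cart)
    also have "\<dots> \<le> (\<Sum>c\<in>(UNIV :: 'm set). 2 * \<kappa>)"
      by (intro sum_mono) (use y in simp)
    also have "\<dots> = e / 2"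
      by (simp add: \<kappa>_def)
    also have "\<dots> < e"
      using e by simp
    finally have "y \<in> ball z e"
      by (simp add: dist_norm norm_minus_commute)
    with e show ?thesis by blast
  qed
  ultimately show ?thesis by blast
qed

text \<open>On \<open>L1\<close> the determinant is the product of the diagonal minors, on
  \<open>L2\<close> it is the product of the off-diagonal ones times the sign of
  \<open>block_swap\<close>. Its positivity excludes the vanishing of one product, and zero blocks
  force the vanishing of the other.\<close>

lemma diagonal_minors_cases:
  fixes X :: "real^('n::finite + 'n)^('n + 'n)"
  assumes "X \<in> L \<inter> Sigma_plus"
  shows "X \<in> L1 \<inter> Sigma_plus \<and> 0 < minor Inl Inl X * minor Inr Inr X \<and> minor Inr Inl X * minor Inl Inr X = 0 \<or>
    X \<in> L2 \<inter> Sigma_plus \<and> minor Inl Inl X * minor Inr Inr X = 0 \<and>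
      0 < det (block_swap :: real^('n + 'n)^('n + 'n)) * (minor Inr Inl X * minor Inl Inr X)"
proof -
  have pos: "det X > 0" and "X \<in> L1 \<or> X \<in> L2"
    using assms by (auto simp: L_def Sigma_plus_def)
  then show ?thesis
  proof (elim disjE)
    assume X1: "X \<in> L1"
    then obtain A D where X: "X = block_matrix A 0 0 D"
      unfolding L1_def by blast
    show ?thesis
      by (rule disjI1) (use assms X1 pos in \<open>simp add: X minor_block_matrix det_block_diagonal det_zero_matrix\<close>)
  next
    assume X2: "X \<in> L2"
    then obtain B C where X: "X = block_matrix 0 B C 0"
      unfolding L2_def by blast
    show ?thesis
      by (rule disjI2) (use assms X2 pos in
        \<open>simp add: X minor_block_matrix det_block_antidiagonal det_zero_matrix mult.commute[of "det B"]\<close>)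
  qed
qed

lemma L_Inl_Inr_minor_zero:
  fixes X :: "real^('n::finite + 'n)^('n + 'n)"
  assumes "X \<in> L"
  shows "minor Inl Inl X * minor Inl Inr X = 0"
  using assms by (auto simp: L_def L1_def L2_def minor_block_matrix det_zero_matrix)

lemma young_average_cmult:
  "young_average \<Omega> \<nu> \<psi> w \<Longrightarrow> young_average \<Omega> \<nu> (\<lambda>X. s * \<psi> X) (\<lambda>x. s * w x)"
  unfolding young_average_def by (auto elim: eventually_mono)

text \<open>The product ab vanishes on \<open>L\<close>, so the weighted average of a or of b is 0.
  In the first case ad has average 0, which leaves no mass where ad is positive, namely on
  \<open>L1\<close>; in the second case cb does the same for \<open>L2\<close>. The neighbourhood is
  the set where the cutoff is nonzero.\<close>

lemma local_dichotomy:
  fixes \<Omega> :: "(real^('n::finite + 'n)) set"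
    and \<nu> :: "real^('n + 'n) \<Rightarrow> (real^('n + 'n)^('n + 'n)) measure"
  assumes n: "CARD('n) \<ge> 2" and \<Omega>: "bounded \<Omega>" "open \<Omega>"
    and ym: "gradient_young_measure (real (2 * CARD('n))) \<Omega> \<nu>"
    and A: "supported_in \<Omega> \<nu> (L \<inter> Sigma_plus)" and z: "z \<in> \<Omega>"
  shows "\<exists>U. open U \<and> z \<in> U \<and>
    ((AE x in lebesgue_on \<Omega>. x \<in> U \<longrightarrow> emeasure (\<nu> x) (UNIV - (L1 \<inter> Sigma_plus)) = 0) \<or>
     (AE x in lebesgue_on \<Omega>. x \<in> U \<longrightarrow> emeasure (\<nu> x) (UNIV - (L2 \<inter> Sigma_plus)) = 0))"
proof -
  obtain \<kappa> where \<kappa>: "\<kappa> > 0" and cube: "\<And>y. (\<And>c. \<bar>y $ c - z $ c\<bar> \<le> 2 * \<kappa>) \<Longrightarrow> y \<in> \<Omega>"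
    using small_cube[OF \<Omega>(2) z] by blast
  define \<Phi> where "\<Phi> x = (box_bump z \<kappa> x)\<^sup>2" for x
  define U where "U = {x. \<Phi> x \<noteq> 0}"
  have \<Phi>_cont: "continuous_on UNIV \<Phi>"
    unfolding \<Phi>_def by (intro continuous_on_power cc_function_continuous cc_function_box_bump \<kappa>)
  have \<Phi>_bounds: "0 \<le> \<Phi> x" "\<Phi> x \<le> 1" for x
    unfolding \<Phi>_def using box_bump_nonneg[of z \<kappa> x] box_bump_le_1[of z \<kappa> x] by (simp_all add: power_le_one)
  have U: "open U" "z \<in> U"
  proof -
    show "open U"
      unfolding U_def by (intro open_Collect_neq \<Phi>_cont continuous_on_const)
    show "z \<in> U"
      using \<kappa> box_bump_nonzero_iff[OF \<kappa>, of z z] by (simp add: U_def \<Phi>_def)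
  qed
  have \<Phi>_int: "(LINT x|lborel. \<Phi> x) \<noteq> 0"
    using cc_function_square_integral_zero[OF cc_function_box_bump[OF \<kappa>], of z z] U(2)
    by (auto simp: U_def \<Phi>_def power2_eq_square)
  have \<nu>: "\<nu> \<in> \<Omega> \<rightarrow> space (prob_algebra borel)"
    using ym unfolding gradient_young_measure_def by blast
  have p: "2 * CARD('n) > 0" by simp
  obtain a where a: "young_average \<Omega> \<nu> (minor (Inl :: 'n \<Rightarrow> _) Inl) a"
    using young_average_exists[OF ym minor_power_growth(1) p] by blast
  obtain b where b: "young_average \<Omega> \<nu> (minor (Inl :: 'n \<Rightarrow> _) Inr) b"
    using young_average_exists[OF ym minor_power_growth(1) p] by blast
  obtain c where c: "young_average \<Omega> \<nu> (minor (Inr :: 'n \<Rightarrow> _) Inl) c"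
    using young_average_exists[OF ym minor_power_growth(1) p] by blast
  obtain d where d: "young_average \<Omega> \<nu> (minor (Inr :: 'n \<Rightarrow> _) Inr) d"
    using young_average_exists[OF ym minor_power_growth(1) p] by blast
  obtain ad where ad: "young_average \<Omega> \<nu> (\<lambda>X. minor (Inl :: 'n \<Rightarrow> _) Inl X * minor (Inr :: 'n \<Rightarrow> _) Inr X) ad"
    using young_average_exists[OF ym minor_power_growth(2) p] by blast
  obtain cb where cb: "young_average \<Omega> \<nu> (\<lambda>X. minor (Inr :: 'n \<Rightarrow> _) Inl X * minor (Inl :: 'n \<Rightarrow> _) Inr X) cb"
    using young_average_exists[OF ym minor_power_growth(2) p] by blast
  obtain ab where ab: "young_average \<Omega> \<nu> (\<lambda>X. minor (Inl :: 'n \<Rightarrow> _) Inl X * minor (Inl :: 'n \<Rightarrow> _) Inr X) ab"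
    using young_average_exists[OF ym minor_power_growth(2) p] by blast
  have range: "range (Inr :: 'n \<Rightarrow> 'n + 'n) = - range Inl"
  proof (intro set_eqI iffI)
    fix x :: "'n + 'n"
    assume "x \<in> - range Inl"
    then show "x \<in> range Inr" by (cases x) auto
  qed auto
  have mix: "minor I (\<lambda>b. if Inl b = l then k else Inl b) X = 0" "minor I (\<lambda>b. if Inr b = k then l else Inr b) X = 0"
    if "X \<in> L \<inter> Sigma_plus" "l \<in> range Inl" "k \<in> range Inr" "I = Inl \<or> I = Inr"
    for X :: "real^('n + 'n)^('n + 'n)" and k l and I :: "'n \<Rightarrow> 'n + 'n"
    using that mixed_minors_vanish[OF n, of X I] by auto
  \<comment> \<open>Stated for all choices of row groups, so that the pairs (a, b), (a, d) and (c,
    b) are instances of one identity.\<close>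
  have product: "(LINT x|lborel. \<Phi> x) * (LINT x|lebesgue_on \<Omega>. w x * \<Phi> x)
      = (LINT x|lebesgue_on \<Omega>. u x * \<Phi> x) * (LINT x|lebesgue_on \<Omega>. v x * \<Phi> x)"
    if "I = Inl \<or> I = Inr" "J = Inl \<or> J = Inr"
      and "young_average \<Omega> \<nu> (minor I Inl) u" "young_average \<Omega> \<nu> (minor J Inr) v"
      and "young_average \<Omega> \<nu> (\<lambda>X. minor I Inl X * minor J Inr X) w"
    for I J :: "'n \<Rightarrow> 'n + 'n" and u v w
    unfolding \<Phi>_def
    using young_measure_product[OF \<Omega> ym inj_Inl inj_Inr range A mix(1)[OF _ _ _ that(1)] mix(2)[OF _ _ _ that(2)] \<kappa> cube that(3-5)]
    by blast
  have "AE x in lebesgue_on \<Omega>. ab x = 0"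
    by (rule young_average_zero[OF \<nu> A ab]) (simp add: L_Inl_Inr_minor_zero)
  then have "AE x in lebesgue_on \<Omega>. ab x * \<Phi> x = 0"
    by eventually_elim simp
  then have "(LINT x|lebesgue_on \<Omega>. ab x * \<Phi> x) = 0"
    by (rule integral_eq_zero_AE)
  then have "(LINT x|lebesgue_on \<Omega>. a x * \<Phi> x) = 0 \<or> (LINT x|lebesgue_on \<Omega>. b x * \<Phi> x) = 0"
    using product[OF _ _ a b ab] by simp
  then show ?thesis
  proof
    assume "(LINT x|lebesgue_on \<Omega>. a x * \<Phi> x) = 0"
    then have zero: "(LINT x|lebesgue_on \<Omega>. ad x * \<Phi> x) = 0"
      using product[OF _ _ a d ad] \<Phi>_int by simp
    have "AE x in lebesgue_on \<Omega>. \<Phi> x \<noteq> 0 \<longrightarrow> emeasure (\<nu> x) (UNIV - (L2 \<inter> Sigma_plus)) = 0"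
      by (rule AE_support_of_young_average_zero[OF \<nu> A _ _ _ ad \<Phi>_cont \<Phi>_bounds zero])
        (use diagonal_minors_cases in \<open>force simp: borel_L1_L2 borel_Sigma_plus\<close>)+
    then have "AE x in lebesgue_on \<Omega>. x \<in> U \<longrightarrow> emeasure (\<nu> x) (UNIV - (L2 \<inter> Sigma_plus)) = 0"
      by (simp add: U_def)
    with U show ?thesis
      by (intro exI[of _ U]) simp
  next
    assume "(LINT x|lebesgue_on \<Omega>. b x * \<Phi> x) = 0"
    then have "(LINT x|lebesgue_on \<Omega>. cb x * \<Phi> x) = 0"
      using product[OF _ _ c b cb] \<Phi>_int by simp
    \<comment> \<open>The determinant of \<open>block_swap\<close> is inserted because cb alone has
      the sign (-1)^n on \<open>L2\<close>; with this factor the integrand is nonnegative on the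
      support.\<close>
    then have zero: "(LINT x|lebesgue_on \<Omega>. det (block_swap :: real^('n + 'n)^('n + 'n)) * cb x * \<Phi> x) = 0"
      by (simp add: mult.assoc)
    have "AE x in lebesgue_on \<Omega>. \<Phi> x \<noteq> 0 \<longrightarrow> emeasure (\<nu> x) (UNIV - (L1 \<inter> Sigma_plus)) = 0"
      by (rule AE_support_of_young_average_zero[OF \<nu> A _ _ _ young_average_cmult[OF cb] \<Phi>_cont \<Phi>_bounds zero])
        (use diagonal_minors_cases in \<open>force simp: borel_L1_L2 borel_Sigma_plus\<close>)+
    then have "AE x in lebesgue_on \<Omega>. x \<in> U \<longrightarrow> emeasure (\<nu> x) (UNIV - (L1 \<inter> Sigma_plus)) = 0"
      by (simp add: U_def)
    with U show ?thesis
      by (intro exI[of _ U]) simp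
  qed
qed

text \<open>The unions of all open sets on which one alternative holds almost everywhere form an
  open cover by two sets. By the Lindelof property each alternative still holds almost everywhere on
  its whole union, although the family may be uncountable; connectedness then selects one of
  them.\<close>

lemma AE_dichotomy_connected:
  fixes \<Omega> :: "'a::euclidean_space set"
  assumes \<Omega>: "open \<Omega>" "connected \<Omega>" and excl: "\<And>x. x \<in> \<Omega> \<Longrightarrow> \<not> (P x \<and> Q x)"
    and local: "\<And>z. z \<in> \<Omega> \<Longrightarrow> \<exists>U. open U \<and> z \<in> U \<and>
      ((AE x in lebesgue_on \<Omega>. x \<in> U \<longrightarrow> P x) \<or> (AE x in lebesgue_on \<Omega>. x \<in> U \<longrightarrow> Q x))"
  shows "(AE x in lebesgue_on \<Omega>. P x) \<or> (AE x in lebesgue_on \<Omega>. Q x)"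
proof -
  define good where "good R = {U. open U \<and> (AE x in lebesgue_on \<Omega>. x \<in> U \<longrightarrow> R x)}" for R :: "'a \<Rightarrow> bool"
  have cover_AE: "AE x in lebesgue_on \<Omega>. R x" if "\<Omega> \<subseteq> \<Union>(good R)" for R
  proof -
    obtain F where F: "F \<subseteq> good R" "countable F" "\<Union>F = \<Union>(good R)"
      by (rule Lindelof[of "good R"]) (auto simp: good_def)
    have "AE x in lebesgue_on \<Omega>. \<forall>U\<in>F. x \<in> U \<longrightarrow> R x"
      using F by (subst AE_ball_countable) (auto simp: good_def)
    moreover have "AE x in lebesgue_on \<Omega>. x \<in> \<Omega>"
      by (rule AE_I2) simp
    ultimately show ?thesis
    proof eventually_elim
      case (elim x)
      then have "x \<in> \<Union>F"
        using F(3) that by auto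
      with elim show ?case by blast
    qed
  qed
  have open_good: "open (\<Union>(good R))" for R
    by (rule open_Union) (simp add: good_def)
  have "\<Omega> \<subseteq> \<Union>(good P) \<union> \<Union>(good Q)"
  proof
    fix z assume "z \<in> \<Omega>"
    from local[OF this] show "z \<in> \<Union>(good P) \<union> \<Union>(good Q)"
      unfolding good_def by blast
  qed
  moreover have "\<Union>(good P) \<inter> \<Union>(good Q) \<inter> \<Omega> = {}"
  proof (rule ccontr)
    assume "\<Union>(good P) \<inter> \<Union>(good Q) \<inter> \<Omega> \<noteq> {}"
    then obtain z U V where UV: "U \<in> good P" "V \<in> good Q" "z \<in> U \<inter> V \<inter> \<Omega>" by blast
    have "AE x in lebesgue_on \<Omega>. x \<in> U \<longrightarrow> P x" "AE x in lebesgue_on \<Omega>. x \<in> V \<longrightarrow> Q x"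
      using UV by (auto simp: good_def)
    moreover have "AE x in lebesgue_on \<Omega>. x \<in> \<Omega>"
      by (rule AE_I2) simp
    \<comment> \<open>On the overlap both alternatives would hold almost everywhere, which
      \<open>excl\<close> forbids at every point, so the overlap is null. Being open, it is
      empty.\<close>
    ultimately have "AE x in lebesgue_on \<Omega>. x \<notin> U \<inter> V \<inter> \<Omega>"
      by eventually_elim (use excl in blast)
    then have "AE x in lebesgue. x \<in> \<Omega> \<longrightarrow> x \<notin> U \<inter> V \<inter> \<Omega>"
      using \<Omega>(1) by (subst (asm) AE_restrict_space_iff) auto
    then have "AE x in lebesgue. x \<notin> U \<inter> V \<inter> \<Omega>"
      by eventually_elim blast
    then have "negligible (U \<inter> V \<inter> \<Omega>)"
      by (subst negligible_iff_null_sets) (use UV \<Omega>(1) in \<open>simp add: AE_iff_null_sets good_def open_Int borel_open\<close>)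
    moreover have "open (U \<inter> V \<inter> \<Omega>)"
      using UV \<Omega> by (auto simp: good_def)
    ultimately show False
      using UV(3) open_not_negligible by blast
  qed
  ultimately have "\<Omega> \<subseteq> \<Union>(good P) \<or> \<Omega> \<subseteq> \<Union>(good Q)"
    using connectedD[OF \<Omega>(2) open_good[of P] open_good[of Q]] by blast
  then show ?thesis
    using cover_AE by blast
qed

theorem theorem1p12:
  fixes \<Omega> :: "(real^('n::finite + 'n)) set"
    and \<nu> :: "real^('n + 'n) \<Rightarrow> (real^('n + 'n)^('n + 'n)) measure"
  assumes "CARD('n) \<ge> 2"
    and "bounded \<Omega>" and "open \<Omega>" and "connected \<Omega>"
    and "gradient_young_measure (real (2 * CARD('n))) \<Omega> \<nu>"
    and "supported_in \<Omega> \<nu> (L \<inter> Sigma_plus)"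
  shows "supported_in \<Omega> \<nu> (L1 \<inter> Sigma_plus) \<or> supported_in \<Omega> \<nu> (L2 \<inter> Sigma_plus)"
proof -
  have borel: "L1 \<inter> Sigma_plus \<in> sets (borel :: (real^('n + 'n)^('n + 'n)) measure)"
    "L2 \<inter> Sigma_plus \<in> sets (borel :: (real^('n + 'n)^('n + 'n)) measure)"
    using borel_L1_L2 borel_Sigma_plus by (auto intro: sets.Int)
  \<comment> \<open>The two subspaces meet only in the zero matrix, whose determinant is not
    positive. A probability measure cannot be concentrated on both of two disjoint sets, and this
    gives the exclusion needed for patching.\<close>
  have disjoint: "(L1 \<inter> Sigma_plus) \<inter> (L2 \<inter> Sigma_plus) = ({} :: (real^('n + 'n)^('n + 'n)) set)"
  proof -
    have "det X = 0" if "X \<in> L1" "X \<in> L2" for X :: "real^('n + 'n)^('n + 'n)"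
    proof -
      have "X = 0"
        using that unfolding L1_eq L2_eq by (intro matrix_eq_blocks) auto
      then show ?thesis
        by (simp add: det_zero_matrix)
    qed
    then show ?thesis
      by (auto simp: Sigma_plus_def)
  qed
  have excl: "\<not> (emeasure (\<nu> x) (UNIV - (L1 \<inter> Sigma_plus)) = 0 \<and> emeasure (\<nu> x) (UNIV - (L2 \<inter> Sigma_plus)) = 0)"
    if "x \<in> \<Omega>" for x
  proof
    assume "emeasure (\<nu> x) (UNIV - (L1 \<inter> Sigma_plus)) = 0 \<and> emeasure (\<nu> x) (UNIV - (L2 \<inter> Sigma_plus)) = 0"
    moreover have sets: "sets (\<nu> x) = sets borel" and prob: "prob_space (\<nu> x)"
      using assms(5) that unfolding gradient_young_measure_def by (auto simp: space_prob_algebra)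
    have "UNIV - (L1 \<inter> Sigma_plus) \<in> sets (\<nu> x)" "UNIV - (L2 \<inter> Sigma_plus) \<in> sets (\<nu> x)"
      unfolding sets using borel by (metis borel_comp Compl_eq_Diff_UNIV)+
    ultimately have "(UNIV - (L1 \<inter> Sigma_plus)) \<union> (UNIV - (L2 \<inter> Sigma_plus)) \<in> null_sets (\<nu> x)"
      by (intro null_sets.Un null_setsI) auto
    moreover have "(UNIV - (L1 \<inter> Sigma_plus)) \<union> (UNIV - (L2 \<inter> Sigma_plus)) = space (\<nu> x)"
      using disjoint sets_eq_imp_space_eq[OF sets] by auto
    ultimately have "emeasure (\<nu> x) (space (\<nu> x)) = 0"
      by auto
    then show False
      using prob_space.emeasure_space_1[OF prob] by simp
  qed
  show ?thesis
    using AE_dichotomy_connected[OF assms(3,4) excl local_dichotomy[OF assms(1,2,3,5,6)]] borel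
    unfolding supported_in_def by blast
qed

end
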